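(* Let $q\geq 2$ and $n\geq 0$ be integers and let $\eta,\varepsilon\in(0,1)$. Suppose $\xi_1,\ldots,\xi_N\in\mathbb{S}^q$ are drawn independently and identically distributed according to $\sigma_q$. If $$N>\log\left(\frac{2\dim(\Pi_n^q)}{\varepsilon}\right)\frac{3\dim(\Pi_n^q)}{\eta^2},$$ then with probability exceeding $1-\varepsilon$ with respect to the product measure $\mathbb{P}=\sigma_q^{\otimes N}$, we have $$(1-\eta)\|P\|_{\sigma_q,2}^2\leq\frac1N\sum_{j=1}^N|P(\xi_j)|^2\leq(1+\eta)\|P\|_{\sigma_q,2}^2$$ for all $P\in\Pi_n^q$.
   Context: $\mathbb{S}^q=\{x\in\mathbb{R}^{q+1}:|x|_2=1\}$ is the unit sphere, $\mu_q$ its surface measure, $\omega_q=\mu_q(\mathbb{S}^q)$, and $\sigma_q=\frac{1}{\omega_q}\mu_q$ the normalized surface measure. $\Pi_n^q$ is the complex vector space of spherical harmonics of degree at most $n$, i.e. $\Pi_n^q=\bigoplus_{\ell=0}^n\mathcal{H}_\ell^q$ where $\mathcal{H}_\ell^q$ is the space of restrictions to $\mathbb{S}^q$ of complex-valued harmonic homogeneous polynomials of degree $\ell$ on $\mathbb{R}^{q+1}$; $\dim$ is the dimension over $\mathbb{C}$. $\|f\|_{\sigma_q,2}=(\int_{\mathbb{S}^q}|f|^2\,d\sigma_q)^{1/2}$, and $\log$ is the natural logarithm. *)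

theory Defs
  imports
    "HOL-Probability.Probability"
    "HOL-Library.Function_Algebras"
begin

text \<open>
  Throughout, \<open>real ^ 'n\<close> with \<open>CARD('n) = q + 1\<close> plays the role of $\mathbb{R}^{q+1}$,
  and \<open>sphere 0 1\<close> is the unit sphere $\mathbb{S}^q$.
\<close>

section \<open>Surface measure\<close>

text \<open>
  The surface measure is the measure $\mu$ on the Borel sets of the unit sphere for which Lebesgue
  measure is $r^q\,dr\,d\mu$ in polar coordinates, i.e.
  $\mu(E) = (q+1)\,\lambda(\{r x : 0 < r \le 1,\ x \in E\})$.  The image measure below encodes this,
  the preimage of \<open>E\<close> under \<open>x \<mapsto> x / |x|\<close> in the punctured unit ball being the cone over \<open>E\<close>.
\<close>

definition surface_measure :: "(real ^ 'n) measure" where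
  "surface_measure =
     scale_measure (of_nat CARD('n))
       (distr (restrict_space lborel (cball 0 1 - {0})) (restrict_space borel (sphere 0 1))
          (\<lambda>x. x /\<^sub>R norm x))"

definition normalized_surface_measure :: "(real ^ 'n) measure" where
  "normalized_surface_measure =
     scale_measure (1 / emeasure surface_measure (sphere (0 :: real ^ 'n) 1)) surface_measure"

lemma space_surface_measure [simp]:
  "space (surface_measure :: (real ^ 'n) measure) = sphere 0 1"
  by (simp add: surface_measure_def space_scale_measure space_restrict_space)

lemma sets_surface_measure [simp, measurable_cong]:
  "sets (surface_measure :: (real ^ 'n) measure) = sets (restrict_space borel (sphere 0 1))"
  by (simp add: surface_measure_def)

lemma measurable_radial_projection:
  "(\<lambda>x. x /\<^sub>R norm x) \<in> restrict_space lborel (cball 0 1 - {0 :: real ^ 'n})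
     \<rightarrow>\<^sub>M restrict_space borel (sphere 0 1)"
  by (rule measurable_restrict_space2, force simp: space_restrict_space,
      rule measurable_restrict_space1, measurable)

lemma emeasure_surface_measure:
  fixes E :: "(real ^ 'n) set"
  assumes E: "E \<in> sets borel" "E \<subseteq> sphere 0 1"
  shows "emeasure surface_measure E =
    of_nat CARD('n) * emeasure lborel {r *\<^sub>R x |r x. 0 < r \<and> r \<le> 1 \<and> x \<in> E}"
proof -
  let ?B = "cball 0 1 - {0 :: real ^ 'n}"
  have "(\<lambda>x. x /\<^sub>R norm x) -` E \<inter> ?B = {r *\<^sub>R x |r x. 0 < r \<and> r \<le> 1 \<and> x \<in> E}"
  proof (intro equalityI subsetI)
    fix y assume y: "y \<in> (\<lambda>x. x /\<^sub>R norm x) -` E \<inter> ?B"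
    then have "y = norm y *\<^sub>R (y /\<^sub>R norm y)" by simp
    with y show "y \<in> {r *\<^sub>R x |r x. 0 < r \<and> r \<le> 1 \<and> x \<in> E}"
      by (auto intro!: exI[of _ "norm y"] exI[of _ "y /\<^sub>R norm y"])
  next
    fix y assume "y \<in> {r *\<^sub>R x |r x. 0 < r \<and> r \<le> 1 \<and> x \<in> E}"
    then obtain r x where "y = r *\<^sub>R x" "0 < r" "r \<le> 1" "x \<in> E" by auto
    moreover from this E have "norm x = 1" by auto
    ultimately show "y \<in> (\<lambda>x. x /\<^sub>R norm x) -` E \<inter> ?B" by auto
  qed
  moreover from this have "{r *\<^sub>R x |r x. 0 < r \<and> r \<le> 1 \<and> x \<in> E} \<subseteq> ?B"
    by blast
  moreover have "E \<in> sets (restrict_space borel (sphere 0 1))"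
    using E by (subst sets_restrict_space_iff) auto
  ultimately show ?thesis
    by (simp add: surface_measure_def emeasure_distr[OF measurable_radial_projection]
        space_restrict_space emeasure_restrict_space)
qed

lemma emeasure_surface_measure_sphere:
  "emeasure surface_measure (sphere (0 :: real ^ 'n) 1) =
     ennreal (real CARD('n) * unit_ball_vol (real CARD('n)))"
proof -
  have "{r *\<^sub>R x |r x. 0 < r \<and> r \<le> 1 \<and> x \<in> sphere (0 :: real ^ 'n) 1} = cball 0 1 - {0}"
  proof (intro equalityI subsetI)
    fix y :: "real ^ 'n" assume y: "y \<in> cball 0 1 - {0}"
    then have "y = norm y *\<^sub>R (y /\<^sub>R norm y)" by simp
    with y show "y \<in> {r *\<^sub>R x |r x. 0 < r \<and> r \<le> 1 \<and> x \<in> sphere (0 :: real ^ 'n) 1}"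
      by (auto intro!: exI[of _ "norm y"] exI[of _ "y /\<^sub>R norm y"])
  qed auto
  then have "emeasure surface_measure (sphere (0 :: real ^ 'n) 1) =
      of_nat CARD('n) * emeasure lborel (cball (0 :: real ^ 'n) 1 - {0})"
    by (subst emeasure_surface_measure) auto
  also have "emeasure lborel (cball (0 :: real ^ 'n) 1 - {0}) = emeasure lborel (cball (0 :: real ^ 'n) 1)"
    by (rule emeasure_Diff_null_set) auto
  also have "\<dots> = ennreal (unit_ball_vol (real CARD('n)))"
    by (subst emeasure_cball) auto
  finally show ?thesis
    by (simp add: ennreal_mult ennreal_of_nat_eq_real_of_nat)
qed

lemma prob_space_normalized_surface_measure:
  "prob_space (normalized_surface_measure :: (real ^ 'n) measure)"
proof
  have "unit_ball_vol (real CARD('n)) > 0" by simp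
  then have "unit_ball_vol (real CARD('n)) \<noteq> 0" by (rule less_imp_neq[symmetric])
  with \<open>unit_ball_vol (real CARD('n)) > 0\<close> show "emeasure (normalized_surface_measure :: (real ^ 'n) measure)
      (space normalized_surface_measure) = 1"
    unfolding normalized_surface_measure_def
    by (simp only: space_scale_measure space_surface_measure emeasure_scale_measure
        emeasure_surface_measure_sphere)
       (simp add: divide_ennreal ennreal_mult' [symmetric] flip: ennreal_1)
qed

definition sphere_L2_norm :: "(real ^ 'n \<Rightarrow> complex) \<Rightarrow> real" where
  "sphere_L2_norm f = sqrt (LINT x|normalized_surface_measure. (cmod (f x))\<^sup>2)"


section \<open>Spherical harmonics\<close>

definition homogeneous_polynomials :: "nat \<Rightarrow> (real ^ 'n \<Rightarrow> complex) set" where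
  "homogeneous_polynomials l =
     {p. \<exists>c :: ('n \<Rightarrow> nat) \<Rightarrow> complex.
        \<forall>x. p x = (\<Sum>\<alpha> | (\<Sum>i\<in>UNIV. \<alpha> i) = l. c \<alpha> * of_real (\<Prod>i\<in>UNIV. x $ i ^ \<alpha> i))}"

definition partial_derivative :: "'n \<Rightarrow> (real ^ 'n \<Rightarrow> complex) \<Rightarrow> real ^ 'n \<Rightarrow> complex" where
  "partial_derivative i f x = vector_derivative (\<lambda>t. f (x + t *\<^sub>R axis i 1)) (at 0)"

definition laplacian :: "(real ^ 'n \<Rightarrow> complex) \<Rightarrow> real ^ 'n \<Rightarrow> complex" where
  "laplacian f x = (\<Sum>i\<in>UNIV. partial_derivative i (partial_derivative i f) x)"

text \<open>
  A function on the sphere is represented by its extension by \<open>0\<close>, so that the pointwise operations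
  on \<open>real ^ 'n \<Rightarrow> complex\<close> are those of functions on the sphere.
\<close>

definition spherical_harmonics :: "nat \<Rightarrow> (real ^ 'n \<Rightarrow> complex) set" where
  "spherical_harmonics l =
     {(\<lambda>x. if x \<in> sphere 0 1 then p x else 0) |p.
        p \<in> homogeneous_polynomials l \<and> (\<forall>x. laplacian p x = 0)}"

definition spherical_harmonics_upto :: "nat \<Rightarrow> (real ^ 'n \<Rightarrow> complex) set" where
  "spherical_harmonics_upto n =
     {(\<lambda>x. \<Sum>l\<le>n. Y l x) |Y. \<forall>l\<le>n. Y l \<in> spherical_harmonics l}"

definition cfun_scale :: "complex \<Rightarrow> ('a \<Rightarrow> complex) \<Rightarrow> 'a \<Rightarrow> complex" where
  "cfun_scale c f = (\<lambda>x. c * f x)"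

lemma vector_space_cfun_scale: "vector_space cfun_scale"
  by unfold_locales (auto simp: cfun_scale_def fun_eq_iff algebra_simps)

abbreviation complex_dim :: "('a \<Rightarrow> complex) set \<Rightarrow> nat" where
  "complex_dim \<equiv> vector_space.dim cfun_scale"

end

(*
Expand P in an orthonormal basis (Y_k) of the space, of dimension d, and put v_j = (conj (Y_k (xi_j)))_k.
The claim says that the spectrum of the sum of the rank-one matrices v_j v_j^H lies in
[(1 - eta) N, (1 + eta) N].  Rotation invariance forces |v_j|^2 = d, and orthonormality makes the
expectation of v_j v_j^H the identity, so this is a matrix Chernoff bound.  It follows from
  E tr exp (A + t v v^H) <= (1 + (exp (t d) - 1) / d) tr exp A
for t of either sign, by induction on the number of samples, Markov's inequality and
t = ln (1 + eta) / d or t = ln (1 - eta) / d.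

For negative t the operators are kept positive semidefinite by starting from a multiple of the identity.

The trace inequality is a rank-one Golden-Thompson inequality with an elementary proof: along
s |-> A + s v v^H the derivative of tr exp is g(s) = <exp (A + s v v^H) v, v>, and g' <= d g, because
the moments a_k = <A^k v, v> of a positive semidefinite A are log-convex, so that
a_k a_l <= a_0 a_(k+l) with a_0 = d.
*)

theory Submission
  imports Defs
begin

section \<open>Powers of positive semidefinite operators\<close>

text \<open>A and v v^H do not commute, so exp (A + s v v^H) has no usable closed form. Everything
  is therefore read off the numbers <A^k v, v> and tr A^m, summed as power series: positivity
  permits termwise comparison, and neither eigenvalues nor an operator exponential are ever formed.
  The comparisons hold between positive semidefinite operators only, so a downward step is read
  backwards, as an upward step from the smaller operator. The initial multiple c of the identity
  inflates the trace by exp c, but it moves the threshold in Markov's inequality by the same amount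
  and cancels. One sample costs a factor 1 + (exp (t d) - 1) / d \<le> exp ((exp (t d) - 1) / d),
  and the choices of t minimise the resulting exponent. The constant 3 comes from (1 + x) ln (1 + x)
  - x \<ge> x^2 / 3 on (0, 1). In 2 dim, the dimension is the trace of the identity and the 2 counts
  the tails.\<close>

definition ip :: "'i set \<Rightarrow> ('i \<Rightarrow> complex) \<Rightarrow> ('i \<Rightarrow> complex) \<Rightarrow> complex" where
  "ip I x y = (\<Sum>i\<in>I. x i * cnj (y i))"

text \<open>
  Vectors are functions on the whole index type, and only the coordinates in \<open>I\<close> matter: the index
  set will be an orthonormal basis, whose cardinality is not available as a type.
\<close>

definition psd_op :: "'i set \<Rightarrow> (('i \<Rightarrow> complex) \<Rightarrow> ('i \<Rightarrow> complex)) \<Rightarrow> bool" where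
  "psd_op I A \<longleftrightarrow>
     (\<forall>x y. A (x + y) = A x + A y) \<and> (\<forall>c x. A (cfun_scale c x) = cfun_scale c (A x)) \<and>
     (\<forall>x y. ip I (A x) y = ip I x (A y)) \<and> (\<forall>x. 0 \<le> Re (ip I (A x) x))"

text \<open>For self-adjoint A, the k-th moment of the spectral measure of A at x. Correspondingly,
  \<open>trace_pow\<close>, \<open>trace_exp\<close> and \<open>qf_exp\<close> are tr A^m, tr exp A
  and <exp A v, v>, the exponentials being power series in these moments.\<close>

definition qf :: "'i set \<Rightarrow> (('i \<Rightarrow> complex) \<Rightarrow> ('i \<Rightarrow> complex)) \<Rightarrow> nat \<Rightarrow> ('i \<Rightarrow> complex) \<Rightarrow> real" where
  "qf I A k x = Re (ip I ((A ^^ k) x) x)"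

text \<open>The operator A + s v v^H, with s of either sign.\<close>

definition rank_one_update ::
    "'i set \<Rightarrow> (('i \<Rightarrow> complex) \<Rightarrow> ('i \<Rightarrow> complex)) \<Rightarrow> real \<Rightarrow> ('i \<Rightarrow> complex) \<Rightarrow>
      (('i \<Rightarrow> complex) \<Rightarrow> ('i \<Rightarrow> complex))" where
  "rank_one_update I A s v x = A x + cfun_scale (of_real s * ip I x v) v"

definition unit_vec :: "'i \<Rightarrow> 'i \<Rightarrow> complex" where
  "unit_vec i = (\<lambda>j. if j = i then 1 else 0)"

definition trace_pow :: "'i set \<Rightarrow> (('i \<Rightarrow> complex) \<Rightarrow> ('i \<Rightarrow> complex)) \<Rightarrow> nat \<Rightarrow> real" where
  "trace_pow I A m = (\<Sum>i\<in>I. qf I A m (unit_vec i))"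

definition trace_exp :: "'i set \<Rightarrow> (('i \<Rightarrow> complex) \<Rightarrow> ('i \<Rightarrow> complex)) \<Rightarrow> real" where
  "trace_exp I A = (\<Sum>m. trace_pow I A m / fact m)"

definition qf_exp :: "'i set \<Rightarrow> (('i \<Rightarrow> complex) \<Rightarrow> ('i \<Rightarrow> complex)) \<Rightarrow> ('i \<Rightarrow> complex) \<Rightarrow> real" where
  "qf_exp I A v = (\<Sum>m. qf I A m v / fact m)"

section \<open>Inner product and powers of a self-adjoint operator\<close>

lemma ip_add_left: "ip I (x + y) z = ip I x z + ip I y z"
  by (simp add: ip_def algebra_simps sum.distrib)

lemma ip_add_right: "ip I z (x + y) = ip I z x + ip I z y"
  by (simp add: ip_def algebra_simps sum.distrib)

lemma ip_scale_left: "ip I (cfun_scale c x) z = c * ip I x z"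
  by (simp add: ip_def cfun_scale_def sum_distrib_left mult.assoc)

lemma ip_scale_right: "ip I z (cfun_scale c x) = cnj c * ip I z x"
  by (simp add: ip_def cfun_scale_def sum_distrib_left algebra_simps)

lemma cnj_ip: "cnj (ip I x y) = ip I y x"
  by (simp add: ip_def mult.commute)

lemma ip_self: "ip I x x = of_real (\<Sum>i\<in>I. (cmod (x i))\<^sup>2)"
  by (simp only: ip_def complex_norm_square of_real_sum)

lemma ip_unit_right: "finite I \<Longrightarrow> i \<in> I \<Longrightarrow> ip I x (unit_vec i) = x i"
  unfolding ip_def unit_vec_def by (subst sum.remove[of _ i]) (auto intro!: sum.neutral)

lemma ip_unit_left: "finite I \<Longrightarrow> i \<in> I \<Longrightarrow> ip I (unit_vec i) x = cnj (x i)"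
  by (metis cnj_ip ip_unit_right)

lemma cmod_ip_le: "(cmod (ip I x y))\<^sup>2 \<le> (\<Sum>i\<in>I. (cmod (x i))\<^sup>2) * (\<Sum>i\<in>I. (cmod (y i))\<^sup>2)"
proof -
  have "cmod (ip I x y) \<le> (\<Sum>i\<in>I. cmod (x i) * cmod (y i))"
    unfolding ip_def by (rule order_trans[OF norm_sum]) (simp add: norm_mult)
  hence "(cmod (ip I x y))\<^sup>2 \<le> (\<Sum>i\<in>I. cmod (x i) * cmod (y i))\<^sup>2"
    by (intro power_mono) auto
  also have "\<dots> \<le> (\<Sum>i\<in>I. (cmod (x i))\<^sup>2) * (\<Sum>i\<in>I. (cmod (y i))\<^sup>2)"
    by (rule Cauchy_Schwarz_ineq_sum)
  finally show ?thesis .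
qed

lemma psd_opD:
  assumes "psd_op I A"
  shows "A (x + y) = A x + A y" "A (cfun_scale c x) = cfun_scale c (A x)"
    "ip I (A x) y = ip I x (A y)" "0 \<le> Re (ip I (A x) x)"
  using assms unfolding psd_op_def by blast+

lemma funpow_linear:
  assumes "psd_op I A"
  shows "(A ^^ k) (x + y) = (A ^^ k) x + (A ^^ k) y"
    "(A ^^ k) (cfun_scale c x) = cfun_scale c ((A ^^ k) x)"
    "ip I ((A ^^ k) x) y = ip I x ((A ^^ k) y)"
proof -
  show "(A ^^ k) (x + y) = (A ^^ k) x + (A ^^ k) y"
    using assms by (induction k) (auto simp: psd_op_def)
  show "(A ^^ k) (cfun_scale c x) = cfun_scale c ((A ^^ k) x)"
    using assms by (induction k) (auto simp: psd_op_def)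
  show "ip I ((A ^^ k) x) y = ip I x ((A ^^ k) y)"
  proof (induction k arbitrary: y)
    case (Suc k)
    have "ip I ((A ^^ Suc k) x) y = ip I ((A ^^ k) x) (A y)"
      by (simp add: psd_opD(3)[OF assms])
    also have "\<dots> = ip I x ((A ^^ Suc k) y)" unfolding Suc by (simp add: funpow_swap1)
    finally show ?case .
  qed simp
qed

text \<open>Splitting the power evenly gives |A^j x|^2 or <A y, y> with y = A^j x, so no square root
  of A is needed.\<close>

lemma qf_nonneg:
  assumes "psd_op I A"
  shows "0 \<le> qf I A k x"
proof (cases "even k")
  case True
  then obtain j where k: "k = j + j" by (metis evenE mult_2)
  have "ip I ((A ^^ k) x) x = ip I ((A ^^ j) x) ((A ^^ j) x)"
    unfolding k funpow_add o_apply by (rule funpow_linear(3)[OF assms])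
  then show ?thesis by (simp add: qf_def ip_self sum_nonneg)
next
  case False
  then obtain j where k: "k = j + Suc j" by (metis oddE add_Suc_right mult_2 Suc_eq_plus1)
  have "ip I ((A ^^ k) x) x = ip I (A ((A ^^ j) x)) ((A ^^ j) x)"
    unfolding k funpow_add o_apply
    by (subst funpow_linear(3)[OF assms]) simp
  then show ?thesis unfolding qf_def using psd_opD(4)[OF assms] by metis
qed

lemma psd_op_funpow: "psd_op I A \<Longrightarrow> psd_op I (A ^^ k)"
  using qf_nonneg[of I A k] funpow_linear[of I A k] by (auto simp: psd_op_def[of I "A ^^ k"] qf_def)

section \<open>Log-convexity of the moments\<close>

lemma quadratic_nonneg_imp:
  fixes a b c :: real
  assumes "\<And>t. 0 \<le> a + 2 * t * b + t\<^sup>2 * c"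
  shows "b\<^sup>2 \<le> a * c"
proof (cases "c = 0")
  case True
  have "b = 0"
  proof (rule ccontr)
    assume "b \<noteq> 0"
    \<comment> \<open>At this t the affine function a + 2 t b takes the value -1.\<close>
    have "0 \<le> a + 2 * (- (a + 1) / (2 * b)) * b"
      using assms[of "- (a + 1) / (2 * b)"] True by simp
    with \<open>b \<noteq> 0\<close> show False by (simp add: field_simps)
  qed
  with True show ?thesis by simp
next
  case False
  have "c > 0"
  proof (rule ccontr)
    assume "\<not> c > 0"
    with False have c: "c < 0" by simp
    \<comment> \<open>A point t \<ge> 1 so far out that t (-c) is at least 2 |b| + |a| + 1; there
      the negative leading term outweighs the other two.\<close>
    define t where "t = (2 * \<bar>b\<bar> + \<bar>a\<bar> + 1) / (- c) + 1"
    have t: "t \<ge> 1" using c by (simp add: t_def divide_nonneg_neg divide_nonpos_neg)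
    have tc: "t * (- c) \<ge> 2 * \<bar>b\<bar> + \<bar>a\<bar> + 1" using c by (simp add: t_def field_simps)
    have "t * (2 * \<bar>b\<bar> + \<bar>a\<bar> + 1) \<le> t * (t * (- c))"
      using tc t by (intro mult_left_mono) auto
    hence "t\<^sup>2 * c \<le> - (t * (2 * \<bar>b\<bar> + \<bar>a\<bar> + 1))" by (simp add: power2_eq_square)
    moreover have "t * b \<le> t * \<bar>b\<bar>" using t by (intro mult_left_mono) auto
    moreover have "a \<le> t * \<bar>a\<bar>" using t mult_right_mono[of 1 t "\<bar>a\<bar>"] by auto
    ultimately show False using assms[of t] t unfolding ring_distribs by linarith
  qed
  have "0 \<le> a + 2 * (- b / c) * b + (- b / c)\<^sup>2 * c" by (rule assms)
  also have "\<dots> = a - b\<^sup>2 / c" using False by (simp add: power2_eq_square field_simps)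
  finally show ?thesis using \<open>c > 0\<close> by (simp add: field_simps)
qed

text \<open>The form <A x, y> may be degenerate, so the inequality is taken from the nonnegative
  quadratic t |-> <A (x + t y), x + t y>. Real t control only the real part, which is all that the
  later estimates use.\<close>

lemma semi_Cauchy_Schwarz:
  assumes "psd_op I A"
  shows "(Re (ip I (A x) y))\<^sup>2 \<le> Re (ip I (A x) x) * Re (ip I (A y) y)"
proof (rule quadratic_nonneg_imp)
  fix t :: real
  have sym: "ip I (A y) x = cnj (ip I (A x) y)"
    by (metis cnj_ip psd_opD(3)[OF assms])
  have "0 \<le> Re (ip I (A (x + cfun_scale t y)) (x + cfun_scale t y))"
    by (rule psd_opD(4)[OF assms])
  also have "\<dots> = Re (ip I (A x) x) + 2 * t * Re (ip I (A x) y) + t\<^sup>2 * Re (ip I (A y) y)"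
    by (simp add: psd_opD(1,2)[OF assms] ip_add_left ip_add_right ip_scale_left ip_scale_right
        sym algebra_simps power2_eq_square)
  finally show "0 \<le> Re (ip I (A x) x) + 2 * t * Re (ip I (A x) y) + t\<^sup>2 * Re (ip I (A y) y)" .
qed

text \<open>Cauchy-Schwarz for the form of A^k, applied to x and A x.\<close>

lemma qf_log_convex:
  assumes "psd_op I A"
  shows "(qf I A (Suc k) x)\<^sup>2 \<le> qf I A k x * qf I A (Suc (Suc k)) x"
proof -
  have "ip I ((A ^^ k) (A x)) (A x) = ip I ((A ^^ Suc (Suc k)) x) x"
    using psd_opD(3)[OF assms, of "(A ^^ Suc k) x" x] by (simp add: funpow_swap1)
  moreover have "ip I ((A ^^ k) x) (A x) = ip I ((A ^^ Suc k) x) x"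
    using psd_opD(3)[OF assms, of "(A ^^ k) x" x] by simp
  ultimately show ?thesis
    using semi_Cauchy_Schwarz[OF psd_op_funpow[OF assms], of k x "A x"]
    by (simp add: qf_def)
qed

text \<open>The ratios of consecutive terms are nondecreasing, so the k ratios leading from a 0 to a
  k are dominated by the k ratios leading from a l to a (k + l).\<close>

lemma log_convex_mult_le:
  fixes a :: "nat \<Rightarrow> real"
  assumes nonneg: "\<And>k. 0 \<le> a k" and lc: "\<And>k. (a (Suc k))\<^sup>2 \<le> a k * a (Suc (Suc k))"
  shows "a k * a l \<le> a 0 * a (k + l)"
proof (cases "\<exists>j. a j = 0")
  case True
  then obtain j where j: "a j = 0" by blast
  \<comment> \<open>A zero forces zeros at every index except possibly 0, as the log-convex sequence
    1, 0, 0, ... shows. Downward propagation therefore stops at 1.\<close>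
  have down: "i \<ge> 1 \<Longrightarrow> i \<le> j \<Longrightarrow> a i = 0" for i
  proof (induction "j - i" arbitrary: i)
    case 0
    with j show ?case by auto
  next
    case (Suc n)
    then have "a (Suc i) = 0" by auto
    with Suc lc[of "i - 1"] show ?case by simp
  qed
  have up: "a (j + i) = 0" for i
    by (induction i) (use j lc in \<open>auto, metis mult_zero_left power2_eq_square sum_power2_le_zero_iff
          add_0 zero_eq_power2 order_antisym zero_le_power2\<close>)
  have z: "a i = 0" if "i \<ge> 1" for i
    using down[OF that] up[of "i - j"] by (cases "i \<le> j") auto
  show ?thesis
    by (cases "k = 0"; cases "l = 0") (auto simp: z mult.commute nonneg)
next
  case False
  with nonneg have pos: "0 < a k" for k by (metis order_le_less)
  define r where "r k = a (Suc k) / a k" for k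
  have "r k \<le> r (Suc k)" for k
    using lc[of k] pos by (simp add: r_def field_simps power2_eq_square)
  hence r: "r k \<le> r (k + l)" for k l
    by (metis lift_Suc_mono_le le_add1)
  have rec: "a (Suc k) = r k * a k" for k using pos[of k] by (simp add: r_def)
  show ?thesis
  proof (induction k)
    case (Suc k)
    have "a (Suc k) * a l = r k * (a k * a l)" by (simp add: rec)
    also have "\<dots> \<le> r k * (a 0 * a (k + l))"
      using Suc pos by (intro mult_left_mono) (auto simp: r_def less_imp_le)
    also have "\<dots> \<le> r (k + l) * (a 0 * a (k + l))"
      using r pos by (intro mult_right_mono) (auto simp: less_imp_le)
    also have "\<dots> = a 0 * a (Suc k + l)" by (simp add: rec)
    finally show ?case .
  qed simp
qed

lemma qf_mult_le:
  assumes "psd_op I A"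
  shows "qf I A k x * qf I A l x \<le> qf I A 0 x * qf I A (k + l) x"
  using assms by (intro log_convex_mult_le qf_nonneg qf_log_convex)

section \<open>Moments bounded by traces\<close>

lemma trace_pow_nonneg: "psd_op I A \<Longrightarrow> 0 \<le> trace_pow I A m"
  unfolding trace_pow_def by (intro sum_nonneg qf_nonneg)

lemma ip_expand:
  assumes "finite I"
  shows "ip I z u = (\<Sum>i\<in>I. ip I z (cfun_scale (u i) (unit_vec i)))"
  using assms by (simp add: ip_scale_right ip_unit_right) (simp add: ip_def mult.commute)

text \<open>The largest eigenvalue of A^m is at most its trace. Without eigenvalues: u is expanded
  in unit vectors, and the semidefinite Cauchy-Schwarz inequality bounds each term by sqrt (q u)
  |u_i| sqrt (q e_i); one factor sqrt (q u) then cancels.\<close>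

lemma qf_le_trace_pow:
  assumes fin: "finite I" and A: "psd_op I A"
  shows "qf I A m u \<le> (\<Sum>i\<in>I. (cmod (u i))\<^sup>2) * trace_pow I A m"
proof -
  define q where "q = qf I A m"
  have q0: "0 \<le> q x" for x by (simp add: q_def qf_nonneg[OF A])
  have qs: "q (cfun_scale c x) = (cmod c)\<^sup>2 * q x" for c x
  proof -
    have "ip I ((A ^^ m) (cfun_scale c x)) (cfun_scale c x) = (c * cnj c) * ip I ((A ^^ m) x) x"
      by (simp add: funpow_linear[OF A] ip_scale_left ip_scale_right)
    then show ?thesis
      unfolding q_def qf_def by (simp flip: complex_norm_square)
  qed
  have "q u = (\<Sum>i\<in>I. Re (ip I ((A ^^ m) u) (cfun_scale (u i) (unit_vec i))))"
    unfolding q_def qf_def by (subst ip_expand[OF fin]) simp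
  also have "\<dots> \<le> (\<Sum>i\<in>I. sqrt (q u) * (cmod (u i) * sqrt (q (unit_vec i))))"
  proof (rule sum_mono)
    fix i assume "i \<in> I"
    let ?y = "cfun_scale (u i) (unit_vec i)"
    have "(Re (ip I ((A ^^ m) u) ?y))\<^sup>2 \<le> q u * q ?y"
      unfolding q_def qf_def by (rule semi_Cauchy_Schwarz[OF psd_op_funpow[OF A]])
    hence "Re (ip I ((A ^^ m) u) ?y) \<le> sqrt (q u * q ?y)" by (rule real_le_rsqrt)
    also have "\<dots> = sqrt (q u) * (cmod (u i) * sqrt (q (unit_vec i)))"
      by (simp add: qs real_sqrt_mult)
    finally show "Re (ip I ((A ^^ m) u) ?y) \<le> \<dots>" .
  qed
  also have "\<dots> = sqrt (q u) * (\<Sum>i\<in>I. cmod (u i) * sqrt (q (unit_vec i)))"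
    by (simp add: sum_distrib_left)
  finally have le: "q u \<le> sqrt (q u) * (\<Sum>i\<in>I. cmod (u i) * sqrt (q (unit_vec i)))" .
  define T where "T = (\<Sum>i\<in>I. cmod (u i) * sqrt (q (unit_vec i)))"
  have "q u \<le> T\<^sup>2"
  proof (cases "q u = 0")
    case False
    with q0[of u] have pos: "0 < sqrt (q u)" by simp
    have "sqrt (q u) * sqrt (q u) \<le> sqrt (q u) * T" using le q0[of u] by (simp add: T_def)
    hence "sqrt (q u) \<le> T" using pos mult_le_cancel_left_pos by blast
    hence "(sqrt (q u))\<^sup>2 \<le> T\<^sup>2" using pos by (intro power_mono) auto
    thus ?thesis using q0[of u] by simp
  qed simp
  also have "T\<^sup>2 \<le> (\<Sum>i\<in>I. (cmod (u i))\<^sup>2) * (\<Sum>i\<in>I. (sqrt (q (unit_vec i)))\<^sup>2)"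
    unfolding T_def by (rule Cauchy_Schwarz_ineq_sum)
  finally show ?thesis by (simp add: q0 trace_pow_def q_def[symmetric])
qed

lemma qf_0: "qf I A 0 x = (\<Sum>i\<in>I. (cmod (x i))\<^sup>2)"
  by (simp add: qf_def ip_self)

text \<open>Serves to make the exponential series converge; the trace stands in for the operator
  norm.\<close>

lemma qf_le_power:
  assumes fin: "finite I" and A: "psd_op I A"
  shows "qf I A m x \<le> (trace_pow I A 1) ^ m * qf I A 0 x"
proof (induction m)
  case (Suc m)
  let ?L = "trace_pow I A 1"
  \<comment> \<open>For an even exponent the moment is a squared norm, and the bound is <A y, y>
    \<le> tr A |y|^2 with y = A^j x.\<close>
  have even: "qf I A (Suc (2 * j)) x \<le> ?L * qf I A (2 * j) x" for j
  proof -
    have 1: "ip I ((A ^^ Suc (2 * j)) x) x = ip I (A ((A ^^ j) x)) ((A ^^ j) x)"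
      unfolding mult_2 add_Suc_right[symmetric] funpow_add o_apply
      by (subst funpow_linear(3)[OF A]) simp
    have 2: "ip I ((A ^^ (2 * j)) x) x = ip I ((A ^^ j) x) ((A ^^ j) x)"
      unfolding mult_2 funpow_add o_apply by (rule funpow_linear(3)[OF A])
    show ?thesis
      using qf_le_trace_pow[OF fin A, of 1 "(A ^^ j) x"]
      by (simp add: qf_def 1 2 del: funpow.simps) (simp add: ip_self mult.commute)
  qed
  have step: "qf I A (Suc m) x \<le> ?L * qf I A m x"
  proof (cases "even m")
    case True
    then show ?thesis using even by (metis evenE)
  next
    case False
    then obtain j where m: "m = Suc (2 * j)" by (metis oddE Suc_eq_plus1)
    let ?a = "\<lambda>k. qf I A k x"
    \<comment> \<open>For odd m, log-convexity transfers the bound from the even exponent m + 1,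
      after cancelling one factor a (m + 1).\<close>
    have "(?a (Suc m))\<^sup>2 \<le> ?a m * ?a (Suc (Suc m))" by (rule qf_log_convex[OF A])
    also have "\<dots> \<le> ?a m * (?L * ?a (Suc m))"
      using even[of "Suc j"] by (intro mult_left_mono qf_nonneg[OF A]) (simp add: m)
    finally have le: "?a (Suc m) * ?a (Suc m) \<le> (?L * ?a m) * ?a (Suc m)"
      by (simp only: power2_eq_square mult_ac)
    show ?thesis
    proof (cases "?a (Suc m) = 0")
      case True
      then show ?thesis using A by (simp add: trace_pow_nonneg qf_nonneg)
    next
      case False
      with qf_nonneg[OF A, of "Suc m" x] have "0 < ?a (Suc m)" by simp
      with le show ?thesis by simp
    qed
  qed
  also have "\<dots> \<le> ?L * (?L ^ m * qf I A 0 x)"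
    using Suc by (intro mult_left_mono trace_pow_nonneg[OF A])
  finally show ?case by (simp add: mult_ac)
qed simp

lemma summable_qf:
  assumes "finite I" "psd_op I A"
  shows "summable (\<lambda>m. qf I A m x / fact m)"
proof (rule summable_comparison_test')
  show "summable (\<lambda>m. qf I A 0 x * ((trace_pow I A 1) ^ m / fact m))"
    using summable_exp[of "trace_pow I A 1"] by (intro summable_mult) (simp add: field_simps)
  show "norm (qf I A m x / fact m) \<le> qf I A 0 x * ((trace_pow I A 1) ^ m / fact m)" for m
    using qf_le_power[OF assms, of m x] qf_nonneg[OF assms(2), of m x]
    by (simp add: field_simps)
qed

lemma summable_trace_pow:
  assumes "finite I" "psd_op I A"
  shows "summable (\<lambda>m. trace_pow I A m / fact m)"
  unfolding trace_pow_def sum_divide_distrib by (intro summable_sum summable_qf assms)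

section \<open>Rank-one updates and the trace of the exponential\<close>

lemma psd_op_rank_one_update:
  assumes A: "psd_op I A" and s: "0 \<le> s"
  shows "psd_op I (rank_one_update I A s v)"
  unfolding psd_op_def
proof (intro conjI allI)
  fix x y c
  show "rank_one_update I A s v (x + y) = rank_one_update I A s v x + rank_one_update I A s v y"
    by (simp add: rank_one_update_def psd_opD(1)[OF A] ip_add_left fun_eq_iff cfun_scale_def
        algebra_simps)
  show "rank_one_update I A s v (cfun_scale c x) = cfun_scale c (rank_one_update I A s v x)"
    by (simp add: rank_one_update_def psd_opD(2)[OF A] ip_scale_left)
      (simp add: fun_eq_iff cfun_scale_def algebra_simps)
  show "ip I (rank_one_update I A s v x) y = ip I x (rank_one_update I A s v y)"
    by (simp add: rank_one_update_def psd_opD(3)[OF A] ip_add_left ip_add_right ip_scale_left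
        ip_scale_right cnj_ip mult_ac)
  have "ip I (rank_one_update I A s v x) x = ip I (A x) x + of_real (s * (cmod (ip I x v))\<^sup>2)"
    by (simp add: rank_one_update_def ip_add_left ip_scale_left cnj_ip[of I x v, symmetric]
        complex_norm_square mult.assoc flip: of_real_power)
  then show "0 \<le> Re (ip I (rank_one_update I A s v x) x)"
    using psd_opD(4)[OF A, of x] s by simp
qed

lemma rank_one_update_0 [simp]: "rank_one_update I A 0 v = A"
  by (simp add: rank_one_update_def fun_eq_iff cfun_scale_def)

lemma rank_one_update_add:
  "rank_one_update I (rank_one_update I A s v) t v = rank_one_update I A (s + t) v"
  by (simp add: rank_one_update_def fun_eq_iff cfun_scale_def algebra_simps)

text \<open>In use C = A + s v v^H, which need not commute with A. The words A^l C^k interpolate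
  between C^m and A^m by exchanging one factor at a time.\<close>

definition mixed_form ::
    "'i set \<Rightarrow> (('i \<Rightarrow> complex) \<Rightarrow> ('i \<Rightarrow> complex)) \<Rightarrow> (('i \<Rightarrow> complex) \<Rightarrow> ('i \<Rightarrow> complex)) \<Rightarrow>
      ('i \<Rightarrow> complex) \<Rightarrow> nat \<Rightarrow> nat \<Rightarrow> real" where
  "mixed_form I A C v l k = Re (ip I ((A ^^ l) ((C ^^ k) v)) v)"

context
  fixes I :: "'i set" and A C :: "('i \<Rightarrow> complex) \<Rightarrow> ('i \<Rightarrow> complex)" and s :: real and v
  assumes A: "psd_op I A" and s: "0 \<le> s" and C_def: "C = rank_one_update I A s v"
begin

lemma psd_C: "psd_op I C"
  unfolding C_def by (rule psd_op_rank_one_update[OF A s])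

lemma funpow_update_Suc:
  "(A ^^ l) ((C ^^ Suc k) x) =
    (A ^^ Suc l) ((C ^^ k) x) + cfun_scale (of_real s * ip I ((C ^^ k) x) v) ((A ^^ l) v)"
proof -
  have "(C ^^ Suc k) x = A ((C ^^ k) x) + cfun_scale (of_real s * ip I ((C ^^ k) x) v) v"
    by (simp add: C_def rank_one_update_def)
  then show ?thesis
    by (simp only: funpow_linear[OF A] funpow_Suc_right[of l] o_apply)
qed

lemma Re_ip_funpow_self: "ip I ((A ^^ l) v) v = of_real (qf I A l v)"
proof -
  have "cnj (ip I ((A ^^ l) v) v) = ip I ((A ^^ l) v) v"
    by (metis cnj_ip funpow_linear(3)[OF A])
  then show ?thesis by (simp add: qf_def complex_eq_iff)
qed

text \<open>Replacing one C by A + s v v^H splits the form at v, which leaves a product of a moment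
  of A and a moment of C.\<close>

lemma mixed_form_Suc:
  "mixed_form I A C v l (Suc k) = mixed_form I A C v (Suc l) k + s * qf I A l v * qf I C k v"
  unfolding mixed_form_def funpow_update_Suc ip_add_left ip_scale_left Re_ip_funpow_self
  by (simp add: qf_def)

text \<open>Each exchange of C for A drops a nonnegative term s <A^l v, v> <C^k v, v>.\<close>

lemma mixed_form_bounds:
  "qf I A (l + k) v \<le> mixed_form I A C v l k" "mixed_form I A C v l k \<le> qf I C (l + k) v"
proof -
  have le: "mixed_form I A C v (Suc l) k \<le> mixed_form I A C v l (Suc k)" for l k
    using s by (simp add: mixed_form_Suc qf_nonneg[OF A] qf_nonneg[OF psd_C])
  have "mixed_form I A C v (l + j) k \<le> mixed_form I A C v l (k + j)" for l k j
  proof (induction j arbitrary: k)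
    case (Suc j)
    from le[of "l + j" k] Suc[of "Suc k"] show ?case by simp
  qed simp
  from this[of l k 0] this[of 0 l k]
  show "qf I A (l + k) v \<le> mixed_form I A C v l k" "mixed_form I A C v l k \<le> qf I C (l + k) v"
    by (simp_all add: mixed_form_def qf_def add.commute)
qed

text \<open>The right-hand side is what v v^H would give if it were the scalar |v|^2 =
  \<open>qf I A 0 v\<close>: the binomial expansion of A^l (A + s |v|^2)^k at v. Summed against 1 /
  k! for l = 0, it yields the factor exp (s |v|^2) of the growth bound.\<close>

lemma mixed_form_le_binomial:
  "mixed_form I A C v l k \<le> (\<Sum>r\<le>k. real (k choose r) * (s * qf I A 0 v) ^ r * qf I A (l + k - r) v)"
proof (induction k arbitrary: l)
  case 0
  show ?case by (simp add: mixed_form_def qf_def)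
next
  case (Suc k)
  let ?d = "qf I A 0 v"
  let ?a = "\<lambda>j. qf I A j v"
  have "s * ?a l * qf I C k v = s * ?a l * mixed_form I A C v 0 k"
    by (simp add: mixed_form_def qf_def)
  also have "\<dots> \<le> s * ?a l * (\<Sum>r\<le>k. real (k choose r) * (s * ?d) ^ r * ?a (k - r))"
    using Suc[of 0] s by (intro mult_left_mono) (auto simp: qf_nonneg[OF A])
  also have "\<dots> = (\<Sum>r\<le>k. (s * real (k choose r) * (s * ?d) ^ r) * (?a l * ?a (k - r)))"
    by (simp add: sum_distrib_left mult_ac)
  \<comment> \<open>Log-convexity merges the two moments into one; the factor |v|^2 that appears
    raises the power of s |v|^2 by one.\<close>
  also have "\<dots> \<le> (\<Sum>r\<le>k. (s * real (k choose r) * (s * ?d) ^ r) * (?d * ?a (l + (k - r))))"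
    using s by (intro sum_mono mult_left_mono qf_mult_le[OF A]) (auto simp: qf_nonneg[OF A])
  also have "\<dots> = (\<Sum>r\<le>k. real (k choose r) * (s * ?d) ^ Suc r * ?a (l + k - r))"
    by (intro sum.cong) (auto simp: mult_ac)
  finally have 1: "s * ?a l * qf I C k v \<le> \<dots>" .
  have "mixed_form I A C v l (Suc k) = mixed_form I A C v (Suc l) k + s * ?a l * qf I C k v"
    by (rule mixed_form_Suc)
  also have "\<dots> \<le> (\<Sum>r\<le>k. real (k choose r) * (s * ?d) ^ r * ?a (Suc l + k - r)) +
      (\<Sum>r\<le>k. real (k choose r) * (s * ?d) ^ Suc r * ?a (l + k - r))"
    by (intro add_mono Suc 1)
  \<comment> \<open>Since k choose Suc k is 0, the range can be extended to Suc k; after the shift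
    both sums run over r \<le> k and Pascal's rule adds them.\<close>
  also have "(\<Sum>r\<le>k. real (k choose r) * (s * ?d) ^ r * ?a (Suc l + k - r)) =
      (\<Sum>r\<le>Suc k. real (k choose r) * (s * ?d) ^ r * ?a (Suc l + k - r))"
    by simp
  also have "\<dots> = ?a (Suc l + k) +
      (\<Sum>r\<le>k. real (k choose Suc r) * (s * ?d) ^ Suc r * ?a (l + k - r))"
    by (subst sum.atMost_Suc_shift) simp
  also have "\<dots> + (\<Sum>r\<le>k. real (k choose r) * (s * ?d) ^ Suc r * ?a (l + k - r)) =
      ?a (Suc l + k) + (\<Sum>r\<le>k. real (Suc k choose Suc r) * (s * ?d) ^ Suc r * ?a (l + k - r))"
    by (simp add: sum.distrib[symmetric] algebra_simps)
  also have "\<dots> = (\<Sum>r\<le>Suc k. real (Suc k choose r) * (s * ?d) ^ r * ?a (l + Suc k - r))"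
    by (subst sum.atMost_Suc_shift) simp
  finally show ?case .
qed

text \<open>A difference form of d/ds tr (A + s v v^H)^m = m <(A + s v v^H)^(m-1) v, v>. Each of the
  m exchanges of a factor contributes s times a mixed form, and these lie between the moments of A
  and of C. For m = 0 the truncated m - 1 is harmless because of the factor m.\<close>

lemma trace_pow_update_bounds:
  assumes fin: "finite I"
  shows "s * real m * qf I A (m - 1) v \<le> trace_pow I C m - trace_pow I A m"
    "trace_pow I C m - trace_pow I A m \<le> s * real m * qf I C (m - 1) v"
proof -
  \<comment> \<open>The real part of tr (A^l C^k).\<close>
  define t where "t l k = (\<Sum>i\<in>I. Re (ip I ((A ^^ l) ((C ^^ k) (unit_vec i))) (unit_vec i)))" for l k
  have t_Suc: "t l (Suc k) = t (Suc l) k + s * mixed_form I A C v l k" for l k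
  proof -
    have "ip I ((A ^^ l) ((C ^^ Suc k) (unit_vec i))) (unit_vec i) =
        ip I ((A ^^ Suc l) ((C ^^ k) (unit_vec i))) (unit_vec i) +
        of_real s * (((A ^^ l) v) i * cnj (((C ^^ k) v) i))" if i: "i \<in> I" for i
    proof -
      have "ip I ((C ^^ k) (unit_vec i)) v = cnj (((C ^^ k) v) i)"
        by (simp add: funpow_linear(3)[OF psd_C] ip_unit_left[OF fin i])
      moreover have "ip I ((A ^^ l) v) (unit_vec i) = ((A ^^ l) v) i"
        by (rule ip_unit_right[OF fin i])
      ultimately show ?thesis
        unfolding funpow_update_Suc by (simp add: ip_add_left ip_scale_left)
    qed
    then have "t l (Suc k) = (\<Sum>i\<in>I. Re (ip I ((A ^^ Suc l) ((C ^^ k) (unit_vec i))) (unit_vec i)) +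
        Re (of_real s * (((A ^^ l) v) i * cnj (((C ^^ k) v) i))))"
      unfolding t_def plus_complex.sel(1)[symmetric] by (intro sum.cong arg_cong[of _ _ Re]) auto
    then have "t l (Suc k) = t (Suc l) k + (\<Sum>i\<in>I. Re (of_real s * (((A ^^ l) v) i * cnj (((C ^^ k) v) i))))"
      unfolding t_def sum.distrib .
    also have "(\<Sum>i\<in>I. Re (of_real s * (((A ^^ l) v) i * cnj (((C ^^ k) v) i)))) =
        s * Re (ip I ((A ^^ l) v) ((C ^^ k) v))"
      by (simp add: ip_def sum_distrib_left)
    also have "ip I ((A ^^ l) v) ((C ^^ k) v) = cnj (ip I ((A ^^ l) ((C ^^ k) v)) v)"
      by (simp add: cnj_ip funpow_linear(3)[OF A])
    finally show ?thesis by (simp add: mixed_form_def)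
  qed
  have "s * real k * qf I A (l + k - 1) v \<le> t l k - t (l + k) 0 \<and>
    t l k - t (l + k) 0 \<le> s * real k * qf I C (l + k - 1) v" for l k
  proof (induction k arbitrary: l)
    case (Suc k)
    have "s * qf I A (l + k) v \<le> s * mixed_form I A C v l k"
      "s * mixed_form I A C v l k \<le> s * qf I C (l + k) v"
      using mixed_form_bounds[of l k] s by (auto intro: mult_left_mono)
    with Suc[of "Suc l"] t_Suc[of l k] show ?case by (simp add: algebra_simps)
  qed simp
  from this[of m 0]
  show "s * real m * qf I A (m - 1) v \<le> trace_pow I C m - trace_pow I A m"
    "trace_pow I C m - trace_pow I A m \<le> s * real m * qf I C (m - 1) v"
    by (simp_all add: t_def trace_pow_def qf_def)
qed

text \<open>The first two bounds are the preceding ones weighted by 1 / m!, the third is the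
  binomial bound read as a Cauchy product.\<close>

lemma exp_update_bounds:
  assumes fin: "finite I"
  shows "s * qf_exp I A v \<le> trace_exp I C - trace_exp I A"
    "trace_exp I C - trace_exp I A \<le> s * qf_exp I C v"
    "qf_exp I C v \<le> exp (s * qf I A 0 v) * qf_exp I A v"
proof -
  note sA = summable_trace_pow[OF fin A] summable_qf[OF fin A, of v]
  note sC = summable_trace_pow[OF fin psd_C] summable_qf[OF fin psd_C, of v]
  have D: "(\<lambda>m. (trace_pow I C m - trace_pow I A m) / fact m) sums (trace_exp I C - trace_exp I A)"
    unfolding trace_exp_def diff_divide_distrib by (intro sums_diff summable_sums sA sC)
  have shift: "(\<lambda>m. s * real m * qf I B (m - 1) v / fact m) sums (s * qf_exp I B v)"
    if B: "psd_op I B" for B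
  proof -
    have "(\<lambda>m. s * (qf I B m v / fact m)) sums (s * qf_exp I B v)"
      unfolding qf_exp_def by (intro sums_mult summable_sums summable_qf fin B)
    then have "(\<lambda>m. s * real (Suc m) * qf I B (Suc m - 1) v / fact (Suc m)) sums (s * qf_exp I B v)"
      by (simp add: field_simps del: of_nat_Suc)
    from iffD1[OF sums_Suc_iff[of "\<lambda>m. s * real m * qf I B (m - 1) v / fact m"] this]
    show ?thesis by simp
  qed
  show "s * qf_exp I A v \<le> trace_exp I C - trace_exp I A"
    by (rule sums_le[OF _ shift[OF A] D]) (intro divide_right_mono trace_pow_update_bounds fin, simp)
  show "trace_exp I C - trace_exp I A \<le> s * qf_exp I C v"
    by (rule sums_le[OF _ D shift[OF psd_C]]) (intro divide_right_mono trace_pow_update_bounds fin, simp)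
  let ?f = "\<lambda>r. (s * qf I A 0 v) ^ r /\<^sub>R fact r"
  let ?g = "\<lambda>m. qf I A m v / fact m"
  have "(\<lambda>m. \<Sum>r\<le>m. ?f r * ?g (m - r)) sums ((\<Sum>r. ?f r) * (\<Sum>m. ?g m))"
  proof (rule Cauchy_product_sums)
    show "summable (\<lambda>r. norm (?f r))" by (rule summable_norm_exp)
    show "summable (\<lambda>m. norm (?g m))" using sA(2) by (simp add: qf_nonneg[OF A])
  qed
  then have P: "(\<lambda>m. \<Sum>r\<le>m. ?f r * ?g (m - r)) sums (exp (s * qf I A 0 v) * qf_exp I A v)"
    by (simp add: exp_def qf_exp_def)
  show "qf_exp I C v \<le> exp (s * qf I A 0 v) * qf_exp I A v"
  proof (rule sums_le[OF _ _ P])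
    show "(\<lambda>m. qf I C m v / fact m) sums qf_exp I C v"
      unfolding qf_exp_def by (rule summable_sums[OF sC(2)])
    fix m
    have "qf I C m v = mixed_form I A C v 0 m" by (simp add: mixed_form_def qf_def)
    also have "\<dots> \<le> (\<Sum>r\<le>m. real (m choose r) * (s * qf I A 0 v) ^ r * qf I A (m - r) v)"
      using mixed_form_le_binomial[of 0 m] by simp
    finally have "qf I C m v / fact m \<le> \<dots> / fact m" by (simp add: divide_right_mono)
    also have "\<dots> = (\<Sum>r\<le>m. ?f r * ?g (m - r))"
      by (auto simp: sum_divide_distrib binomial_fact field_simps intro!: sum.cong)
    finally show "qf I C m v / fact m \<le> \<dots>" .
  qed
qed

end

text \<open>A difference form of $f' = g$, $g' \le d g$.\<close>

lemma telescoping_exp_bounds: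
  fixes f g :: "real \<Rightarrow> real"
  assumes le: "\<And>s h. 0 \<le> s \<Longrightarrow> 0 \<le> h \<Longrightarrow> h * g s \<le> f (s + h) - f s"
    and ge: "\<And>s h. 0 \<le> s \<Longrightarrow> 0 \<le> h \<Longrightarrow> f (s + h) - f s \<le> h * g (s + h)"
    and growth: "\<And>s h. 0 \<le> s \<Longrightarrow> 0 \<le> h \<Longrightarrow> g (s + h) \<le> exp (h * d) * g s"
    and g: "\<And>s. 0 \<le> s \<Longrightarrow> 0 \<le> g s"
    and d: "0 < d" and t: "0 \<le> t"
  shows "f t - f 0 \<le> (exp (t * d) - 1) / d * g 0"
    and "(1 - exp (- (t * d))) / d * g t \<le> f t - f 0"
proof -
  \<comment> \<open>Cutting [0, t] into K + 1 steps of length h = t / (K + 1) gives the bounds up to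
    a factor exp (h d) or exp (- h d), which tends to 1; no differentiability of f or g is
    used.\<close>
  have K: "f t - f 0 \<le> (exp (t * d) - 1) / d * g 0 * exp (t / Suc K * d) \<and>
      (1 - exp (- (t * d))) / d * g t * exp (- (t / Suc K * d)) \<le> f t - f 0" for K
  proof (cases "t = 0")
    case False
    define h where "h = t / Suc K"
    with False t have h: "0 < h" by (simp add: divide_pos_pos)
    define q where "q = exp (h * d)"
    have q1: "q > 1" using h d by (simp add: q_def)
    have q_inv: "exp (- (h * d)) = 1 / q" by (simp add: q_def exp_minus field_simps)
    have qK: "q ^ Suc K = exp (t * d)"
      unfolding q_def exp_of_nat_mult[symmetric] by (simp add: h_def field_simps del: of_nat_Suc)
    have "f (real (Suc K) * h) - f (real 0 * h) = (\<Sum>i<Suc K. f (real (Suc i) * h) - f (real i * h))"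
      by (rule sum_lessThan_telescope[symmetric])
    moreover have "real (Suc K) * h = t" by (simp add: h_def del: of_nat_Suc)
    moreover have "real (Suc i) * h = real i * h + h" for i by (simp add: algebra_simps)
    ultimately have tel: "f t - f 0 = (\<Sum>i<Suc K. f (real i * h + h) - f (real i * h))"
      by (simp only: of_nat_0 mult_zero_left)
    have geo: "(\<Sum>i<Suc K. q ^ i) = (exp (t * d) - 1) / (q - 1)"
      using q1 qK by (subst geometric_sum) auto
    have "f t - f 0 \<le> (\<Sum>i<Suc K. h * (q * q ^ i * g 0))"
      unfolding tel
    proof (rule sum_mono)
      fix i
      have "f (real i * h + h) - f (real i * h) \<le> h * g (real i * h + h)"
        using h by (intro ge) auto
      also have "g (real i * h + h) \<le> exp ((real i * h + h) * d) * g 0"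
        using growth[of 0 "real i * h + h"] h by simp
      also have "exp ((real i * h + h) * d) = q * q ^ i"
        unfolding q_def exp_of_nat_mult[symmetric] exp_add[symmetric] by (simp add: algebra_simps)
      finally show "f (real i * h + h) - f (real i * h) \<le> h * (q * q ^ i * g 0)"
        using h by simp
    qed
    also have "\<dots> = h * q * g 0 * (\<Sum>i<Suc K. q ^ i)"
      by (simp add: sum_distrib_left mult_ac del: sum.lessThan_Suc)
    also have "\<dots> = (exp (t * d) - 1) * g 0 * q * (h / (q - 1))"
      by (simp only: geo times_divide_eq_right times_divide_eq_left mult_ac)
    also have "\<dots> \<le> (exp (t * d) - 1) * g 0 * q * (1 / d)"
    proof (rule mult_left_mono)
      have "h * d \<le> q - 1" unfolding q_def using exp_ge_add_one_self[of "h * d"] by linarith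
      then show "h / (q - 1) \<le> 1 / d" using q1 d by (simp add: field_simps)
      show "0 \<le> (exp (t * d) - 1) * g 0 * q" using t d q1 g[of 0] by simp
    qed
    finally have 1: "f t - f 0 \<le> (exp (t * d) - 1) / d * g 0 * exp (t / Suc K * d)"
      by (simp add: h_def q_def)
    have "(1 - exp (- (t * d))) / d * g t * exp (- (h * d)) =
        (exp (t * d) - 1) * g t * exp (- (t * d)) * (exp (- (h * d)) / d)"
      by (simp add: exp_minus field_simps)
    also have "\<dots> \<le> (exp (t * d) - 1) * g t * exp (- (t * d)) * (h / (q - 1))"
    proof (rule mult_left_mono)
      \<comment> \<open>The companion of h d \<le> q - 1: the estimate 1 + x \<le> exp x at x = - h
        d.\<close>
      have "q * (1 - h * d) \<le> q * exp (- (h * d))"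
        using q1 exp_ge_add_one_self[of "- (h * d)"] by (intro mult_left_mono) auto
      also have "\<dots> = 1" by (simp add: q_def exp_minus)
      finally have "q - 1 \<le> q * h * d" by (simp add: algebra_simps)
      then show "exp (- (h * d)) / d \<le> h / (q - 1)"
        using q1 d unfolding q_inv by (simp add: field_simps)
      show "0 \<le> (exp (t * d) - 1) * g t * exp (- (t * d))" using t d g[of t] by simp
    qed
    also have "\<dots> = (\<Sum>i<Suc K. h * (q ^ i * exp (- (t * d)) * g t))"
      unfolding sum_distrib_left[symmetric] sum_distrib_right[symmetric] geo by simp
    also have "\<dots> \<le> f t - f 0"
      unfolding tel
    proof (rule sum_mono)
      fix i assume "i \<in> {..<Suc K}"
      then have "real i * h \<le> real (Suc K) * h" using h by (intro mult_right_mono) auto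
      then have ih: "real i * h \<le> t" by (simp add: h_def del: of_nat_Suc)
      have "g t \<le> exp ((t - real i * h) * d) * g (real i * h)"
        using growth[of "real i * h" "t - real i * h"] h ih by simp
      then have "q ^ i * exp (- (t * d)) * g t \<le>
          q ^ i * exp (- (t * d)) * (exp ((t - real i * h) * d) * g (real i * h))"
        using q1 by (intro mult_left_mono) auto
      also have "\<dots> = (q ^ i * exp (- (t * d)) * exp ((t - real i * h) * d)) * g (real i * h)"
        by (simp add: mult_ac)
      also have "q ^ i * exp (- (t * d)) * exp ((t - real i * h) * d) = 1"
        unfolding q_def exp_of_nat_mult[symmetric] exp_add[symmetric] by (simp add: algebra_simps)
      finally have "h * (q ^ i * exp (- (t * d)) * g t) \<le> h * g (real i * h)"
        using h by simp
      also have "\<dots> \<le> f (real i * h + h) - f (real i * h)" using h by (intro le) auto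
      finally show "h * (q ^ i * exp (- (t * d)) * g t) \<le> f (real i * h + h) - f (real i * h)" .
    qed
    finally show ?thesis using 1 by (simp add: h_def)
  qed simp
  have lim: "(\<lambda>K. t / real (Suc K) * d) \<longlonglongrightarrow> 0"
    using tendsto_mult[OF LIMSEQ_Suc[OF lim_const_over_n[of t]] tendsto_const[of d]] by simp
  have "(\<lambda>K. (exp (t * d) - 1) / d * g 0 * exp (t / Suc K * d)) \<longlonglongrightarrow>
      (exp (t * d) - 1) / d * g 0 * exp 0"
    by (intro tendsto_intros lim)
  with K show "f t - f 0 \<le> (exp (t * d) - 1) / d * g 0"
    by (intro LIMSEQ_le_const) auto
  have "(\<lambda>K. (1 - exp (- (t * d))) / d * g t * exp (- (t / Suc K * d))) \<longlonglongrightarrow>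
      (1 - exp (- (t * d))) / d * g t * exp (- 0)"
    by (intro tendsto_intros lim)
  with K show "(1 - exp (- (t * d))) / d * g t \<le> f t - f 0"
    by (intro LIMSEQ_le_const2) auto
qed

section \<open>The trace of the exponential under one rank-one step\<close>

lemma qf_exp_nonneg: "finite I \<Longrightarrow> psd_op I A \<Longrightarrow> 0 \<le> qf_exp I A v"
  unfolding qf_exp_def by (intro suminf_nonneg summable_qf) (auto simp: qf_nonneg)

lemma trace_exp_nonneg: "finite I \<Longrightarrow> psd_op I A \<Longrightarrow> 0 \<le> trace_exp I A"
  unfolding trace_exp_def by (intro suminf_nonneg summable_trace_pow) (auto simp: trace_pow_nonneg)

text \<open>The second bound is phrased at the updated operator so that it can be read from the top
  down: with A + t v v^H as the starting operator it estimates the effect of subtracting t v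
  v^H.\<close>

lemma trace_exp_update:
  assumes fin: "finite I" and A: "psd_op I A" and t: "0 \<le> t"
    and d: "d = (\<Sum>i\<in>I. (cmod (v i))\<^sup>2)" "0 < d"
  shows "trace_exp I (rank_one_update I A t v) \<le>
      trace_exp I A + (exp (t * d) - 1) / d * qf_exp I A v"
    and "trace_exp I A + (1 - exp (- (t * d))) / d * qf_exp I (rank_one_update I A t v) v \<le>
      trace_exp I (rank_one_update I A t v)"
proof -
  define f where "f s = trace_exp I (rank_one_update I A s v)" for s
  define g where "g s = qf_exp I (rank_one_update I A s v) v" for s
  note psd = psd_op_rank_one_update[OF A]
  have "h * g s \<le> f (s + h) - f s" "f (s + h) - f s \<le> h * g (s + h)"
    "g (s + h) \<le> exp (h * d) * g s" if "0 \<le> s" "0 \<le> h" for s h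
    using exp_update_bounds[OF psd[of s v, OF that(1)] that(2) refl fin, of v]
    unfolding f_def g_def rank_one_update_add qf_0 d(1) by auto
  moreover have "0 \<le> g s" if "0 \<le> s" for s
    unfolding g_def by (intro qf_exp_nonneg fin psd that)
  ultimately have "f t - f 0 \<le> (exp (t * d) - 1) / d * g 0"
    "(1 - exp (- (t * d))) / d * g t \<le> f t - f 0"
    using telescoping_exp_bounds[of g f d t] d(2) t by blast+
  then show "trace_exp I (rank_one_update I A t v) \<le>
      trace_exp I A + (exp (t * d) - 1) / d * qf_exp I A v"
    "trace_exp I A + (1 - exp (- (t * d))) / d * qf_exp I (rank_one_update I A t v) v \<le>
      trace_exp I (rank_one_update I A t v)"
    by (simp_all add: f_def g_def)
qed

text \<open>Jensen's inequality for the normalised moments, a m / a 0 \<ge> (a 1 / a 0)^m, together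
  with a m / a 0 \<le> tr A^m. It turns a bad Rayleigh quotient into a large trace, the event to
  which Markov's inequality applies.\<close>

lemma exp_le_trace_exp:
  assumes fin: "finite I" and A: "psd_op I A" and u: "0 < (\<Sum>i\<in>I. (cmod (u i))\<^sup>2)"
    and c: "c * (\<Sum>i\<in>I. (cmod (u i))\<^sup>2) \<le> Re (ip I (A u) u)"
  shows "exp c \<le> trace_exp I A"
proof -
  define a where "a m = qf I A m u" for m
  have a0: "0 < a 0" using u by (simp add: a_def qf_0)
  have an: "0 \<le> a m" for m by (simp add: a_def qf_nonneg[OF A])
  define \<alpha> where "\<alpha> = a 1 / a 0"
  have \<alpha>: "0 \<le> \<alpha>" using a0 an[of 1] by (simp add: \<alpha>_def)
  have "a 0 * \<alpha> ^ m \<le> a m" for m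
  proof (induction m)
    case (Suc m)
    have "a 0 * \<alpha> ^ Suc m = \<alpha> * (a 0 * \<alpha> ^ m)" by simp
    also have "\<dots> \<le> \<alpha> * a m" using Suc \<alpha> by (rule mult_left_mono)
    also have "\<dots> \<le> a (Suc m)"
      using qf_mult_le[OF A, of m u 1] a0 by (simp add: a_def[symmetric] \<alpha>_def field_simps)
    finally show ?case .
  qed simp
  moreover have "a m \<le> a 0 * trace_pow I A m" for m
    using qf_le_trace_pow[OF fin A, of m u] by (simp add: a_def qf_0)
  ultimately have "a 0 * \<alpha> ^ m \<le> a 0 * trace_pow I A m" for m by (rule order_trans)
  with a0 have le: "\<alpha> ^ m \<le> trace_pow I A m" for m by simp
  have "c \<le> \<alpha>" using c a0 by (simp add: \<alpha>_def a_def qf_def ip_self field_simps)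
  then have "exp c \<le> exp \<alpha>" by simp
  also have "\<dots> \<le> trace_exp I A"
    unfolding exp_def trace_exp_def
  proof (rule suminf_le)
    show "summable (\<lambda>n. \<alpha> ^ n /\<^sub>R fact n)" by (rule summable_exp_generic)
    show "summable (\<lambda>m. trace_pow I A m / fact m)" by (rule summable_trace_pow[OF fin A])
    show "\<alpha> ^ n /\<^sub>R fact n \<le> trace_pow I A n / fact n" for n
      using le[of n] by (simp add: field_simps)
  qed
  finally show ?thesis .
qed

section \<open>Sums of rank-one operators over a sample\<close>

definition sum_op ::
    "'i set \<Rightarrow> real \<Rightarrow> real \<Rightarrow> 'j set \<Rightarrow> ('j \<Rightarrow> 'i \<Rightarrow> complex) \<Rightarrow> (('i \<Rightarrow> complex) \<Rightarrow> ('i \<Rightarrow> complex))" where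
  "sum_op I c s J w x =
     (\<lambda>i. of_real c * x i + (\<Sum>j\<in>J. of_real s * ip I x (w j) * w j i))"

lemma sum_op_empty: "sum_op I c s {} w = cfun_scale (of_real c)"
  by (simp add: sum_op_def cfun_scale_def fun_eq_iff)

text \<open>The vectors are w (\<xi> k), a fixed map of the sample points, so that overwriting
  coordinate j of \<xi> is one rank-one update; this matches integration over one more factor of a
  product measure.\<close>

lemma sum_op_insert:
  assumes "finite J" "j \<notin> J"
  shows "sum_op I c s (insert j J) (\<lambda>k. w ((\<xi>(j := y)) k)) =
    rank_one_update I (sum_op I c s J (\<lambda>k. w (\<xi> k))) s (w y)"
proof -
  have "(\<Sum>k\<in>J. of_real s * ip I x (w ((\<xi>(j := y)) k)) * w ((\<xi>(j := y)) k) i) =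
    (\<Sum>k\<in>J. of_real s * ip I x (w (\<xi> k)) * w (\<xi> k) i)" for x i
    using assms by (intro sum.cong) auto
  then show ?thesis
    using assms by (simp add: sum_op_def rank_one_update_def fun_eq_iff cfun_scale_def)
qed

lemma ip_sum_op:
  "ip I (sum_op I c s J w x) y =
    of_real c * ip I x y + (\<Sum>j\<in>J. of_real s * ip I x (w j) * ip I (w j) y)"
proof -
  have "ip I (sum_op I c s J w x) y =
      (\<Sum>i\<in>I. of_real c * (x i * cnj (y i)) + (\<Sum>j\<in>J. of_real s * ip I x (w j) * (w j i * cnj (y i))))"
    unfolding ip_def[of I "sum_op I c s J w x"]
    by (intro sum.cong refl) (simp add: sum_op_def sum_distrib_left algebra_simps)
  also have "\<dots> = of_real c * ip I x y + (\<Sum>i\<in>I. \<Sum>j\<in>J. of_real s * ip I x (w j) * (w j i * cnj (y i)))"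
    by (simp add: sum.distrib ip_def[of I x y] sum_distrib_left)
  also have "(\<Sum>i\<in>I. \<Sum>j\<in>J. of_real s * ip I x (w j) * (w j i * cnj (y i))) =
      (\<Sum>j\<in>J. of_real s * ip I x (w j) * ip I (w j) y)"
    by (subst sum.swap) (simp add: ip_def[of I _ y] sum_distrib_left)
  finally show ?thesis .
qed

lemma Re_ip_sum_op:
  "Re (ip I (sum_op I c s J w x) x) =
    c * (\<Sum>i\<in>I. (cmod (x i))\<^sup>2) + s * (\<Sum>j\<in>J. (cmod (ip I x (w j)))\<^sup>2)"
proof -
  have "ip I (sum_op I c s J w x) x =
      of_real (c * (\<Sum>i\<in>I. (cmod (x i))\<^sup>2) + s * (\<Sum>j\<in>J. (cmod (ip I x (w j)))\<^sup>2))"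
    unfolding ip_sum_op ip_self
    by (simp add: sum_distrib_left mult.assoc cnj_ip[of I x, symmetric] complex_norm_square
        del: of_real_power)
  then show ?thesis by (simp only: Re_complex_of_real)
qed

lemma psd_op_sum_op:
  assumes "\<And>x. 0 \<le> c * (\<Sum>i\<in>I. (cmod (x i))\<^sup>2) + s * (\<Sum>j\<in>J. (cmod (ip I x (w j)))\<^sup>2)"
  shows "psd_op I (sum_op I c s J w)"
  unfolding psd_op_def
proof (intro conjI allI)
  fix x y a
  show "sum_op I c s J w (x + y) = sum_op I c s J w x + sum_op I c s J w y"
    by (simp add: sum_op_def fun_eq_iff ip_add_left algebra_simps sum.distrib)
  show "sum_op I c s J w (cfun_scale a x) = cfun_scale a (sum_op I c s J w x)"
    unfolding sum_op_def ip_scale_left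
    by (simp add: cfun_scale_def fun_eq_iff algebra_simps sum_distrib_left)
  have "ip I x (sum_op I c s J w y) = cnj (ip I (sum_op I c s J w y) x)" by (simp add: cnj_ip)
  also have "\<dots> = ip I (sum_op I c s J w x) y"
    unfolding ip_sum_op by (simp add: cnj_ip mult_ac)
  finally show "ip I (sum_op I c s J w x) y = ip I x (sum_op I c s J w y)" ..
  show "0 \<le> Re (ip I (sum_op I c s J w x) x)" unfolding Re_ip_sum_op by (rule assms)
qed

lemma psd_op_sum_op_nonneg: "0 \<le> c \<Longrightarrow> 0 \<le> s \<Longrightarrow> psd_op I (sum_op I c s J w)"
  by (intro psd_op_sum_op add_nonneg_nonneg mult_nonneg_nonneg sum_nonneg) auto

text \<open>Each w_j w_j^H is at most its trace d, so t times the sum is at most t |J| d \<le>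
  c.\<close>

lemma psd_op_sum_op_neg:
  assumes J: "finite J" and d: "\<And>j. j \<in> J \<Longrightarrow> (\<Sum>i\<in>I. (cmod (w j i))\<^sup>2) = d"
    and t: "0 \<le> t" "t * real (card J) * d \<le> c"
  shows "psd_op I (sum_op I c (- t) J w)"
proof (rule psd_op_sum_op)
  fix x
  let ?n = "\<Sum>i\<in>I. (cmod (x i))\<^sup>2"
  have "(\<Sum>j\<in>J. (cmod (ip I x (w j)))\<^sup>2) \<le> (\<Sum>j\<in>J. ?n * d)"
    using cmod_ip_le[of I x] d by (intro sum_mono) metis
  then have "t * (\<Sum>j\<in>J. (cmod (ip I x (w j)))\<^sup>2) \<le> t * (\<Sum>j\<in>J. ?n * d)"
    using t by (intro mult_left_mono)
  also have "\<dots> = (t * real (card J) * d) * ?n" by simp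
  also have "\<dots> \<le> c * ?n" using t by (intro mult_right_mono sum_nonneg) auto
  finally show "0 \<le> c * ?n + - t * (\<Sum>j\<in>J. (cmod (ip I x (w j)))\<^sup>2)" by simp
qed

lemma trace_exp_scale:
  assumes fin: "finite I"
  shows "trace_exp I (cfun_scale (of_real c)) = real (card I) * exp c"
proof -
  have pw: "(cfun_scale (of_real c) ^^ m) x = cfun_scale (of_real (c ^ m)) x" for m x
    by (induction m) (auto simp: cfun_scale_def fun_eq_iff mult.assoc)
  have "ip I (unit_vec i) (unit_vec i) = 1" if "i \<in> I" for i
    using that by (simp add: ip_unit_left[OF fin]) (simp add: unit_vec_def)
  then have "trace_pow I (cfun_scale (of_real c)) m = real (card I) * c ^ m" for m
    unfolding trace_pow_def qf_def pw ip_scale_left by simp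
  moreover have "(\<lambda>m. real (card I) * (c ^ m /\<^sub>R fact m)) sums (real (card I) * exp c)"
    by (intro sums_mult exp_converges)
  ultimately show ?thesis
    unfolding trace_exp_def by (simp add: field_simps sums_iff)
qed

section \<open>Rotation invariance of the surface measure\<close>

text \<open>
  The image measure $M$ is translation invariant and agrees with Lebesgue measure on the unit ball $B$.
  Integrating $1_B(y) 1_A(x + y)$ over both measures in both orders gives $\lambda(B) M(A) = \lambda(B) \lambda(A)$.
  The library's \<open>measure_orthogonal_image\<close> requires a well-ordered index type.
\<close>

lemma lborel_distr_orthogonal:
  fixes T :: "'a::euclidean_space \<Rightarrow> 'a"
  assumes T: "orthogonal_transformation T"
  shows "distr lborel borel T = lborel"
proof -
  define M where "M = distr lborel borel T"
  have sets_M [simp, measurable_cong]: "sets M = sets borel" and space_M [simp]: "space M = UNIV"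
    by (simp_all add: M_def)
  let ?B = "cball (0 :: 'a) 1"
  have T_meas [measurable]: "T \<in> borel_measurable borel"
    using T by (intro borel_measurable_continuous_onI linear_continuous_on)
      (simp add: linear_linear orthogonal_transformation_linear)
  obtain S where S: "T \<circ> S = id" "S \<circ> T = id"
    using orthogonal_transformation_bij[OF T] by (metis bij_def inv_o_cancel surj_iff)
  \<comment> \<open>The preimage of a ball under an isometry is a ball of the same radius. This
    makes M sigma-finite and fixes its value on unit balls around every centre.\<close>
  have cball: "emeasure M (cball y r) = emeasure lborel (cball (0 :: 'a) r)" if "0 \<le> r" for y r
  proof -
    have "dist y (T x) = dist (S y) x" for x
      using T S(1) unfolding orthogonal_transformation_isometry by (metis comp_apply id_apply)
    then have "T -` cball y r = cball (S y) r" by auto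
    then show ?thesis using that by (simp add: M_def emeasure_distr emeasure_cball)
  qed
  interpret M: sigma_finite_measure M
  proof
    have "(\<Union>n. cball (0 :: 'a) (real n)) = UNIV"
      by (auto intro: real_arch_simple)
    moreover have "emeasure M (cball 0 (real n)) \<noteq> \<infinity>" for n
      by (simp add: cball emeasure_cball)
    ultimately show "\<exists>A. countable A \<and> A \<subseteq> sets M \<and> \<Union> A = space M \<and> (\<forall>a\<in>A. emeasure M a \<noteq> \<infinity>)"
      by (intro exI[of _ "range (\<lambda>n. cball 0 (real n))"]) auto
  qed
  interpret P: pair_sigma_finite lborel M ..
  have shift_M: "distr M borel ((+) y) = M" for y
  proof -
    have "(+) y \<circ> T = T \<circ> (+) (S y)"
      using fun_cong[OF S(1)] linear_add[OF orthogonal_transformation_linear[OF T]]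
      by (simp add: fun_eq_iff)
    then have "distr M borel ((+) y) = distr (distr lborel borel ((+) (S y))) borel T"
      by (simp add: M_def distr_distr)
    then show ?thesis unfolding lborel_distr_plus by (simp add: M_def)
  qed
  have "emeasure M A = emeasure lborel A" if A [measurable]: "A \<in> sets borel" for A
  proof -
    have inner1: "(\<integral>\<^sup>+x. indicator ?B y * indicator A (y + x) \<partial>M) = indicator ?B y * emeasure M A" for y
    proof -
      have "(\<integral>\<^sup>+x. indicator ?B y * indicator A (y + x) \<partial>M) = indicator ?B y * (\<integral>\<^sup>+x. indicator A (y + x) \<partial>M)"
        by (rule nn_integral_cmult) measurable
      also have "(\<integral>\<^sup>+x. indicator A (y + x) \<partial>M) = (\<integral>\<^sup>+x. indicator A x \<partial>distr M borel ((+) y))"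
        by (rule nn_integral_distr[symmetric]) measurable
      also have "\<dots> = emeasure M A" unfolding shift_M by (rule nn_integral_indicator) simp
      finally show ?thesis .
    qed
    have [measurable]: "?B \<in> sets borel" by simp
    have inner2: "(\<integral>\<^sup>+y. indicator ?B y * indicator A (y + x) \<partial>lborel) =
        (\<integral>\<^sup>+y. indicator ?B (y - x) * indicator A y \<partial>lborel)" for x
    proof -
      have "(\<integral>\<^sup>+y. indicator ?B (y - x) * indicator A y \<partial>distr lborel borel ((+) x)) =
          (\<integral>\<^sup>+y. indicator ?B (x + y - x) * indicator A (x + y) \<partial>lborel)"
        by (rule nn_integral_distr) measurable
      also have "\<dots> = (\<integral>\<^sup>+y. indicator ?B y * indicator A (y + x) \<partial>lborel)"
        by (simp only: add_diff_cancel_right' add.commute[of x])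
      finally show ?thesis unfolding lborel_distr_plus ..
    qed
    \<comment> \<open>As a condition on x, membership of y - x in the unit ball means that x lies in
      the unit ball around y, whose M-measure is known.\<close>
    have inner3: "(\<integral>\<^sup>+x. indicator ?B (y - x) * indicator A y \<partial>M) =
        emeasure lborel ?B * indicator A y" for y
    proof -
      have "(\<integral>\<^sup>+x. indicator ?B (y - x) * indicator A y \<partial>M) =
          (\<integral>\<^sup>+x. indicator (cball y 1) x * indicator A y \<partial>M)"
        by (simp only: indicator_def mem_cball dist_norm diff_0 norm_minus_cancel)
      also have "\<dots> = (\<integral>\<^sup>+x. indicator (cball y 1) x \<partial>M) * indicator A y"
        by (rule nn_integral_multc, rule borel_measurable_indicator) simp
      also have "(\<integral>\<^sup>+x. indicator (cball y 1) x \<partial>M) = emeasure M (cball y 1)"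
        by (rule nn_integral_indicator) simp
      finally show ?thesis by (simp add: cball)
    qed
    have "emeasure lborel ?B * emeasure M A = (\<integral>\<^sup>+y. indicator ?B y \<partial>lborel) * emeasure M A"
      by (subst nn_integral_indicator) auto
    also have "\<dots> = (\<integral>\<^sup>+y. indicator ?B y * emeasure M A \<partial>lborel)"
      by (rule nn_integral_multc[symmetric]) measurable
    also have "\<dots> = (\<integral>\<^sup>+y. (\<integral>\<^sup>+x. indicator ?B y * indicator A (y + x) \<partial>M) \<partial>lborel)"
      by (simp only: inner1)
    also have "\<dots> = (\<integral>\<^sup>+x. (\<integral>\<^sup>+y. indicator ?B y * indicator A (y + x) \<partial>lborel) \<partial>M)"
      by (rule P.Fubini'[symmetric]) measurable
    also have "\<dots> = (\<integral>\<^sup>+x. (\<integral>\<^sup>+y. indicator ?B (y - x) * indicator A y \<partial>lborel) \<partial>M)"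
      by (simp only: inner2)
    also have "\<dots> = (\<integral>\<^sup>+y. (\<integral>\<^sup>+x. indicator ?B (y - x) * indicator A y \<partial>M) \<partial>lborel)"
      by (rule P.Fubini') measurable
    also have "\<dots> = (\<integral>\<^sup>+y. emeasure lborel ?B * indicator A y \<partial>lborel)"
      by (simp only: inner3)
    also have "\<dots> = emeasure lborel ?B * (\<integral>\<^sup>+y. indicator A y \<partial>lborel)"
      by (rule nn_integral_cmult) measurable
    also have "(\<integral>\<^sup>+y. indicator A y \<partial>lborel) = emeasure lborel A"
      by (rule nn_integral_indicator) simp
    finally have eq: "emeasure lborel ?B * emeasure M A = emeasure lborel ?B * emeasure lborel A" .
    have "emeasure lborel ?B = ennreal (unit_ball_vol (real DIM('a)))" by (simp add: emeasure_cball)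
    moreover have "\<not> unit_ball_vol (real DIM('a)) \<le> 0" by (simp add: not_le)
    ultimately have "emeasure lborel ?B \<noteq> 0" "emeasure lborel ?B \<noteq> \<top>"
      by (simp_all only: ennreal_eq_0_iff ennreal_neq_top not_False_eq_True)
    with eq show ?thesis
      by (simp add: ennreal_mult_cancel_left)
  qed
  then show ?thesis unfolding M_def[symmetric] by (intro measure_eqI) auto
qed

section \<open>The normalized surface measure under orthogonal maps\<close>

lemma space_normalized_surface_measure [simp]:
  "space (normalized_surface_measure :: (real ^ 'n) measure) = sphere 0 1"
  by (simp add: normalized_surface_measure_def space_scale_measure)

lemma sets_normalized_surface_measure [simp, measurable_cong]:
  "sets (normalized_surface_measure :: (real ^ 'n) measure) = sets (restrict_space borel (sphere 0 1))"
  by (simp add: normalized_surface_measure_def)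

lemma emeasure_normalized_surface_measure:
  fixes E :: "(real ^ 'n) set"
  assumes E: "E \<in> sets borel" "E \<subseteq> sphere 0 1"
  shows "emeasure normalized_surface_measure E =
    1 / emeasure surface_measure (sphere (0 :: real ^ 'n) 1) * (of_nat CARD('n) *
      emeasure lborel ({x. x /\<^sub>R norm x \<in> E} \<inter> (cball 0 1 - {0})))"
proof -
  have "E \<in> sets (restrict_space borel (sphere 0 1))"
    using E by (subst sets_restrict_space_iff) auto
  then have "emeasure surface_measure E = of_nat CARD('n) *
      emeasure lborel ({x. x /\<^sub>R norm x \<in> E} \<inter> (cball 0 1 - {0}))"
    by (simp add: surface_measure_def emeasure_distr[OF measurable_radial_projection]
        space_restrict_space emeasure_restrict_space vimage_def)
  then show ?thesis by (simp add: normalized_surface_measure_def)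
qed

lemma radial_projection_sets:
  fixes E :: "(real ^ 'n) set"
  assumes "E \<in> sets borel"
  shows "{x. x /\<^sub>R norm x \<in> E} \<inter> (cball 0 1 - {0}) \<in> sets borel"
proof -
  have "(\<lambda>x :: real ^ 'n. x /\<^sub>R norm x) -` E \<inter> space borel \<in> sets borel"
    by (rule measurable_sets[OF _ assms]) measurable
  moreover have "cball (0 :: real ^ 'n) 1 - {0} \<in> sets borel" by measurable
  ultimately have "((\<lambda>x :: real ^ 'n. x /\<^sub>R norm x) -` E \<inter> space borel) \<inter> (cball 0 1 - {0}) \<in> sets borel"
    by (rule sets.Int)
  then show ?thesis by (simp add: vimage_def)
qed

lemma orthogonal_measurable_sphere:
  fixes T :: "real ^ 'n \<Rightarrow> real ^ 'n"
  assumes T: "orthogonal_transformation T"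
  shows "T \<in> normalized_surface_measure \<rightarrow>\<^sub>M normalized_surface_measure"
proof -
  have "T \<in> borel_measurable borel"
    using T by (intro borel_measurable_continuous_onI linear_continuous_on)
      (simp add: linear_linear orthogonal_transformation_linear)
  then have "T \<in> restrict_space borel (sphere 0 1) \<rightarrow>\<^sub>M restrict_space borel (sphere 0 1)"
    by (intro measurable_restrict_space3) (auto simp: orthogonal_transformation_norm[OF T])
  then show ?thesis by (simp cong: measurable_cong_sets)
qed

lemma inverse_norm_mult_eq_1: "inverse (norm x) * norm x = 1 \<longleftrightarrow> x \<noteq> 0"
  by (cases "x = 0") auto

text \<open>Orthogonal maps are linear and preserve the norm, so the cone over the preimage of E is
  the preimage of the cone over E; invariance of Lebesgue measure carries over.\<close>

lemma normalized_surface_measure_distr_orthogonal: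
  fixes T :: "real ^ 'n \<Rightarrow> real ^ 'n"
  assumes T: "orthogonal_transformation T"
  shows "distr normalized_surface_measure normalized_surface_measure T = normalized_surface_measure"
proof (rule measure_eqI)
  fix E :: "(real ^ 'n) set"
  assume "E \<in> sets (distr normalized_surface_measure normalized_surface_measure T)"
  then have E: "E \<in> sets normalized_surface_measure" by simp
  then have Eb: "E \<in> sets borel" "E \<subseteq> sphere 0 1" by (simp_all add: sets_restrict_space_iff)
  have T_meas: "T \<in> borel_measurable borel"
    using T by (intro borel_measurable_continuous_onI linear_continuous_on)
      (simp add: linear_linear orthogonal_transformation_linear)
  let ?C = "\<lambda>E. {x :: real ^ 'n. x /\<^sub>R norm x \<in> E} \<inter> (cball 0 1 - {0})"
  let ?F = "T -` E \<inter> sphere 0 1"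
  have F: "?F \<in> sets borel" using measurable_sets[OF T_meas Eb(1)] by auto
  have lin: "linear T" by (rule orthogonal_transformation_linear[OF T])
  have nrm: "norm (T x) = norm x" for x by (rule orthogonal_transformation_norm[OF T])
  have "T x = 0 \<longleftrightarrow> x = 0" for x by (metis nrm norm_eq_zero)
  then have "?C ?F = T -` ?C E"
    unfolding set_eq_iff vimage_def Int_iff mem_Collect_eq mem_cball Diff_iff
    by (auto simp add: nrm linear_scale[OF lin] inverse_norm_mult_eq_1)
  also have "emeasure lborel \<dots> = emeasure (distr lborel borel T) (?C E)"
    using T_meas radial_projection_sets[OF Eb(1)] by (subst emeasure_distr) auto
  also have "\<dots> = emeasure lborel (?C E)" by (simp add: lborel_distr_orthogonal[OF T])
  finally have "emeasure lborel (?C ?F) = emeasure lborel (?C E)" .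
  then have "emeasure normalized_surface_measure ?F = emeasure normalized_surface_measure E"
    using F Eb by (simp add: emeasure_normalized_surface_measure)
  then show "emeasure (distr normalized_surface_measure normalized_surface_measure T) E =
      emeasure normalized_surface_measure E"
    using E by (subst emeasure_distr[OF orthogonal_measurable_sphere[OF T]]) auto
qed simp

lemma integral_sphere_orthogonal:
  fixes T :: "real ^ 'n \<Rightarrow> real ^ 'n" and f :: "real ^ 'n \<Rightarrow> 'b::{banach, second_countable_topology}"
  assumes T: "orthogonal_transformation T" and f: "f \<in> borel_measurable normalized_surface_measure"
  shows "(LINT x|normalized_surface_measure. f (T x)) = (LINT x|normalized_surface_measure. f x)"
  using integral_distr[OF orthogonal_measurable_sphere[OF T] f]
  by (simp add: normalized_surface_measure_distr_orthogonal[OF T])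

section \<open>Continuous functions on the sphere\<close>

lemma continuous_on_sphere_measurable:
  fixes f :: "real ^ 'n \<Rightarrow> 'b::topological_space"
  assumes "continuous_on (sphere 0 1) f"
  shows "f \<in> borel_measurable normalized_surface_measure"
proof -
  have "f \<in> borel_measurable (restrict_space borel (sphere 0 1))"
    by (rule borel_measurable_continuous_on_restrict[OF assms])
  then show ?thesis by (simp cong: measurable_cong_sets)
qed

lemma continuous_on_sphere_integrable:
  fixes f :: "real ^ 'n \<Rightarrow> 'b::{banach, second_countable_topology}"
  assumes f: "continuous_on (sphere 0 1) f"
  shows "integrable normalized_surface_measure f"
proof -
  interpret prob_space "normalized_surface_measure :: (real ^ 'n) measure"
    by (rule prob_space_normalized_surface_measure)
  have "compact (f ` sphere 0 1)"
    by (rule compact_continuous_image[OF f]) simp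
  then obtain B where "\<And>x. x \<in> sphere 0 1 \<Longrightarrow> norm (f x) \<le> B"
    by (metis bounded_iff compact_imp_bounded imageI)
  then show ?thesis
    by (intro integrable_const_bound[of _ B] continuous_on_sphere_measurable f) auto
qed

text \<open>The set where f does not vanish would be null, hence so would the cone over it; but that
  cone contains a nonempty open subset of the ball.\<close>

lemma continuous_on_sphere_integral_square_0:
  fixes f :: "real ^ 'n \<Rightarrow> complex"
  assumes f: "continuous_on (sphere 0 1) f"
    and 0: "(LINT x|normalized_surface_measure. (cmod (f x))\<^sup>2) = 0" and x: "norm x = 1"
  shows "f x = 0"
proof (rule ccontr)
  assume fx: "f x \<noteq> 0"
  let ?E = "{y \<in> sphere 0 1. f y \<noteq> 0}"
  let ?U = "{y \<in> ball 0 1 - {0}. f (y /\<^sub>R norm y) \<noteq> 0}"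
  have E: "?E \<in> sets borel"
  proof -
    have "f -` (- {0}) \<inter> space normalized_surface_measure \<in> sets normalized_surface_measure"
      by (rule measurable_sets[OF continuous_on_sphere_measurable[OF f]]) simp
    moreover have "f -` (- {0}) \<inter> space normalized_surface_measure = ?E" by auto
    ultimately show ?thesis by (simp add: sets_restrict_space_iff)
  qed
  have "integrable normalized_surface_measure (\<lambda>x. (cmod (f x))\<^sup>2)"
    by (intro continuous_on_sphere_integrable continuous_intros f)
  then have "AE y in normalized_surface_measure. (cmod (f y))\<^sup>2 = 0"
    using 0 by (subst (asm) integral_nonneg_eq_0_iff_AE) auto
  then have "AE y in normalized_surface_measure. y \<notin> ?E" by eventually_elim auto
  then have "?E \<in> null_sets normalized_surface_measure"
    using E by (subst (asm) AE_iff_null_sets[symmetric]) (auto simp: sets_restrict_space_iff)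
  then have "emeasure normalized_surface_measure ?E = 0" by auto
  moreover have "1 / emeasure surface_measure (sphere (0 :: real ^ 'n) 1) \<noteq> 0"
    by (simp add: emeasure_surface_measure_sphere ennreal_divide_eq_0_iff)
  ultimately have C0: "emeasure lborel ({y. y /\<^sub>R norm y \<in> ?E} \<inter> (cball 0 1 - {0})) = 0"
    using E by (subst (asm) emeasure_normalized_surface_measure) auto
  have U: "?U \<subseteq> {y. y /\<^sub>R norm y \<in> ?E} \<inter> (cball 0 1 - {0})"
    by (auto simp: inverse_norm_mult_eq_1)
  have "continuous_on (ball 0 1 - {0}) (\<lambda>y. f (y /\<^sub>R norm y))"
    by (rule continuous_on_compose2[OF f]) (auto simp: inverse_norm_mult_eq_1 intro!: continuous_intros)
  then have "open ((\<lambda>y. f (y /\<^sub>R norm y)) -` (- {0}) \<inter> (ball 0 1 - {0}))"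
    by (subst (asm) continuous_on_open_vimage) auto
  moreover have "(\<lambda>y. f (y /\<^sub>R norm y)) -` (- {0}) \<inter> (ball 0 1 - {0}) = ?U" by auto
  ultimately have "open ?U" by simp
  \<comment> \<open>The point x lies on the boundary of the ball, so half of it witnesses that the
    open part of the cone is nonempty.\<close>
  moreover have "(1/2) *\<^sub>R x \<in> ?U" using x fx by auto
  ultimately have "\<not> negligible ?U" by (intro open_not_negligible) blast+
  moreover have "negligible ?U"
  proof (rule negligible_subset[OF _ U])
    have "{y. y /\<^sub>R norm y \<in> ?E} \<inter> (cball 0 1 - {0}) \<in> null_sets lborel"
      by (intro null_setsI C0) (simp only: sets_lborel radial_projection_sets[OF E])
    then show "negligible ({y. y /\<^sub>R norm y \<in> ?E} \<inter> (cball 0 1 - {0}))"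
      by (simp add: negligible_iff_null_sets null_sets_completionI)
  qed
  ultimately show False by contradiction
qed

section \<open>Spherical harmonics as a vector space of functions\<close>

interpretation cfs: vector_space cfun_scale
  by (rule vector_space_cfun_scale)

section \<open>Homogeneous polynomials under products and linear substitution\<close>

definition monomial_fn :: "('n::finite \<Rightarrow> nat) \<Rightarrow> real ^ 'n \<Rightarrow> complex" where
  "monomial_fn \<alpha> x = of_real (\<Prod>i\<in>UNIV. x $ i ^ \<alpha> i)"

lemma finite_exponents: "finite {\<alpha> :: 'n::finite \<Rightarrow> nat. (\<Sum>i\<in>UNIV. \<alpha> i) = l}"
proof (rule finite_subset)
  show "{\<alpha> :: 'n \<Rightarrow> nat. (\<Sum>i\<in>UNIV. \<alpha> i) = l} \<subseteq> UNIV \<rightarrow>\<^sub>E {..l}"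
    by (auto intro: member_le_sum)
  show "finite ((UNIV :: 'n set) \<rightarrow>\<^sub>E {..l})" by (intro finite_PiE) auto
qed

lemma homogeneous_polynomials_iff:
  "p \<in> homogeneous_polynomials l \<longleftrightarrow>
    (\<exists>c. p = (\<lambda>x. \<Sum>\<alpha> | (\<Sum>i\<in>UNIV. \<alpha> i) = l. c \<alpha> * monomial_fn \<alpha> x))"
  by (simp add: homogeneous_polynomials_def monomial_fn_def fun_eq_iff)

lemma subspace_homogeneous_polynomials:
  "cfs.subspace (homogeneous_polynomials l :: (real ^ 'n \<Rightarrow> complex) set)"
proof (rule cfs.subspaceI)
  show "(0 :: real ^ 'n \<Rightarrow> complex) \<in> homogeneous_polynomials l"
    unfolding homogeneous_polynomials_iff by (rule exI[of _ "\<lambda>_. 0"]) (simp add: fun_eq_iff)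
next
  fix p q :: "real ^ 'n \<Rightarrow> complex"
  assume "p \<in> homogeneous_polynomials l" "q \<in> homogeneous_polynomials l"
  then obtain c d where
    "p = (\<lambda>x. \<Sum>\<alpha> | (\<Sum>i\<in>UNIV. \<alpha> i) = l. c \<alpha> * monomial_fn \<alpha> x)"
    "q = (\<lambda>x. \<Sum>\<alpha> | (\<Sum>i\<in>UNIV. \<alpha> i) = l. d \<alpha> * monomial_fn \<alpha> x)"
    unfolding homogeneous_polynomials_iff by blast
  then show "p + q \<in> homogeneous_polynomials l"
    unfolding homogeneous_polynomials_iff
    by (intro exI[of _ "\<lambda>\<alpha>. c \<alpha> + d \<alpha>"]) (simp add: fun_eq_iff sum.distrib distrib_right)
next
  fix a :: complex and p :: "real ^ 'n \<Rightarrow> complex"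
  assume "p \<in> homogeneous_polynomials l"
  then obtain c where "p = (\<lambda>x. \<Sum>\<alpha> | (\<Sum>i\<in>UNIV. \<alpha> i) = l. c \<alpha> * monomial_fn \<alpha> x)"
    unfolding homogeneous_polynomials_iff by blast
  then show "cfun_scale a p \<in> homogeneous_polynomials l"
    unfolding homogeneous_polynomials_iff
    by (intro exI[of _ "\<lambda>\<alpha>. a * c \<alpha>"]) (simp add: fun_eq_iff cfun_scale_def sum_distrib_left mult.assoc)
qed

lemma subspace_sum_mult:
  assumes V: "cfs.subspace V" and f: "\<And>i. i \<in> I \<Longrightarrow> f i \<in> V"
  shows "(\<lambda>x. \<Sum>i\<in>I. c i * f i x) \<in> V"
  using f
proof (induction I rule: infinite_finite_induct)
  case (insert i I)
  then have "(\<lambda>x. \<Sum>i\<in>I. c i * f i x) \<in> V" "f i \<in> V" by auto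
  then have "cfun_scale (c i) (f i) + (\<lambda>x. \<Sum>i\<in>I. c i * f i x) \<in> V"
    by (intro cfs.subspace_add cfs.subspace_scale V)
  then show ?case using insert(1,2) by (simp add: cfun_scale_def plus_fun_def)
qed (use cfs.subspace_0[OF V] in \<open>simp_all add: zero_fun_def\<close>)

lemma monomial_fn_homogeneous: "monomial_fn \<alpha> \<in> homogeneous_polynomials (\<Sum>i\<in>UNIV. \<alpha> i)"
proof -
  have "monomial_fn \<alpha> = (\<lambda>x. \<Sum>\<beta> | (\<Sum>i\<in>UNIV. \<beta> i) = (\<Sum>i\<in>UNIV. \<alpha> i).
      (if \<beta> = \<alpha> then 1 else 0) * monomial_fn \<beta> x)"
    by (rule ext) (simp add: if_distrib[of "\<lambda>c. c * _"] sum.delta finite_exponents cong: if_cong)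
  then show ?thesis
    unfolding homogeneous_polynomials_iff by (rule exI[of _ "\<lambda>\<beta>. if \<beta> = \<alpha> then 1 else 0"])
qed

lemma homogeneous_polynomials_mult:
  assumes "p \<in> homogeneous_polynomials k" "q \<in> homogeneous_polynomials l"
  shows "(\<lambda>x. p x * q x) \<in> homogeneous_polynomials (k + l)"
proof -
  obtain c d where
    p: "p = (\<lambda>x. \<Sum>\<alpha> | (\<Sum>i\<in>UNIV. \<alpha> i) = k. c \<alpha> * monomial_fn \<alpha> x)" and
    q: "q = (\<lambda>x. \<Sum>\<alpha> | (\<Sum>i\<in>UNIV. \<alpha> i) = l. d \<alpha> * monomial_fn \<alpha> x)"
    using assms unfolding homogeneous_polynomials_iff by blast
  have mm: "monomial_fn \<alpha> x * monomial_fn \<beta> x = monomial_fn (\<lambda>i. \<alpha> i + \<beta> i) x"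
    for \<alpha> \<beta> :: "'a \<Rightarrow> nat" and x
    by (simp add: monomial_fn_def power_add prod.distrib)
  have "(\<lambda>x. p x * q x) = (\<lambda>x. \<Sum>\<alpha> | (\<Sum>i\<in>UNIV. \<alpha> i) = k. c \<alpha> *
      (\<Sum>\<beta> | (\<Sum>i\<in>UNIV. \<beta> i) = l. d \<beta> * monomial_fn (\<lambda>i. \<alpha> i + \<beta> i) x))"
    unfolding p q
    by (rule ext, subst sum_product)
      (auto simp: sum_distrib_left mm[symmetric] mult_ac intro!: sum.cong)
  also have "\<dots> \<in> homogeneous_polynomials (k + l)"
  proof (intro subspace_sum_mult subspace_homogeneous_polynomials)
    fix \<alpha> \<beta> :: "'a \<Rightarrow> nat"
    assume "\<alpha> \<in> {\<alpha>. (\<Sum>i\<in>UNIV. \<alpha> i) = k}" "\<beta> \<in> {\<beta>. (\<Sum>i\<in>UNIV. \<beta> i) = l}"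
    then have "(\<Sum>i\<in>UNIV. \<alpha> i + \<beta> i) = k + l" by (simp add: sum.distrib)
    then show "monomial_fn (\<lambda>i. \<alpha> i + \<beta> i) \<in> homogeneous_polynomials (k + l)"
      using monomial_fn_homogeneous[of "\<lambda>i. \<alpha> i + \<beta> i"] by simp
  qed
  finally show ?thesis .
qed

lemma homogeneous_polynomials_1: "(\<lambda>_ :: real ^ 'n. 1) \<in> homogeneous_polynomials 0"
proof -
  have "monomial_fn (\<lambda>_. 0) = (\<lambda>_ :: real ^ 'n. 1)" by (simp add: monomial_fn_def fun_eq_iff)
  then show ?thesis using monomial_fn_homogeneous[of "\<lambda>_ :: 'n. 0"] by simp
qed

lemma homogeneous_polynomials_power:
  "p \<in> homogeneous_polynomials 1 \<Longrightarrow> (\<lambda>x. p x ^ k) \<in> homogeneous_polynomials k"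
proof (induction k)
  case (Suc k)
  with homogeneous_polynomials_mult[of p 1 "\<lambda>x. p x ^ k" k] show ?case by simp
qed (simp add: homogeneous_polynomials_1)

lemma homogeneous_polynomials_prod:
  assumes "finite I" "\<And>i. i \<in> I \<Longrightarrow> p i \<in> homogeneous_polynomials (k i)"
  shows "(\<lambda>x. \<Prod>i\<in>I. p i x) \<in> homogeneous_polynomials (\<Sum>i\<in>I. k i)"
  using assms
proof (induction I rule: finite_induct)
  case (insert i I)
  with homogeneous_polynomials_mult[of "p i" "k i" "\<lambda>x. \<Prod>i\<in>I. p i x" "\<Sum>i\<in>I. k i"]
  show ?case by simp
qed (simp add: homogeneous_polynomials_1)

lemma coordinate_homogeneous: "(\<lambda>x :: real ^ 'n. of_real (x $ i)) \<in> homogeneous_polynomials 1"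
proof -
  have "(\<Prod>j\<in>UNIV. x $ j ^ (if j = i then 1 else 0)) = x $ i" for x :: "real ^ 'n"
    by (simp add: if_distrib[of "\<lambda>k. _ ^ k"] prod.delta cong: if_cong)
  then have "monomial_fn (\<lambda>j. if j = i then 1 else 0) = (\<lambda>x :: real ^ 'n. of_real (x $ i))"
    unfolding monomial_fn_def by (simp only:)
  then show ?thesis
    using monomial_fn_homogeneous[of "\<lambda>j. if j = i then 1 else 0"] by (simp add: sum.delta)
qed

text \<open>Substitution turns each coordinate into a linear form, and a monomial of degree l into a
  product of l linear forms.\<close>

lemma homogeneous_polynomials_compose_linear:
  fixes T :: "real ^ 'n \<Rightarrow> real ^ 'n"
  assumes T: "linear T" and p: "p \<in> homogeneous_polynomials l"
  shows "(\<lambda>x. p (T x)) \<in> homogeneous_polynomials l"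
proof -
  have coord: "(\<lambda>x. of_real (T x $ i)) \<in> homogeneous_polynomials 1" for i
  proof -
    have "(\<lambda>x. of_real (T x $ i)) = (\<lambda>x. \<Sum>j\<in>UNIV. of_real (matrix T $ i $ j) * complex_of_real (x $ j))"
      by (subst fun_cong[OF matrix_vector_mul(2)[OF T], symmetric]) (simp add: matrix_vector_mult_def)
    then show ?thesis
      by (simp only:) (intro subspace_sum_mult subspace_homogeneous_polynomials coordinate_homogeneous)
  qed
  obtain c where c: "p = (\<lambda>x. \<Sum>\<alpha> | (\<Sum>i\<in>UNIV. \<alpha> i) = l. c \<alpha> * monomial_fn \<alpha> x)"
    using p unfolding homogeneous_polynomials_iff by blast
  show ?thesis
    unfolding c
  proof (intro subspace_sum_mult subspace_homogeneous_polynomials)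
    fix \<alpha> :: "'n \<Rightarrow> nat" assume "\<alpha> \<in> {\<alpha>. (\<Sum>i\<in>UNIV. \<alpha> i) = l}"
    moreover have "(\<lambda>x. \<Prod>i\<in>UNIV. of_real (T x $ i) ^ \<alpha> i) \<in> homogeneous_polynomials (\<Sum>i\<in>UNIV. \<alpha> i)"
      by (intro homogeneous_polynomials_prod homogeneous_polynomials_power coord) auto
    ultimately show "(\<lambda>x. monomial_fn \<alpha> (T x)) \<in> homogeneous_polynomials l"
      by (simp add: monomial_fn_def)
  qed
qed

section \<open>Polynomial functions, partial derivatives and the Laplacian\<close>

inductive_set polynomials :: "(real ^ 'n \<Rightarrow> complex) set" where
  const: "(\<lambda>_. c) \<in> polynomials"
| coord: "(\<lambda>x. of_real (x $ i)) \<in> polynomials"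
| add: "p \<in> polynomials \<Longrightarrow> q \<in> polynomials \<Longrightarrow> (\<lambda>x. p x + q x) \<in> polynomials"
| mult: "p \<in> polynomials \<Longrightarrow> q \<in> polynomials \<Longrightarrow> (\<lambda>x. p x * q x) \<in> polynomials"

text \<open>\<open>partial_derivative\<close> is a \<open>vector_derivative\<close>, hence a choice;
  a total derivative determines its value.\<close>

lemma partial_derivative_eq:
  assumes "(f has_derivative f') (at x)"
  shows "partial_derivative i f x = f' (axis i 1)"
proof -
  have 1: "((\<lambda>t. x + t *\<^sub>R axis i 1) has_derivative (\<lambda>t. t *\<^sub>R axis i 1)) (at 0)"
    by (auto intro!: derivative_eq_intros)
  have 2: "(f has_derivative f') (at (x + 0 *\<^sub>R axis i 1))" using assms by simp
  have "(f \<circ> (\<lambda>t. x + t *\<^sub>R axis i 1) has_derivative f' \<circ> (\<lambda>t. t *\<^sub>R axis i 1)) (at 0)"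
    by (rule diff_chain_at[OF 1 2])
  moreover have "f' \<circ> (\<lambda>t. t *\<^sub>R axis i 1) = (\<lambda>t. t *\<^sub>R f' (axis i 1))"
    using linear_scale[OF has_derivative_linear[OF assms]] by auto
  ultimately have "((\<lambda>t. f (x + t *\<^sub>R axis i 1)) has_vector_derivative f' (axis i 1)) (at 0)"
    by (simp add: has_vector_derivative_def o_def)
  then show ?thesis
    unfolding partial_derivative_def by (rule vector_derivative_at)
qed

text \<open>Differentiation lowers the degree of a homogeneous polynomial, so a class closed under
  it without a degree is used. The coefficients D are existential because the induction has to
  produce polynomials; that they are the partial derivatives follows afterwards.\<close>

lemma polynomials_has_derivative_ex:
  assumes "p \<in> polynomials"
  shows "\<exists>D. (\<forall>i. D i \<in> polynomials) \<and>
    (\<forall>x. (p has_derivative (\<lambda>h. \<Sum>i\<in>UNIV. (h $ i) *\<^sub>R D i x)) (at x))"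
  using assms
proof (induction p rule: polynomials.induct)
  case (const c)
  show ?case by (rule exI[of _ "\<lambda>i x. 0"]) (auto intro: polynomials.const)
next
  case (coord j)
  have "((\<lambda>x :: real ^ 'a. complex_of_real (x $ j)) has_derivative (\<lambda>h. of_real (h $ j))) (at x)" for x
    by (intro bounded_linear_imp_has_derivative bounded_linear_compose[OF bounded_linear_of_real]
        bounded_linear_vec_nth)
  moreover have "(\<lambda>h :: real ^ 'a. complex_of_real (h $ j)) =
      (\<lambda>h. \<Sum>i\<in>UNIV. (h $ i) *\<^sub>R (if i = j then 1 else 0))"
    by (rule ext) (simp add: if_distrib[of "scaleR _"] sum.delta scaleR_conv_of_real[of _ 1] cong: if_cong)
  ultimately show ?case
    by (intro exI[of _ "\<lambda>i x. if i = j then 1 else 0"]) (auto intro: polynomials.const)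
next
  case (add p q)
  then obtain D E where D: "\<forall>i. D i \<in> polynomials" "\<forall>i. E i \<in> polynomials"
    "\<And>x. (p has_derivative (\<lambda>h. \<Sum>i\<in>UNIV. (h $ i) *\<^sub>R D i x)) (at x)"
    "\<And>x. (q has_derivative (\<lambda>h. \<Sum>i\<in>UNIV. (h $ i) *\<^sub>R E i x)) (at x)"
    by blast
  show ?case
  proof (intro exI[of _ "\<lambda>i x. D i x + E i x"] conjI allI)
    show "(\<lambda>x. D i x + E i x) \<in> polynomials" for i using D by (intro polynomials.add) auto
    show "((\<lambda>x. p x + q x) has_derivative (\<lambda>h. \<Sum>i\<in>UNIV. (h $ i) *\<^sub>R (D i x + E i x))) (at x)" for x
      using has_derivative_add[OF D(3,4), of x] by (simp add: scaleR_right_distrib sum.distrib)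
  qed
next
  case (mult p q)
  then obtain D E where D: "\<forall>i. D i \<in> polynomials" "\<forall>i. E i \<in> polynomials"
    "\<And>x. (p has_derivative (\<lambda>h. \<Sum>i\<in>UNIV. (h $ i) *\<^sub>R D i x)) (at x)"
    "\<And>x. (q has_derivative (\<lambda>h. \<Sum>i\<in>UNIV. (h $ i) *\<^sub>R E i x)) (at x)"
    by blast
  show ?case
  proof (intro exI[of _ "\<lambda>i x. p x * E i x + D i x * q x"] conjI allI)
    show "(\<lambda>x. p x * E i x + D i x * q x) \<in> polynomials" for i
      using D mult by (intro polynomials.add polynomials.mult) auto
    show "((\<lambda>x. p x * q x) has_derivative
        (\<lambda>h. \<Sum>i\<in>UNIV. (h $ i) *\<^sub>R (p x * E i x + D i x * q x))) (at x)" for x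
      using has_derivative_mult[OF D(3,4), of x]
      by (simp add: scaleR_right_distrib sum.distrib sum_distrib_left sum_distrib_right)
  qed
qed

lemma polynomials_partial_derivative:
  assumes "p \<in> polynomials"
  shows "partial_derivative i p \<in> polynomials"
    "(p has_derivative (\<lambda>h. \<Sum>i\<in>UNIV. (h $ i) *\<^sub>R partial_derivative i p x)) (at x)"
proof -
  obtain D where D: "\<And>i. D i \<in> polynomials"
    "\<And>x. (p has_derivative (\<lambda>h. \<Sum>i\<in>UNIV. (h $ i) *\<^sub>R D i x)) (at x)"
    using polynomials_has_derivative_ex[OF assms] by blast
  have "partial_derivative i p x = D i x" for i x
    unfolding partial_derivative_eq[OF D(2)]
    by (simp add: axis_def if_distrib[of "\<lambda>a. a *\<^sub>R _"] sum.delta cong: if_cong)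
  then have "partial_derivative i p = D i" for i by (simp add: fun_eq_iff)
  with D show "partial_derivative i p \<in> polynomials"
    "(p has_derivative (\<lambda>h. \<Sum>i\<in>UNIV. (h $ i) *\<^sub>R partial_derivative i p x)) (at x)"
    by simp_all
qed

lemma polynomials_sum:
  assumes "\<And>i. i \<in> I \<Longrightarrow> p i \<in> polynomials"
  shows "(\<lambda>x. \<Sum>i\<in>I. p i x) \<in> polynomials"
  using assms
proof (induction I rule: infinite_finite_induct)
  case (insert i I)
  with polynomials.add[of "p i" "\<lambda>x. \<Sum>i\<in>I. p i x"] show ?case by simp
qed (simp_all add: polynomials.const)

lemma polynomials_prod:
  assumes "\<And>i. i \<in> I \<Longrightarrow> p i \<in> polynomials"
  shows "(\<lambda>x. \<Prod>i\<in>I. p i x) \<in> polynomials"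
  using assms
proof (induction I rule: infinite_finite_induct)
  case (insert i I)
  with polynomials.mult[of "p i" "\<lambda>x. \<Prod>i\<in>I. p i x"] show ?case by simp
qed (simp_all add: polynomials.const)

lemma polynomials_power: "p \<in> polynomials \<Longrightarrow> (\<lambda>x. p x ^ k) \<in> polynomials"
proof (induction k)
  case (Suc k)
  with polynomials.mult[of p "\<lambda>x. p x ^ k"] show ?case by simp
qed (simp add: polynomials.const)

lemma homogeneous_imp_polynomial:
  assumes "p \<in> homogeneous_polynomials l"
  shows "p \<in> polynomials"
proof -
  obtain c where c: "p = (\<lambda>x. \<Sum>\<alpha> | (\<Sum>i\<in>UNIV. \<alpha> i) = l. c \<alpha> * monomial_fn \<alpha> x)"
    using assms unfolding homogeneous_polynomials_iff by blast
  have "monomial_fn \<alpha> \<in> polynomials" for \<alpha> :: "'a \<Rightarrow> nat"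
    unfolding monomial_fn_def[abs_def] of_real_prod of_real_power
    by (intro polynomials_prod polynomials_power polynomials.coord)
  then show ?thesis
    unfolding c by (intro polynomials_sum polynomials.mult polynomials.const)
qed

lemma polynomials_continuous:
  assumes "p \<in> polynomials"
  shows "continuous_on S p"
proof (rule continuous_at_imp_continuous_on, rule ballI)
  show "isCont p x" for x
    by (rule has_derivative_continuous[OF polynomials_partial_derivative(2)[OF assms]])
qed

text \<open>The chain rule, applied twice, brings in products of entries of T summed over i, and T
  T^t = 1 reduces them to the diagonal j = k.\<close>

lemma laplacian_compose_orthogonal:
  fixes T :: "real ^ 'n \<Rightarrow> real ^ 'n"
  assumes T: "orthogonal_transformation T" and p: "p \<in> polynomials"
  shows "laplacian (\<lambda>x. p (T x)) x = laplacian p (T x)"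
proof -
  have lin: "linear T" by (rule orthogonal_transformation_linear[OF T])
  have chain: "((\<lambda>x. q (T x)) has_derivative
      (\<lambda>h. \<Sum>j\<in>UNIV. (T h $ j) *\<^sub>R partial_derivative j q (T x))) (at x)"
    if "q \<in> polynomials" for q x
  proof -
    have "(T has_derivative T) (at x)"
      by (intro bounded_linear_imp_has_derivative) (simp add: lin linear_linear)
    from diff_chain_at[OF this polynomials_partial_derivative(2)[OF that]]
    show ?thesis by (simp add: o_def)
  qed
  have D1: "partial_derivative i (\<lambda>x. p (T x)) =
      (\<lambda>x. \<Sum>j\<in>UNIV. (T (axis i 1) $ j) *\<^sub>R partial_derivative j p (T x))" for i
    by (rule ext) (rule partial_derivative_eq[OF chain[OF p]])
  have D2: "partial_derivative i (partial_derivative i (\<lambda>x. p (T x))) x =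
      (\<Sum>j\<in>UNIV. \<Sum>k\<in>UNIV. (T (axis i 1) $ j * T (axis i 1) $ k) *\<^sub>R
        partial_derivative k (partial_derivative j p) (T x))" for i
  proof -
    have "((\<lambda>x. \<Sum>j\<in>UNIV. (T (axis i 1) $ j) *\<^sub>R partial_derivative j p (T x)) has_derivative
      (\<lambda>h. \<Sum>j\<in>UNIV. (T (axis i 1) $ j) *\<^sub>R
        (\<Sum>k\<in>UNIV. (T h $ k) *\<^sub>R partial_derivative k (partial_derivative j p) (T x)))) (at x)"
      by (intro has_derivative_sum has_derivative_scaleR_right chain polynomials_partial_derivative p)
    from partial_derivative_eq[OF this, of i] show ?thesis
      unfolding D1 by (simp add: scaleR_sum_right)
  qed
  have orth: "(\<Sum>i\<in>UNIV. T (axis i 1) $ j * T (axis i 1) $ k) = (if j = k then 1 else 0)" for j k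
  proof -
    have "orthogonal_matrix (matrix T)"
      using T by (simp add: orthogonal_transformation_matrix)
    then have "matrix T ** transpose (matrix T) = mat 1" by (simp add: orthogonal_matrix_def)
    then have "(matrix T ** transpose (matrix T)) $ j $ k = mat 1 $ j $ k" by simp
    then show ?thesis by (simp add: matrix_matrix_mult_def transpose_def matrix_def mat_def)
  qed
  have "laplacian (\<lambda>x. p (T x)) x =
      (\<Sum>j\<in>UNIV. \<Sum>k\<in>UNIV. \<Sum>i\<in>UNIV. (T (axis i 1) $ j * T (axis i 1) $ k) *\<^sub>R
        partial_derivative k (partial_derivative j p) (T x))"
    unfolding laplacian_def D2 by (subst sum.swap) (intro sum.cong refl sum.swap)
  also have "\<dots> = (\<Sum>j\<in>UNIV. \<Sum>k\<in>UNIV. (if j = k then 1 else 0) *\<^sub>R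
        partial_derivative k (partial_derivative j p) (T x))"
    by (simp only: scaleR_sum_left[symmetric] orth)
  also have "\<dots> = laplacian p (T x)"
    by (simp add: laplacian_def if_distrib[of "\<lambda>a. a *\<^sub>R _"] sum.delta cong: if_cong)
  finally show ?thesis .
qed

lemma laplacian_linear:
  assumes p: "p \<in> polynomials" and q: "q \<in> polynomials"
  shows "laplacian (\<lambda>x. a * p x + q x) x = a * laplacian p x + laplacian q x"
proof -
  \<comment> \<open>Quantified over p and q, since it is applied a second time, to their partial
    derivatives.\<close>
  have D: "partial_derivative i (\<lambda>x. a * p x + q x) =
      (\<lambda>x. a * partial_derivative i p x + partial_derivative i q x)"
    if "p \<in> polynomials" "q \<in> polynomials" for i p q
  proof
    fix x
    have "((\<lambda>x. a * p x + q x) has_derivative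
        (\<lambda>h. a * (\<Sum>i\<in>UNIV. (h $ i) *\<^sub>R partial_derivative i p x) +
          (\<Sum>i\<in>UNIV. (h $ i) *\<^sub>R partial_derivative i q x))) (at x)"
      by (intro has_derivative_add has_derivative_mult_right polynomials_partial_derivative that)
    from partial_derivative_eq[OF this, of i]
    show "partial_derivative i (\<lambda>x. a * p x + q x) x =
        a * partial_derivative i p x + partial_derivative i q x"
      by (simp add: axis_def if_distrib[of "\<lambda>a. a *\<^sub>R _"] sum.delta cong: if_cong)
  qed
  show ?thesis
    by (simp add: laplacian_def D p q polynomials_partial_derivative sum.distrib sum_distrib_left)
qed

section \<open>The space of spherical harmonics\<close>

lemma spherical_harmonicsI:
  assumes "p \<in> homogeneous_polynomials l" "\<And>x. laplacian p x = 0"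
    "f = (\<lambda>x. if x \<in> sphere 0 1 then p x else 0)"
  shows "f \<in> spherical_harmonics l"
  unfolding spherical_harmonics_def mem_Collect_eq
  by (intro exI[of _ p] conjI allI assms)

lemma spherical_harmonicsE:
  assumes "f \<in> spherical_harmonics l"
  obtains p where "p \<in> homogeneous_polynomials l" "\<forall>x. laplacian p x = 0"
    "f = (\<lambda>x. if x \<in> sphere 0 1 then p x else 0)"
  using assms unfolding spherical_harmonics_def by blast

lemma spherical_harmonics_uptoI:
  assumes "\<And>l. l \<le> n \<Longrightarrow> Y l \<in> spherical_harmonics l" "f = (\<lambda>x. \<Sum>l\<le>n. Y l x)"
  shows "f \<in> spherical_harmonics_upto n"
  unfolding spherical_harmonics_upto_def mem_Collect_eq
  by (intro exI[of _ Y] conjI allI impI assms)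

lemma spherical_harmonics_uptoE:
  assumes "f \<in> spherical_harmonics_upto n"
  obtains Y where "\<forall>l\<le>n. Y l \<in> spherical_harmonics l" "f = (\<lambda>x. \<Sum>l\<le>n. Y l x)"
  using assms unfolding spherical_harmonics_upto_def by blast

lemma subspace_spherical_harmonics:
  "cfs.subspace (spherical_harmonics l :: (real ^ 'n \<Rightarrow> complex) set)"
proof -
  have lin: "(\<lambda>x. a * f x + g x) \<in> spherical_harmonics l"
    if fg: "f \<in> spherical_harmonics l" "g \<in> spherical_harmonics l"
    for a and f g :: "real ^ 'n \<Rightarrow> complex"
  proof -
    obtain p where p: "p \<in> homogeneous_polynomials l" "\<forall>x. laplacian p x = 0"
      "f = (\<lambda>x. if x \<in> sphere 0 1 then p x else 0)"
      using fg(1) by (rule spherical_harmonicsE)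
    obtain q where q: "q \<in> homogeneous_polynomials l" "\<forall>x. laplacian q x = 0"
      "g = (\<lambda>x. if x \<in> sphere 0 1 then q x else 0)"
      using fg(2) by (rule spherical_harmonicsE)
    have "cfun_scale a p + q \<in> homogeneous_polynomials l"
      by (intro cfs.subspace_add cfs.subspace_scale subspace_homogeneous_polynomials p q)
    moreover have "cfun_scale a p + q = (\<lambda>x. a * p x + q x)"
      by (simp add: cfun_scale_def fun_eq_iff)
    ultimately have "(\<lambda>x. a * p x + q x) \<in> homogeneous_polynomials l" by simp
    moreover have "laplacian (\<lambda>x. a * p x + q x) x = 0" for x
      using p q by (simp add: laplacian_linear homogeneous_imp_polynomial)
    moreover have "(\<lambda>x. a * f x + g x) = (\<lambda>x. if x \<in> sphere 0 1 then a * p x + q x else 0)"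
      by (auto simp: p q)
    ultimately show ?thesis by (rule spherical_harmonicsI)
  qed
  have 0: "(\<lambda>_. 0) \<in> (spherical_harmonics l :: (real ^ 'n \<Rightarrow> complex) set)"
  proof -
    have "(\<lambda>_. 0) \<in> (homogeneous_polynomials l :: (real ^ 'n \<Rightarrow> complex) set)"
      using cfs.subspace_0[OF subspace_homogeneous_polynomials] by (simp add: zero_fun_def)
    moreover have "laplacian (\<lambda>_ :: real ^ 'n. 0) x = 0" for x
      by (simp add: laplacian_def partial_derivative_def[abs_def])
    ultimately show ?thesis by (rule spherical_harmonicsI) auto
  qed
  show ?thesis
  proof (rule cfs.subspaceI)
    show "(0 :: real ^ 'n \<Rightarrow> complex) \<in> spherical_harmonics l" using 0 by (simp add: zero_fun_def)
  next
    fix f g :: "real ^ 'n \<Rightarrow> complex"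
    assume "f \<in> spherical_harmonics l" "g \<in> spherical_harmonics l"
    from lin[OF this, of 1] show "f + g \<in> spherical_harmonics l" by (simp add: plus_fun_def)
  next
    fix a :: complex and f :: "real ^ 'n \<Rightarrow> complex"
    assume "f \<in> spherical_harmonics l"
    from lin[OF this 0, of a] show "cfun_scale a f \<in> spherical_harmonics l"
      by (simp add: cfun_scale_def)
  qed
qed

lemma subspace_spherical_harmonics_upto:
  "cfs.subspace (spherical_harmonics_upto n :: (real ^ 'n \<Rightarrow> complex) set)"
proof -
  have zero: "(0 :: real ^ 'n \<Rightarrow> complex) \<in> spherical_harmonics_upto n"
    by (rule spherical_harmonics_uptoI[of _ "\<lambda>_. 0"])
      (auto simp: fun_eq_iff intro: cfs.subspace_0[OF subspace_spherical_harmonics])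
  have add: "f + g \<in> spherical_harmonics_upto n"
    if f: "f \<in> spherical_harmonics_upto n" and g: "g \<in> spherical_harmonics_upto n"
    for f g :: "real ^ 'n \<Rightarrow> complex"
  proof -
    obtain Y where Y: "\<forall>l\<le>n. Y l \<in> spherical_harmonics l" "f = (\<lambda>x. \<Sum>l\<le>n. Y l x)"
      using f by (rule spherical_harmonics_uptoE)
    obtain Z where Z: "\<forall>l\<le>n. Z l \<in> spherical_harmonics l" "g = (\<lambda>x. \<Sum>l\<le>n. Z l x)"
      using g by (rule spherical_harmonics_uptoE)
    have "Y l + Z l \<in> spherical_harmonics l" if "l \<le> n" for l
      using Y Z that by (intro cfs.subspace_add subspace_spherical_harmonics) auto
    moreover have "f + g = (\<lambda>x. \<Sum>l\<le>n. (Y l + Z l) x)"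
      by (simp add: Y Z fun_eq_iff sum.distrib)
    ultimately show ?thesis by (rule spherical_harmonics_uptoI)
  qed
  have scale: "cfun_scale a f \<in> spherical_harmonics_upto n"
    if f: "f \<in> spherical_harmonics_upto n" for a and f :: "real ^ 'n \<Rightarrow> complex"
  proof -
    obtain Y where Y: "\<forall>l\<le>n. Y l \<in> spherical_harmonics l" "f = (\<lambda>x. \<Sum>l\<le>n. Y l x)"
      using f by (rule spherical_harmonics_uptoE)
    have "cfun_scale a (Y l) \<in> spherical_harmonics l" if "l \<le> n" for l
      using Y that by (intro cfs.subspace_scale subspace_spherical_harmonics) auto
    moreover have "cfun_scale a f = (\<lambda>x. \<Sum>l\<le>n. cfun_scale a (Y l) x)"
      by (simp add: Y cfun_scale_def sum_distrib_left)
    ultimately show ?thesis by (rule spherical_harmonics_uptoI)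
  qed
  show ?thesis by (rule cfs.subspaceI) (fact zero add scale)+
qed

text \<open>An orthogonal map preserves harmonicity, degree and the sphere, so it also respects the
  extension by 0.\<close>

lemma spherical_harmonics_upto_compose_orthogonal:
  fixes T :: "real ^ 'n \<Rightarrow> real ^ 'n"
  assumes T: "orthogonal_transformation T" and f: "f \<in> spherical_harmonics_upto n"
  shows "(\<lambda>x. f (T x)) \<in> spherical_harmonics_upto n"
proof -
  have 1: "(\<lambda>x. g (T x)) \<in> spherical_harmonics l" if "g \<in> spherical_harmonics l" for g l
  proof -
    obtain p where p: "p \<in> homogeneous_polynomials l" "\<forall>x. laplacian p x = 0"
      "g = (\<lambda>x. if x \<in> sphere 0 1 then p x else 0)"
      using \<open>g \<in> spherical_harmonics l\<close> by (rule spherical_harmonicsE)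
    have "(\<lambda>x. p (T x)) \<in> homogeneous_polynomials l"
      by (rule homogeneous_polynomials_compose_linear[OF orthogonal_transformation_linear[OF T] p(1)])
    moreover have "laplacian (\<lambda>x. p (T x)) x = 0" for x
      using p by (simp add: laplacian_compose_orthogonal[OF T] homogeneous_imp_polynomial)
    moreover have "(\<lambda>x. g (T x)) = (\<lambda>x. if x \<in> sphere 0 1 then p (T x) else 0)"
      by (simp add: p orthogonal_transformation_norm[OF T])
    ultimately show ?thesis by (rule spherical_harmonicsI)
  qed
  obtain Y where Y: "\<forall>l\<le>n. Y l \<in> spherical_harmonics l" "f = (\<lambda>x. \<Sum>l\<le>n. Y l x)"
    using f by (rule spherical_harmonics_uptoE)
  show ?thesis
    by (rule spherical_harmonics_uptoI[of _ "\<lambda>l x. Y l (T x)"]) (use Y 1 in auto)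
qed

lemma spherical_harmonics_upto_continuous:
  assumes "f \<in> spherical_harmonics_upto n"
  shows "continuous_on (sphere 0 1) f" "norm x \<noteq> 1 \<Longrightarrow> f x = 0"
proof -
  obtain Y where Y: "\<forall>l\<le>n. Y l \<in> spherical_harmonics l" "f = (\<lambda>x. \<Sum>l\<le>n. Y l x)"
    using assms by (rule spherical_harmonics_uptoE)
  have *: "continuous_on (sphere 0 1) (Y l) \<and> (\<forall>x. norm x \<noteq> 1 \<longrightarrow> Y l x = 0)" if l: "l \<le> n" for l
  proof -
    obtain p where p: "p \<in> homogeneous_polynomials l" "\<forall>x. laplacian p x = 0"
      "Y l = (\<lambda>x. if x \<in> sphere 0 1 then p x else 0)"
      using Y(1)[rule_format, OF l] by (rule spherical_harmonicsE)
    have "continuous_on (sphere 0 1) p"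
      by (intro polynomials_continuous homogeneous_imp_polynomial[OF p(1)])
    then have "continuous_on (sphere 0 1) (Y l)"
      by (rule continuous_on_eq) (simp add: p)
    then show ?thesis by (simp add: p)
  qed
  then show "continuous_on (sphere 0 1) f"
    unfolding Y(2) by (intro continuous_on_sum) auto
  show "f x = 0" if "norm x \<noteq> 1" using that * by (simp add: Y(2))
qed

text \<open>Finite dimension, from the finitely many monomials of degree at most n restricted to the
  sphere; it bounds the size of orthonormal families.\<close>

lemma spherical_harmonics_upto_finite_span:
  "\<exists>F. finite F \<and> (spherical_harmonics_upto n :: (real ^ 'n \<Rightarrow> complex) set) \<subseteq> cfs.span F"
proof -
  define m where "m \<alpha> = (\<lambda>x :: real ^ 'n. if x \<in> sphere 0 1 then monomial_fn \<alpha> x else 0)" for \<alpha>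
  define F where "F = m ` (\<Union>l\<le>n. {\<alpha>. (\<Sum>i\<in>UNIV. \<alpha> i) = l})"
  have "f \<in> cfs.span F" if f: "f \<in> spherical_harmonics_upto n" for f
  proof -
    obtain Y where Y: "\<forall>l\<le>n. Y l \<in> spherical_harmonics l" "f = (\<lambda>x. \<Sum>l\<le>n. Y l x)"
      using f by (rule spherical_harmonics_uptoE)
    have "Y l \<in> cfs.span F" if l: "l \<le> n" for l
    proof -
      obtain p where p: "p \<in> homogeneous_polynomials l" "\<forall>x. laplacian p x = 0"
        "Y l = (\<lambda>x. if x \<in> sphere 0 1 then p x else 0)"
        using Y(1)[rule_format, OF l] by (rule spherical_harmonicsE)
      obtain c where c: "p = (\<lambda>x. \<Sum>\<alpha> | (\<Sum>i\<in>UNIV. \<alpha> i) = l. c \<alpha> * monomial_fn \<alpha> x)"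
        using p(1) unfolding homogeneous_polynomials_iff by blast
      have "Y l = (\<lambda>x. \<Sum>\<alpha> | (\<Sum>i\<in>UNIV. \<alpha> i) = l. c \<alpha> * m \<alpha> x)"
        unfolding p(3) c m_def by (auto simp: fun_eq_iff)
      also have "\<dots> \<in> cfs.span F"
        using l by (intro subspace_sum_mult cfs.subspace_span cfs.span_base) (auto simp: F_def)
      finally show ?thesis .
    qed
    then have "(\<lambda>x. \<Sum>l\<le>n. 1 * Y l x) \<in> cfs.span F"
      by (intro subspace_sum_mult cfs.subspace_span) auto
    then show ?thesis by (simp add: Y(2))
  qed
  then have "(spherical_harmonics_upto n :: (real ^ 'n \<Rightarrow> complex) set) \<subseteq> cfs.span F"
    by (rule subsetI)
  moreover have "finite F" unfolding F_def by (intro finite_imageI finite_UN_I finite_exponents) auto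
  ultimately show ?thesis by (intro exI[of _ F] conjI)
qed

text \<open>Ensures that the dimension d is positive, so that division by d makes sense.\<close>

lemma spherical_harmonics_upto_nonzero:
  "\<exists>f \<in> (spherical_harmonics_upto n :: (real ^ 'n \<Rightarrow> complex) set). f \<noteq> 0"
proof
  let ?f = "\<lambda>x :: real ^ 'n. if x \<in> sphere 0 1 then (1 :: complex) else 0"
  have "laplacian (\<lambda>_ :: real ^ 'n. 1) x = 0" for x
    by (simp add: laplacian_def partial_derivative_def[abs_def])
  then have "?f \<in> spherical_harmonics 0"
    by (intro spherical_harmonicsI[OF homogeneous_polynomials_1]) auto
  moreover have "?f = (\<lambda>x. \<Sum>l\<le>n. (if l = 0 then ?f else 0) x)"
  proof
    fix x
    have "(\<Sum>l\<le>n. (if l = 0 then ?f else 0) x) = (\<Sum>l\<le>n. if l = 0 then ?f x else 0)"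
      by (intro sum.cong) auto
    then show "?f x = (\<Sum>l\<le>n. (if l = 0 then ?f else 0) x)" by (simp add: sum.delta)
  qed
  ultimately show "?f \<in> spherical_harmonics_upto n"
    by (intro spherical_harmonics_uptoI[of n "\<lambda>l. if l = 0 then ?f else 0"])
      (auto intro: cfs.subspace_0[OF subspace_spherical_harmonics])
  have "?f (axis undefined 1) \<noteq> 0 (axis undefined 1)" by (simp add: norm_axis_1)
  then show "?f \<noteq> 0" by (rule contrapos_nn) (rule fun_cong)
qed

section \<open>Orthonormal bases of spherical harmonics\<close>

definition sphere_ip :: "(real ^ 'n \<Rightarrow> complex) \<Rightarrow> (real ^ 'n \<Rightarrow> complex) \<Rightarrow> complex" where
  "sphere_ip f g = (LINT x|normalized_surface_measure. f x * cnj (g x))"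

definition sphere_orthonormal :: "(real ^ 'n \<Rightarrow> complex) set \<Rightarrow> bool" where
  "sphere_orthonormal B \<longleftrightarrow> (\<forall>b\<in>B. \<forall>c\<in>B. sphere_ip b c = (if b = c then 1 else 0))"

lemma cnj_sphere_ip: "cnj (sphere_ip f g) = sphere_ip g f"
  by (simp add: sphere_ip_def Bochner_Integration.integral_cnj[symmetric] mult.commute
      del: Bochner_Integration.integral_cnj)

lemma sphere_L2_norm_square:
  "(sphere_L2_norm f)\<^sup>2 = (LINT x|normalized_surface_measure. (cmod (f x))\<^sup>2)"
  unfolding sphere_L2_norm_def by (intro real_sqrt_pow2 integral_nonneg) auto

lemma sphere_ip_self: "sphere_ip f f = of_real ((sphere_L2_norm f)\<^sup>2)"
proof -
  have "sphere_ip f f = (LINT x|normalized_surface_measure. complex_of_real ((cmod (f x))\<^sup>2))"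
    by (simp only: sphere_ip_def complex_norm_square)
  then show ?thesis by (simp only: integral_complex_of_real sphere_L2_norm_square)
qed

lemma sphere_ip_sum_left:
  assumes f: "\<And>i. i \<in> I \<Longrightarrow> continuous_on (sphere 0 1) (f i)" and g: "continuous_on (sphere 0 1) g"
  shows "sphere_ip (\<lambda>x. \<Sum>i\<in>I. u i * f i x) g = (\<Sum>i\<in>I. u i * sphere_ip (f i) g)"
proof -
  have int: "integrable normalized_surface_measure (\<lambda>x. f i x * cnj (g x))" if "i \<in> I" for i
    using f[OF that] g by (intro continuous_on_sphere_integrable continuous_intros)
  have "sphere_ip (\<lambda>x. \<Sum>i\<in>I. u i * f i x) g =
      (LINT x|normalized_surface_measure. (\<Sum>i\<in>I. u i * (f i x * cnj (g x))))"
    by (simp add: sphere_ip_def sum_distrib_right mult.assoc)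
  also have "\<dots> = (\<Sum>i\<in>I. LINT x|normalized_surface_measure. u i * (f i x * cnj (g x)))"
    by (intro Bochner_Integration.integral_sum integrable_mult_right int)
  finally show ?thesis by (simp add: sphere_ip_def)
qed

lemma sphere_ip_sum_right:
  assumes f: "\<And>i. i \<in> I \<Longrightarrow> continuous_on (sphere 0 1) (f i)" and g: "continuous_on (sphere 0 1) g"
  shows "sphere_ip g (\<lambda>x. \<Sum>i\<in>I. u i * f i x) = (\<Sum>i\<in>I. cnj (u i) * sphere_ip g (f i))"
  using arg_cong[OF sphere_ip_sum_left[OF f g, of I "\<lambda>i. i" u], of cnj]
  by (simp add: cnj_sphere_ip)

lemma sphere_ip_orthonormal_sum:
  assumes B: "finite B" "sphere_orthonormal B" "\<And>b. b \<in> B \<Longrightarrow> continuous_on (sphere 0 1) b"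
    and c: "c \<in> B"
  shows "sphere_ip (\<lambda>x. \<Sum>b\<in>B. u b * b x) c = u c"
proof -
  have "sphere_ip (\<lambda>x. \<Sum>b\<in>B. u b * b x) c = (\<Sum>b\<in>B. u b * sphere_ip b c)"
    using B c by (intro sphere_ip_sum_left) auto
  also have "\<dots> = (\<Sum>b\<in>B. if b = c then u b else 0)"
    using B(2) c by (intro sum.cong) (auto simp: sphere_orthonormal_def)
  finally show ?thesis using B(1) c by simp
qed

lemma sphere_L2_norm_orthonormal_sum:
  assumes B: "finite B" "sphere_orthonormal B" "\<And>b. b \<in> B \<Longrightarrow> continuous_on (sphere 0 1) b"
  shows "(sphere_L2_norm (\<lambda>x. \<Sum>b\<in>B. u b * b x))\<^sup>2 = (\<Sum>b\<in>B. (cmod (u b))\<^sup>2)"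
proof -
  let ?f = "\<lambda>x. \<Sum>b\<in>B. u b * b x"
  have "continuous_on (sphere 0 1) ?f" by (intro continuous_intros B)
  then have "sphere_ip ?f ?f = (\<Sum>c\<in>B. cnj (u c) * sphere_ip ?f c)"
    using B by (intro sphere_ip_sum_right) auto
  also have "\<dots> = (\<Sum>c\<in>B. complex_of_real ((cmod (u c))\<^sup>2))"
    by (intro sum.cong refl)
      (simp only: sphere_ip_orthonormal_sum[OF B] complex_norm_square, rule mult.commute)
  finally have "complex_of_real ((sphere_L2_norm ?f)\<^sup>2) = of_real (\<Sum>c\<in>B. (cmod (u c))\<^sup>2)"
    by (simp only: sphere_ip_self of_real_sum)
  then show ?thesis by (simp only: of_real_eq_iff)
qed

lemma sphere_orthonormal_independent:
  assumes B: "finite B" "sphere_orthonormal B" "\<And>b. b \<in> B \<Longrightarrow> continuous_on (sphere 0 1) b"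
  shows "cfs.independent B"
proof
  assume "cfs.dependent B"
  then obtain u where u: "\<exists>b\<in>B. u b \<noteq> 0" "(\<Sum>b\<in>B. cfun_scale (u b) b) = 0"
    using B(1) by (auto simp: cfs.dependent_finite)
  then obtain c where c: "c \<in> B" "u c \<noteq> 0" by blast
  have sum_apply: "(\<Sum>b\<in>B. cfun_scale (u b) b) x = (\<Sum>b\<in>B. u b * b x)" for x
    using B(1) by (induction B rule: finite_induct) (simp_all add: cfun_scale_def)
  have "(\<lambda>x. \<Sum>b\<in>B. u b * b x) = (\<lambda>_. 0)"
    unfolding sum_apply[symmetric] u(2) by (simp add: fun_eq_iff)
  then have "sphere_ip (\<lambda>x. \<Sum>b\<in>B. u b * b x) c = 0" by (simp add: sphere_ip_def)
  then have "u c = 0" by (simp only: sphere_ip_orthonormal_sum[OF B c(1)])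
  with c show False by simp
qed

text \<open>Instead of orthogonalising a given basis, a largest orthonormal subset is taken, which
  exists because a finite spanning set bounds the sizes. If some P differed from its expansion, the
  normalised remainder could be added.\<close>

lemma spherical_harmonics_orthonormal_basis:
  obtains B :: "(real ^ 'n \<Rightarrow> complex) set" where "finite B" "B \<subseteq> spherical_harmonics_upto n"
    "sphere_orthonormal B"
    "card B = complex_dim (spherical_harmonics_upto n :: (real ^ 'n \<Rightarrow> complex) set)"
    "\<And>P. P \<in> spherical_harmonics_upto n \<Longrightarrow> P = (\<lambda>x. \<Sum>b\<in>B. sphere_ip P b * b x)"
proof -
  let ?V = "spherical_harmonics_upto n :: (real ^ 'n \<Rightarrow> complex) set"
  have V: "cfs.subspace ?V" by (rule subspace_spherical_harmonics_upto)
  have cont: "continuous_on (sphere 0 1) f" if "f \<in> ?V" for f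
    using spherical_harmonics_upto_continuous(1)[OF that] .
  obtain F where F: "finite F" "?V \<subseteq> cfs.span F"
    using spherical_harmonics_upto_finite_span by blast
  define Q where "Q B \<longleftrightarrow> finite B \<and> B \<subseteq> ?V \<and> sphere_orthonormal B" for B
  have indep: "cfs.independent B" if "Q B" for B
    using that cont by (intro sphere_orthonormal_independent) (auto simp: Q_def)
  have "card B \<le> card F" if "Q B" for B
    using cfs.independent_span_bound[OF F(1) indep[OF that]] that F(2) by (auto simp: Q_def)
  then have "\<forall>B. Q B \<longrightarrow> card B < Suc (card F)" by (simp add: less_Suc_eq_le)
  moreover have "Q {}" by (simp add: Q_def sphere_orthonormal_def)
  ultimately obtain B where B: "Q B" and max: "\<And>C. Q C \<Longrightarrow> card C \<le> card B"
    using ex_has_greatest_nat[of Q "{}" card "Suc (card F)"] by blast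
  have fB: "finite B" "B \<subseteq> ?V" "sphere_orthonormal B" using B by (auto simp: Q_def)
  have contB: "continuous_on (sphere 0 1) b" if "b \<in> B" for b using fB(2) that cont by blast
  have expand: "P = (\<lambda>x. \<Sum>b\<in>B. sphere_ip P b * b x)" if P: "P \<in> ?V" for P
  proof (rule ccontr)
    assume neq: "P \<noteq> (\<lambda>x. \<Sum>b\<in>B. sphere_ip P b * b x)"
    let ?S = "\<lambda>x. \<Sum>b\<in>B. sphere_ip P b * b x"
    define g where "g = (\<lambda>x. P x - ?S x)"
    have S: "?S \<in> ?V" using fB(2) by (intro subspace_sum_mult V) auto
    have g: "g \<in> ?V"
      using cfs.subspace_diff[OF V P S] by (simp add: g_def fun_diff_def)
    have gb: "sphere_ip g b = 0" if b: "b \<in> B" for b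
    proof -
      have "sphere_ip g b = sphere_ip P b - sphere_ip ?S b"
        unfolding g_def sphere_ip_def left_diff_distrib
        by (intro Bochner_Integration.integral_diff continuous_on_sphere_integrable continuous_intros
            cont P S contB b)
      then show ?thesis by (simp only: sphere_ip_orthonormal_sum[OF fB(1,3) contB b] cancel_comm_monoid_add_class.diff_cancel)
    qed
    \<comment> \<open>Vanishing norm means g = 0 everywhere: on the sphere by continuity, off it by
      the extension by 0.\<close>
    have "sphere_L2_norm g \<noteq> 0"
    proof
      assume "sphere_L2_norm g = 0"
      then have "(LINT x|normalized_surface_measure. (cmod (g x))\<^sup>2) = 0"
        by (metis sphere_L2_norm_square power_zero_numeral)
      then have "g x = 0" if "norm x = 1" for x
        using continuous_on_sphere_integral_square_0[OF cont[OF g] _ that] by blast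
      then have "g x = 0" for x
        using spherical_harmonics_upto_continuous(2)[OF g, of x] by blast
      with neq show False by (simp add: g_def fun_eq_iff)
    qed
    define s where "s = complex_of_real (1 / sphere_L2_norm g)"
    define e where "e = (\<lambda>x. s * g x)"
    have e: "e \<in> ?V" using cfs.subspace_scale[OF V g, of s] by (simp add: e_def cfun_scale_def)
    have "(\<lambda>x. e x * cnj (e x)) = (\<lambda>x. (s * cnj s) * (g x * cnj (g x)))"
      by (simp add: e_def mult_ac)
    then have "sphere_ip e e = s * cnj s * sphere_ip g g"
      by (simp only: sphere_ip_def integral_mult_right_zero)
    then have ee: "sphere_ip e e = 1"
      using \<open>sphere_L2_norm g \<noteq> 0\<close>
      by (simp add: s_def sphere_ip_self power2_eq_square flip: of_real_mult)
    have eb: "sphere_ip e b = 0" if "b \<in> B" for b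
    proof -
      have "sphere_ip e b = s * sphere_ip g b"
        unfolding e_def sphere_ip_def by (simp add: mult.assoc)
      then show ?thesis by (simp add: gb that)
    qed
    have be: "sphere_ip b e = 0" if "b \<in> B" for b
      using eb[OF that] cnj_sphere_ip[of e b] by simp
    have "e \<notin> B" using eb ee by force
    moreover have "Q (insert e B)"
      unfolding Q_def using fB e ee eb be \<open>e \<notin> B\<close> by (auto simp: sphere_orthonormal_def)
    ultimately show False using max[of "insert e B"] fB(1) by simp
  qed
  have "?V \<subseteq> cfs.span B"
  proof
    fix P assume P: "P \<in> ?V"
    have "(\<lambda>x. \<Sum>b\<in>B. sphere_ip P b * b x) \<in> cfs.span B"
      by (intro subspace_sum_mult cfs.subspace_span cfs.span_base)
    then show "P \<in> cfs.span B" using expand[OF P] by simp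
  qed
  then have "card B = complex_dim ?V"
    using cfs.dim_unique[OF fB(2) _ indep[OF B] refl] by simp
  with fB expand show thesis by (intro that) auto
qed

text \<open>K x, the sum of the |b x|^2, is the squared norm of the reproducing function of x. The
  reproducing function of T x, composed with T, stays in the space, keeps its norm sqrt (K (T x)),
  and has the value K (T x) at x; Cauchy-Schwarz bounds that value by sqrt (K (T x) K x).\<close>

lemma orthonormal_basis_rotation_le:
  fixes B :: "(real ^ 'n \<Rightarrow> complex) set"
  assumes B: "finite B" "B \<subseteq> spherical_harmonics_upto n" "sphere_orthonormal B"
    and expand: "\<And>P. P \<in> spherical_harmonics_upto n \<Longrightarrow> P = (\<lambda>x. \<Sum>b\<in>B. sphere_ip P b * b x)"
    and T: "orthogonal_transformation T"
  shows "(\<Sum>b\<in>B. (cmod (b (T x)))\<^sup>2) \<le> (\<Sum>b\<in>B. (cmod (b x))\<^sup>2)"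
proof -
  let ?K = "\<lambda>x. \<Sum>b\<in>B. (cmod (b x))\<^sup>2"
  have cont: "continuous_on (sphere 0 1) b" if "b \<in> B" for b
    using spherical_harmonics_upto_continuous(1) B(2) that by blast
  \<comment> \<open>the reproducing function of the point \<open>T x\<close>\<close>
  define P where "P = (\<lambda>y. \<Sum>b\<in>B. cnj (b (T x)) * b y)"
  have P: "P \<in> spherical_harmonics_upto n"
    unfolding P_def using B(2) by (intro subspace_sum_mult subspace_spherical_harmonics_upto) auto
  have PT: "(\<lambda>y. P (T y)) \<in> spherical_harmonics_upto n"
    by (rule spherical_harmonics_upto_compose_orthogonal[OF T P])
  define u where "u b = sphere_ip (\<lambda>y. P (T y)) b" for b
  have PTu: "(\<lambda>y. P (T y)) = (\<lambda>y. \<Sum>b\<in>B. u b * b y)"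
    unfolding u_def by (rule expand[OF PT])
  have "(\<Sum>b\<in>B. (cmod (u b))\<^sup>2) = (sphere_L2_norm (\<lambda>y. P (T y)))\<^sup>2"
    unfolding PTu by (rule sphere_L2_norm_orthonormal_sum[OF B(1,3) cont, symmetric])
  also have "\<dots> = (LINT y|normalized_surface_measure. (cmod (P (T y)))\<^sup>2)"
    by (rule sphere_L2_norm_square)
  also have "\<dots> = (LINT y|normalized_surface_measure. (cmod (P y))\<^sup>2)"
    by (rule integral_sphere_orthogonal[OF T])
      (intro continuous_on_sphere_measurable continuous_intros spherical_harmonics_upto_continuous(1)[OF P])
  also have "\<dots> = (sphere_L2_norm P)\<^sup>2" by (rule sphere_L2_norm_square[symmetric])
  also have "\<dots> = (\<Sum>b\<in>B. (cmod (cnj (b (T x))))\<^sup>2)"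
    unfolding P_def by (rule sphere_L2_norm_orthonormal_sum[OF B(1,3) cont])
  finally have u2: "(\<Sum>b\<in>B. (cmod (u b))\<^sup>2) = ?K (T x)" by simp
  have "P (T x) = of_real (?K (T x))"
    unfolding P_def of_real_sum by (intro sum.cong refl) (simp only: complex_norm_square mult.commute)
  moreover have "P (T x) = ip B u (\<lambda>b. cnj (b x))"
    using fun_cong[OF PTu, of x] by (simp add: ip_def)
  ultimately have "cmod (ip B u (\<lambda>b. cnj (b x))) = ?K (T x)"
    by (simp add: sum_nonneg del: of_real_sum)
  with cmod_ip_le[of B u "\<lambda>b. cnj (b x)"] u2
  have le: "?K (T x) * ?K (T x) \<le> ?K (T x) * ?K x" by (simp add: power2_eq_square)
  show ?thesis
  proof (cases "?K (T x) = 0")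
    case True
    then show ?thesis by (simp add: sum_nonneg)
  next
    case False
    then have "0 < ?K (T x)" by (simp add: sum_nonneg order_less_le)
    with le show ?thesis using mult_le_cancel_left_pos by blast
  qed
qed

text \<open>Rotations act transitively on the sphere, so the inequality in both directions makes the
  sum constant. Its mean is the sum of the squared norms of the b, each 1.\<close>

lemma orthonormal_basis_square_sum:
  fixes B :: "(real ^ 'n \<Rightarrow> complex) set"
  assumes B: "finite B" "B \<subseteq> spherical_harmonics_upto n" "sphere_orthonormal B"
    and expand: "\<And>P. P \<in> spherical_harmonics_upto n \<Longrightarrow> P = (\<lambda>x. \<Sum>b\<in>B. sphere_ip P b * b x)"
    and x: "norm x = 1"
  shows "(\<Sum>b\<in>B. (cmod (b x))\<^sup>2) = real (card B)"
proof -
  interpret prob_space "normalized_surface_measure :: (real ^ 'n) measure"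
    by (rule prob_space_normalized_surface_measure)
  let ?K = "\<lambda>x. \<Sum>b\<in>B. (cmod (b x))\<^sup>2"
  have cont: "continuous_on (sphere 0 1) b" if "b \<in> B" for b
    using spherical_harmonics_upto_continuous(1) B(2) that by blast
  have le: "?K y \<le> ?K z" if yz: "norm y = 1" "norm z = 1" for y z :: "real ^ 'n"
  proof -
    obtain T where "orthogonal_transformation T" "T z = y"
      by (rule orthogonal_transformation_exists[of z y]) (use yz in auto)
    then show ?thesis using orthonormal_basis_rotation_le[OF B expand, of T z] by simp
  qed
  have "?K y = ?K x" if "norm y = 1" for y using le[OF that x] le[OF x that] by simp
  then have "(LINT y|normalized_surface_measure. ?K y) = (LINT y|(normalized_surface_measure :: (real ^ 'n) measure). ?K x)"
    by (intro Bochner_Integration.integral_cong) auto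
  also have "\<dots> = ?K x" using prob_space by simp
  finally have "?K x = (LINT y|normalized_surface_measure. ?K y)" ..
  also have "\<dots> = (\<Sum>b\<in>B. (sphere_L2_norm b)\<^sup>2)"
    unfolding sphere_L2_norm_square
    by (intro Bochner_Integration.integral_sum continuous_on_sphere_integrable continuous_intros cont)
  also have "\<dots> = (\<Sum>b\<in>B. 1)"
  proof (rule sum.cong)
    fix b assume b: "b \<in> B"
    have "complex_of_real ((sphere_L2_norm b)\<^sup>2) = 1"
      unfolding sphere_ip_self[symmetric] using B(3) b by (simp add: sphere_orthonormal_def)
    then show "(sphere_L2_norm b)\<^sup>2 = 1" by (simp only: of_real_eq_1_iff)
  qed simp
  finally show ?thesis by simp
qed

section \<open>Matrix Chernoff bound for isotropic vectors\<close>

text \<open>Source of the constant 3: the derivative of the difference is ln (1 + y) - 2 y / 3, and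
  on [0, 1] concavity of ln gives ln (1 + y) \<ge> y ln 2 with ln 2 \<ge> 2 / 3.\<close>

lemma ln_chernoff_upper:
  fixes x :: real
  assumes "0 < x" "x < 1"
  shows "x - (1 + x) * ln (1 + x) \<le> - (x\<^sup>2 / 3)"
proof -
  let ?f = "\<lambda>x :: real. (1 + x) * ln (1 + x) - x - x\<^sup>2 / 3"
  have "?f 0 \<le> ?f x"
  proof (rule DERIV_nonneg_imp_nondecreasing[of 0 x ?f])
    fix y assume y: "0 \<le> y" "y \<le> x"
    \<comment> \<open>The chord of exp over [0, ln 2], that is 2^y \<le> 1 + y; this is the
      concavity of ln in exponential form.\<close>
    have "exp (y * ln 2) \<le> (1 - y) * exp 0 + y * exp (ln 2)"
      using convex_onD[OF exp_convex, of y 0 "ln 2"] y assms by simp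
    then have "exp (y * ln 2) \<le> 1 + y" by simp
    then have "y * ln 2 \<le> ln (1 + y)" using y by (simp add: ln_ge_iff)
    moreover have "y * (2 / 3) \<le> y * ln 2" using y ln2_ge_two_thirds by (intro mult_left_mono) auto
    ultimately have "0 \<le> ln (1 + y) - y * (2 / 3)" by simp
    moreover have "(?f has_real_derivative ln (1 + y) - y * (2 / 3)) (at y)"
      using y by (auto intro!: derivative_eq_intros)
    ultimately show "\<exists>d. (?f has_real_derivative d) (at y) \<and> 0 \<le> d" by blast
  qed (use assms in auto)
  then show ?thesis by simp
qed

text \<open>Brings the lower tail to the exponent of the upper one: the derivative of the difference
  is - ln (1 - y) - 2 y / 3, and - ln (1 - y) \<ge> y.\<close>

lemma ln_chernoff_lower:
  fixes x :: real
  assumes "0 < x" "x < 1"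
  shows "- x - (1 - x) * ln (1 - x) \<le> - (x\<^sup>2 / 3)"
proof -
  let ?f = "\<lambda>x :: real. (1 - x) * ln (1 - x) + x - x\<^sup>2 / 3"
  have "?f 0 \<le> ?f x"
  proof (rule DERIV_nonneg_imp_nondecreasing[of 0 x ?f])
    fix y assume y: "0 \<le> y" "y \<le> x"
    have "ln (1 - y) \<le> - y" using ln_le_minus_one[of "1 - y"] y assms by simp
    then have "0 \<le> - ln (1 - y) - y * (2 / 3)" using y by simp
    moreover have "(?f has_real_derivative - ln (1 - y) - y * (2 / 3)) (at y)"
      using y assms by (auto intro!: derivative_eq_intros)
    ultimately show "\<exists>d. (?f has_real_derivative d) (at y) \<and> 0 \<le> d" by blast
  qed (use assms in auto)
  then show ?thesis by simp
qed

text \<open>Displays the moment as a linear combination of the products v_i cnj v_j, whose means are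
  prescribed for isotropic vectors.\<close>

lemma qf_expand:
  assumes fin: "finite I" and A: "psd_op I A"
  shows "qf I A m v =
    Re (\<Sum>i\<in>I. \<Sum>j\<in>I. (v i * cnj (v j)) * (A ^^ m) (unit_vec i) j)"
proof -
  have sym: "cnj ((A ^^ m) (unit_vec j) i) = (A ^^ m) (unit_vec i) j" if "i \<in> I" "j \<in> I" for i j
    using that funpow_linear(3)[OF A, of m "unit_vec i" "unit_vec j"]
    by (simp add: ip_unit_right[OF fin] ip_unit_left[OF fin])
  have comp: "(A ^^ m) v j = (\<Sum>i\<in>I. v i * (A ^^ m) (unit_vec i) j)" if j: "j \<in> I" for j
  proof -
    have "(A ^^ m) v j = ip I ((A ^^ m) v) (unit_vec j)" by (rule ip_unit_right[OF fin j, symmetric])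
    also have "\<dots> = ip I v ((A ^^ m) (unit_vec j))" by (rule funpow_linear(3)[OF A])
    also have "\<dots> = (\<Sum>i\<in>I. v i * (A ^^ m) (unit_vec i) j)"
      unfolding ip_def by (intro sum.cong refl) (simp only: sym[OF _ j])
    finally show ?thesis .
  qed
  have "ip I ((A ^^ m) v) v = (\<Sum>j\<in>I. \<Sum>i\<in>I. (v i * cnj (v j)) * (A ^^ m) (unit_vec i) j)"
    unfolding ip_def by (intro sum.cong refl) (simp add: comp sum_distrib_left mult_ac)
  also have "\<dots> = (\<Sum>i\<in>I. \<Sum>j\<in>I. (v i * cnj (v j)) * (A ^^ m) (unit_vec i) j)"
    by (rule sum.swap)
  finally show ?thesis unfolding qf_def by (rule arg_cong)
qed

section \<open>Measurability of the trace exponential\<close>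

lemma sum_op_apply:
  "sum_op I c s J w x i = of_real c * x i + (\<Sum>j\<in>J. of_real s * ip I x (w j) * w j i)"
  by (simp add: sum_op_def)

lemma cnj_borel_measurable: "cnj \<in> borel_measurable borel"
  by (intro borel_measurable_continuous_onI continuous_on_cnj continuous_on_id)

lemma measurable_sum_op_funpow:
  assumes "\<And>j i. j \<in> J \<Longrightarrow> i \<in> I \<Longrightarrow> (\<lambda>x. u x j i) \<in> borel_measurable N" "i \<in> I"
  shows "(\<lambda>x. (sum_op I c s J (u x) ^^ m) y i) \<in> borel_measurable N"
  using assms(2)
proof (induction m arbitrary: i)
  case (Suc m)
  have "(\<lambda>x. ip I ((sum_op I c s J (u x) ^^ m) y) (u x j)) \<in> borel_measurable N" if "j \<in> J" for j
    unfolding ip_def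
    by (intro borel_measurable_sum borel_measurable_times Suc.IH
        measurable_compose[OF _ cnj_borel_measurable] assms(1) that)
  then have "(\<lambda>x. of_real c * (sum_op I c s J (u x) ^^ m) y i +
      (\<Sum>j\<in>J. of_real s * ip I ((sum_op I c s J (u x) ^^ m) y) (u x j) * u x j i)) \<in> borel_measurable N"
    using Suc.prems
    by (intro borel_measurable_sum borel_measurable_times borel_measurable_add Suc.IH
        assms(1) borel_measurable_const)
  moreover have "(sum_op I c s J (u x) ^^ Suc m) y i = of_real c * (sum_op I c s J (u x) ^^ m) y i +
      (\<Sum>j\<in>J. of_real s * ip I ((sum_op I c s J (u x) ^^ m) y) (u x j) * u x j i)" for x
    unfolding funpow.simps(2) o_apply by (rule sum_op_apply)
  ultimately show ?case by (simp only:)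
qed simp

lemma measurable_trace_exp_sum_op:
  assumes fin: "finite I"
    and "\<And>j i. j \<in> J \<Longrightarrow> i \<in> I \<Longrightarrow> (\<lambda>x. u x j i) \<in> borel_measurable N"
  shows "(\<lambda>x. trace_exp I (sum_op I c s J (u x))) \<in> borel_measurable N"
proof -
  have "trace_pow I A m = (\<Sum>i\<in>I. Re ((A ^^ m) (unit_vec i) i))" for A :: "('a \<Rightarrow> complex) \<Rightarrow> ('a \<Rightarrow> complex)" and m
    unfolding trace_pow_def qf_def by (intro sum.cong refl) (simp add: ip_unit_right[OF fin])
  then show ?thesis
    unfolding trace_exp_def
    by (simp only:) (intro borel_measurable_suminf borel_measurable_divide borel_measurable_sum
        measurable_compose[OF _ borel_measurable_Re] measurable_sum_op_funpow assms borel_measurable_const)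
qed

text \<open>The mean of w w^H is the identity, and the squared norm is d at every point, not merely
  on average: the factor exp (t |w|^2) of the one-step bound has to be the same for all
  samples.\<close>

locale isotropic_vectors = prob_space M for M :: "'a measure" +
  fixes I :: "'i set" and w :: "'a \<Rightarrow> 'i \<Rightarrow> complex"
  assumes fin: "finite I" and ne: "I \<noteq> {}"
    and meas: "\<And>i. i \<in> I \<Longrightarrow> (\<lambda>x. w x i) \<in> borel_measurable M"
    and nrm: "\<And>x. x \<in> space M \<Longrightarrow> (\<Sum>i\<in>I. (cmod (w x i))\<^sup>2) = real (card I)"
    and iso: "\<And>i j. i \<in> I \<Longrightarrow> j \<in> I \<Longrightarrow>
      (LINT x|M. w x i * cnj (w x j)) = (if i = j then 1 else 0)"
begin

abbreviation d :: real where "d \<equiv> real (card I)"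

lemma d_pos: "0 < d"
  using fin ne by (simp add: card_gt_0_iff)

lemma integrable_w: "i \<in> I \<Longrightarrow> j \<in> I \<Longrightarrow> integrable M (\<lambda>x. w x i * cnj (w x j))"
proof (rule integrable_const_bound[of _ d])
  assume ij: "i \<in> I" "j \<in> I"
  show "(\<lambda>x. w x i * cnj (w x j)) \<in> borel_measurable M"
    by (intro borel_measurable_times measurable_compose[OF _ cnj_borel_measurable] meas ij)
  show "AE x in M. norm (w x i * cnj (w x j)) \<le> d"
  proof (rule AE_I2)
    fix x assume x: "x \<in> space M"
    have "cmod (w x k) \<le> sqrt d" if "k \<in> I" for k
      using member_le_sum[of k I "\<lambda>i. (cmod (w x i))\<^sup>2"] that fin nrm[OF x]
      by (intro real_le_rsqrt) auto
    then have "cmod (w x i) * cmod (w x j) \<le> sqrt d * sqrt d"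
      using ij by (intro mult_mono) auto
    then show "norm (w x i * cnj (w x j)) \<le> d" by (simp add: norm_mult)
  qed
qed

text \<open>Isotropy turns <A^m w, w> = tr (A^m w w^H) into tr A^m on average.\<close>

lemma integral_qf:
  assumes A: "psd_op I A"
  shows "integrable M (\<lambda>x. qf I A m (w x))" "(LINT x|M. qf I A m (w x)) = trace_pow I A m"
proof -
  let ?f = "\<lambda>x. \<Sum>i\<in>I. \<Sum>j\<in>I. (w x i * cnj (w x j)) * (A ^^ m) (unit_vec i) j"
  have int: "integrable M ?f"
    by (intro Bochner_Integration.integrable_sum integrable_mult_left integrable_w)
  then show "integrable M (\<lambda>x. qf I A m (w x))"
    unfolding qf_expand[OF fin A] by (rule integrable_Re)
  have "(LINT x|M. ?f x) = (\<Sum>i\<in>I. \<Sum>j\<in>I. (LINT x|M. w x i * cnj (w x j)) * (A ^^ m) (unit_vec i) j)"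
    by (simp add: Bochner_Integration.integral_sum integrable_w Bochner_Integration.integrable_sum)
  also have "\<dots> = (\<Sum>i\<in>I. \<Sum>j\<in>I. if i = j then (A ^^ m) (unit_vec i) i else 0)"
    by (intro sum.cong refl) (simp add: iso)
  also have "\<dots> = (\<Sum>i\<in>I. (A ^^ m) (unit_vec i) i)"
    using fin by (intro sum.cong refl) (simp add: sum.delta)
  finally have "Re (LINT x|M. ?f x) = trace_pow I A m"
    unfolding trace_pow_def qf_def by (simp add: ip_unit_right[OF fin])
  then show "(LINT x|M. qf I A m (w x)) = trace_pow I A m"
    unfolding qf_expand[OF fin A] by (simp only: integral_Re[OF int])
qed

text \<open>Nonnegative terms allow series and integral to be exchanged without a dominating
  function.\<close>

lemma nn_integral_qf_exp:
  assumes A: "psd_op I A"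
  shows "(\<lambda>x. qf_exp I A (w x)) \<in> borel_measurable M"
    "(\<integral>\<^sup>+x. ennreal (qf_exp I A (w x)) \<partial>M) = ennreal (trace_exp I A)"
proof -
  have m: "(\<lambda>x. qf I A m (w x)) \<in> borel_measurable M" for m
    using integral_qf(1)[OF A] by (rule borel_measurable_integrable)
  then show "(\<lambda>x. qf_exp I A (w x)) \<in> borel_measurable M"
    unfolding qf_exp_def by (intro borel_measurable_suminf borel_measurable_divide borel_measurable_const)
  have "(\<integral>\<^sup>+x. ennreal (qf_exp I A (w x)) \<partial>M) = (\<integral>\<^sup>+x. (\<Sum>m. ennreal (qf I A m (w x) / fact m)) \<partial>M)"
    unfolding qf_exp_def
    by (intro nn_integral_cong suminf_ennreal2[symmetric] summable_qf fin A) (simp add: qf_nonneg[OF A])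
  also have "\<dots> = (\<Sum>m. \<integral>\<^sup>+x. ennreal (qf I A m (w x) / fact m) \<partial>M)"
    using m by (intro nn_integral_suminf) simp
  also have "\<dots> = (\<Sum>m. ennreal (trace_pow I A m / fact m))"
  proof (intro suminf_cong)
    fix m
    have "(\<integral>\<^sup>+x. ennreal (qf I A m (w x) / fact m) \<partial>M) = ennreal (LINT x|M. qf I A m (w x) / fact m)"
      by (intro nn_integral_eq_integral integrable_divide integral_qf A) (simp add: qf_nonneg[OF A])
    then show "(\<integral>\<^sup>+x. ennreal (qf I A m (w x) / fact m) \<partial>M) = ennreal (trace_pow I A m / fact m)"
      by (simp add: integral_qf[OF A])
  qed
  also have "\<dots> = ennreal (trace_exp I A)"
    unfolding trace_exp_def
    by (intro suminf_ennreal2 summable_trace_pow fin A) (simp add: trace_pow_nonneg[OF A])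
  finally show "(\<integral>\<^sup>+x. ennreal (qf_exp I A (w x)) \<partial>M) = ennreal (trace_exp I A)" .
qed

lemma nn_integral_update_pos:
  assumes A: "psd_op I A" and t: "0 \<le> t"
  shows "(\<integral>\<^sup>+x. ennreal (trace_exp I (rank_one_update I A t (w x))) \<partial>M) \<le>
    ennreal (1 + (exp (t * d) - 1) / d) * ennreal (trace_exp I A)"
proof -
  define \<kappa> where "\<kappa> = (exp (t * d) - 1) / d"
  have \<kappa>: "0 \<le> \<kappa>" using t d_pos by (simp add: \<kappa>_def)
  have "(\<integral>\<^sup>+x. ennreal (trace_exp I (rank_one_update I A t (w x))) \<partial>M) \<le>
      (\<integral>\<^sup>+x. ennreal (trace_exp I A) + ennreal \<kappa> * ennreal (qf_exp I A (w x)) \<partial>M)"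
  proof (rule nn_integral_mono)
    fix x assume "x \<in> space M"
    then have "trace_exp I (rank_one_update I A t (w x)) \<le> trace_exp I A + \<kappa> * qf_exp I A (w x)"
      unfolding \<kappa>_def using d_pos by (intro trace_exp_update(1)[OF fin A t]) (simp_all add: nrm)
    then show "ennreal (trace_exp I (rank_one_update I A t (w x))) \<le>
        ennreal (trace_exp I A) + ennreal \<kappa> * ennreal (qf_exp I A (w x))"
      using \<kappa> trace_exp_nonneg[OF fin A] qf_exp_nonneg[OF fin A]
      by (simp add: ennreal_leI flip: ennreal_mult ennreal_plus)
  qed
  also have "\<dots> = ennreal (trace_exp I A) + ennreal \<kappa> * ennreal (trace_exp I A)"
    using nn_integral_qf_exp[OF A]
    by (simp add: nn_integral_add nn_integral_cmult emeasure_space_1)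
  also have "\<dots> = ennreal (1 + \<kappa>) * ennreal (trace_exp I A)"
    using \<kappa> by (simp add: distrib_right)
  finally show ?thesis by (simp add: \<kappa>_def)
qed

text \<open>The one-step bound runs upward from A - t w w^H to A and measures its gain at A, the
  operator that does not depend on the sample. It applies when the lower operator is still positive
  semidefinite.\<close>

lemma nn_integral_update_neg:
  assumes A: "psd_op I A" and t: "0 \<le> t"
    and psd: "\<And>x. x \<in> space M \<Longrightarrow> psd_op I (rank_one_update I A (- t) (w x))"
  shows "(\<integral>\<^sup>+x. ennreal (trace_exp I (rank_one_update I A (- t) (w x))) \<partial>M) \<le>
    ennreal (1 - (1 - exp (- (t * d))) / d) * ennreal (trace_exp I A)"
proof -
  define \<kappa> where "\<kappa> = (1 - exp (- (t * d))) / d"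
  have \<kappa>: "0 \<le> \<kappa>" using t d_pos by (simp add: \<kappa>_def)
  have le: "trace_exp I (rank_one_update I A (- t) (w x)) + \<kappa> * qf_exp I A (w x) \<le> trace_exp I A"
    if x: "x \<in> space M" for x
    using trace_exp_update(2)[OF fin psd[OF x] t nrm[OF x, symmetric] d_pos]
    by (simp add: rank_one_update_add \<kappa>_def)
  have "(\<integral>\<^sup>+x. ennreal (trace_exp I (rank_one_update I A (- t) (w x))) \<partial>M) \<le>
      (\<integral>\<^sup>+x. ennreal (trace_exp I A) - ennreal \<kappa> * ennreal (qf_exp I A (w x)) \<partial>M)"
  proof (rule nn_integral_mono)
    fix x assume x: "x \<in> space M"
    then show "ennreal (trace_exp I (rank_one_update I A (- t) (w x))) \<le>
        ennreal (trace_exp I A) - ennreal \<kappa> * ennreal (qf_exp I A (w x))"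
      using \<kappa> qf_exp_nonneg[OF fin A] le[OF x]
      by (simp add: ennreal_leI ennreal_minus flip: ennreal_mult)
  qed
  also have "\<dots> = (\<integral>\<^sup>+x. ennreal (trace_exp I A) \<partial>M) -
      (\<integral>\<^sup>+x. ennreal \<kappa> * ennreal (qf_exp I A (w x)) \<partial>M)"
  proof (rule nn_integral_diff)
    show "(\<lambda>x. ennreal \<kappa> * ennreal (qf_exp I A (w x))) \<in> borel_measurable M"
      using nn_integral_qf_exp(1)[OF A] by simp
    show "(\<integral>\<^sup>+x. ennreal \<kappa> * ennreal (qf_exp I A (w x)) \<partial>M) \<noteq> \<infinity>"
      using nn_integral_qf_exp[OF A] by (simp add: nn_integral_cmult ennreal_mult_eq_top_iff)
    \<comment> \<open>Subtraction of extended nonnegative reals truncates at 0; positivity of the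
      smaller trace keeps the difference exact.\<close>
    show "AE x in M. ennreal \<kappa> * ennreal (qf_exp I A (w x)) \<le> ennreal (trace_exp I A)"
    proof (rule AE_I2)
      fix x assume x: "x \<in> space M"
      have "0 \<le> trace_exp I (rank_one_update I A (- t) (w x))"
        by (rule trace_exp_nonneg[OF fin psd[OF x]])
      with le[OF x] have "\<kappa> * qf_exp I A (w x) \<le> trace_exp I A" by linarith
      then show "ennreal \<kappa> * ennreal (qf_exp I A (w x)) \<le> ennreal (trace_exp I A)"
        using \<kappa> qf_exp_nonneg[OF fin A] by (simp add: ennreal_leI flip: ennreal_mult)
    qed
  qed simp
  also have "\<dots> = ennreal (trace_exp I A) - ennreal \<kappa> * ennreal (trace_exp I A)"
    using nn_integral_qf_exp[OF A] by (simp add: nn_integral_cmult emeasure_space_1)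
  also have "\<dots> = ennreal ((1 - \<kappa>) * trace_exp I A)"
    using \<kappa> trace_exp_nonneg[OF fin A]
    by (simp add: ennreal_minus left_diff_distrib flip: ennreal_mult)
  also have "\<dots> \<le> ennreal (1 - \<kappa>) * ennreal (trace_exp I A)"
    using trace_exp_nonneg[OF fin A] by (simp add: ennreal_mult'')
  finally show ?thesis by (simp add: \<kappa>_def)
qed

section \<open>Independent samples and the two tails\<close>

lemma measurable_trace_exp_PiM:
  "(\<lambda>\<xi>. trace_exp I (sum_op I c s J (\<lambda>k. w (\<xi> k)))) \<in> borel_measurable (\<Pi>\<^sub>M j\<in>J. M)"
proof (rule measurable_trace_exp_sum_op[OF fin])
  fix j i assume "j \<in> J" "i \<in> I"
  then show "(\<lambda>\<xi>. w (\<xi> j) i) \<in> borel_measurable (\<Pi>\<^sub>M j\<in>J. M)"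
    by (intro measurable_compose[where f = "\<lambda>\<xi>. \<xi> j" and g = "\<lambda>x. w x i", OF _ meas]
        measurable_component_singleton)
qed

text \<open>The samples are integrated out one coordinate at a time. The step is demanded only
  inside J, because downward steps keep positivity only for as many samples as the starting multiple
  of the identity can pay for. The empty sample contributes tr exp (c I) = d exp c.\<close>

lemma nn_integral_PiM_trace_exp:
  assumes "finite J"
    and step: "\<And>j K \<xi>. insert j K \<subseteq> J \<Longrightarrow> j \<notin> K \<Longrightarrow> \<xi> \<in> space (\<Pi>\<^sub>M j\<in>K. M) \<Longrightarrow>
      (\<integral>\<^sup>+y. ennreal (trace_exp I (rank_one_update I (sum_op I c s K (\<lambda>k. w (\<xi> k))) s (w y))) \<partial>M)
        \<le> ennreal \<rho> * ennreal (trace_exp I (sum_op I c s K (\<lambda>k. w (\<xi> k))))"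
  shows "(\<integral>\<^sup>+\<xi>. ennreal (trace_exp I (sum_op I c s J (\<lambda>k. w (\<xi> k)))) \<partial>(\<Pi>\<^sub>M j\<in>J. M)) \<le>
    ennreal \<rho> ^ card J * ennreal (d * exp c)"
  using assms
proof (induction J rule: finite_induct)
  case empty
  interpret P: prob_space "\<Pi>\<^sub>M j\<in>{}. M" by (rule prob_space_PiM) (rule prob_space_axioms)
  show ?case by (simp add: P.emeasure_space_1 sum_op_empty trace_exp_scale[OF fin])
next
  case (insert j J)
  interpret product_sigma_finite "\<lambda>_. M" by standard
  let ?\<Phi> = "\<lambda>J \<xi>. ennreal (trace_exp I (sum_op I c s J (\<lambda>k. w (\<xi> k))))"
  have meas: "?\<Phi> J \<in> borel_measurable (\<Pi>\<^sub>M j\<in>J. M)" for J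
    by (intro measurable_compose[OF _ measurable_ennreal] measurable_trace_exp_PiM)
  have "(\<integral>\<^sup>+\<xi>. ?\<Phi> (insert j J) \<xi> \<partial>(\<Pi>\<^sub>M j\<in>insert j J. M)) =
      (\<integral>\<^sup>+\<xi>. (\<integral>\<^sup>+y. ?\<Phi> (insert j J) (\<xi>(j := y)) \<partial>M) \<partial>(\<Pi>\<^sub>M j\<in>J. M))"
    by (rule product_nn_integral_insert[OF insert(1,2) meas])
  also have "\<dots> \<le> (\<integral>\<^sup>+\<xi>. ennreal \<rho> * ?\<Phi> J \<xi> \<partial>(\<Pi>\<^sub>M j\<in>J. M))"
    unfolding sum_op_insert[OF insert(1,2)]
    by (rule nn_integral_mono, rule insert.prems[of j J]) (use insert(2) in auto)
  also have "\<dots> = ennreal \<rho> * (\<integral>\<^sup>+\<xi>. ?\<Phi> J \<xi> \<partial>(\<Pi>\<^sub>M j\<in>J. M))"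
    by (intro nn_integral_cmult meas)
  also have "\<dots> \<le> ennreal \<rho> * (ennreal \<rho> ^ card J * ennreal (d * exp c))"
    by (rule mult_left_mono, rule insert.IH, rule insert.prems) auto
  finally show ?case using insert(1,2) by (simp add: mult.assoc)
qed

lemma trace_exp_tail:
  assumes "finite J" and \<rho>: "0 \<le> \<rho>"
    and bound: "(\<integral>\<^sup>+\<xi>. ennreal (trace_exp I (sum_op I c s J (\<lambda>k. w (\<xi> k)))) \<partial>(\<Pi>\<^sub>M j\<in>J. M)) \<le>
      ennreal \<rho> ^ card J * ennreal (d * exp c)"
  shows "{\<xi> \<in> space (\<Pi>\<^sub>M j\<in>J. M). exp a \<le> trace_exp I (sum_op I c s J (\<lambda>k. w (\<xi> k)))} \<in> sets (\<Pi>\<^sub>M j\<in>J. M)"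
      (is "?E \<in> _")
    and "measure (\<Pi>\<^sub>M j\<in>J. M)
      {\<xi> \<in> space (\<Pi>\<^sub>M j\<in>J. M). exp a \<le> trace_exp I (sum_op I c s J (\<lambda>k. w (\<xi> k)))} \<le>
      \<rho> ^ card J * (d * exp (c - a))"
proof -
  let ?P = "\<Pi>\<^sub>M j\<in>J. M" and ?\<Phi> = "\<lambda>\<xi>. trace_exp I (sum_op I c s J (\<lambda>k. w (\<xi> k)))"
  interpret P: prob_space ?P by (rule prob_space_PiM) (rule prob_space_axioms)
  note [measurable] = measurable_trace_exp_PiM[of c s J]
  show "?E \<in> sets ?P" by measurable
  have "emeasure ?P ?E \<le> emeasure ?P {\<xi> \<in> space ?P. 1 \<le> ennreal (exp (- a)) * ennreal (?\<Phi> \<xi>)}"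
  proof (rule emeasure_mono)
    show "?E \<subseteq> {\<xi> \<in> space ?P. 1 \<le> ennreal (exp (- a)) * ennreal (?\<Phi> \<xi>)}"
    proof safe
      fix \<xi> assume "exp a \<le> ?\<Phi> \<xi>"
      then have "exp (- a) * exp a \<le> exp (- a) * ?\<Phi> \<xi>" by (intro mult_left_mono) auto
      then have "1 \<le> exp (- a) * ?\<Phi> \<xi>" by (simp flip: exp_add)
      then show "1 \<le> ennreal (exp (- a)) * ennreal (?\<Phi> \<xi>)"
        by (simp add: ennreal_mult'[symmetric])
    qed
  qed measurable
  also have "\<dots> \<le> ennreal (exp (- a)) * (\<integral>\<^sup>+\<xi>. ennreal (?\<Phi> \<xi>) * indicator (space ?P) \<xi> \<partial>?P)"
    by (rule nn_integral_Markov_inequality) measurable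
  also have "(\<integral>\<^sup>+\<xi>. ennreal (?\<Phi> \<xi>) * indicator (space ?P) \<xi> \<partial>?P) = (\<integral>\<^sup>+\<xi>. ennreal (?\<Phi> \<xi>) \<partial>?P)"
    by (intro nn_integral_cong) simp
  also have "ennreal (exp (- a)) * \<dots> \<le> ennreal (exp (- a)) * (ennreal \<rho> ^ card J * ennreal (d * exp c))"
    by (intro mult_left_mono bound) simp
  also have "\<dots> = ennreal (\<rho> ^ card J * (d * exp (c - a)))"
    using \<rho> by (simp add: ennreal_power exp_diff exp_minus field_simps flip: ennreal_mult)
  finally have "emeasure ?P ?E \<le> ennreal (\<rho> ^ card J * (d * exp (c - a)))" .
  then show "measure ?P ?E \<le> \<rho> ^ card J * (d * exp (c - a))"
    using \<rho> by (simp add: P.emeasure_eq_measure)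
qed

text \<open>E collects the samples whose trace exponential is large for one of the two signs.
  Outside E no u can violate the bounds, since its Rayleigh quotient would push a trace over its
  threshold. Working with E postpones the measurability of a condition on uncountably many
  u.\<close>

lemma matrix_chernoff:
  fixes J :: "'j set"
  assumes J: "finite J" "J \<noteq> {}" and \<eta>: "0 < \<eta>" "\<eta> < 1"
  shows "\<exists>E \<in> sets (\<Pi>\<^sub>M j\<in>J. M).
    measure (\<Pi>\<^sub>M j\<in>J. M) E \<le> 2 * d * exp (- (real (card J) * \<eta>\<^sup>2 / (3 * d))) \<and>
    (\<forall>\<xi> \<in> space (\<Pi>\<^sub>M j\<in>J. M) - E. \<forall>u.
      (1 - \<eta>) * (real (card J) * (\<Sum>i\<in>I. (cmod (u i))\<^sup>2)) \<le> (\<Sum>j\<in>J. (cmod (ip I u (w (\<xi> j))))\<^sup>2) \<and>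
      (\<Sum>j\<in>J. (cmod (ip I u (w (\<xi> j))))\<^sup>2) \<le> (1 + \<eta>) * (real (card J) * (\<Sum>i\<in>I. (cmod (u i))\<^sup>2)))"
proof -
  let ?P = "\<Pi>\<^sub>M j\<in>J. M" and ?N = "real (card J)"
  interpret P: prob_space ?P by (rule prob_space_PiM) (rule prob_space_axioms)
  have N: "0 < ?N" using J by (simp add: card_gt_0_iff)
  define \<delta> where "\<delta> = exp (- (?N * \<eta>\<^sup>2 / (3 * d)))"
  have nn: "0 \<le> (\<Sum>i\<in>I. (cmod (u i))\<^sup>2)" for u :: "'i \<Rightarrow> complex" by (simp add: sum_nonneg)
  have mem: "\<xi> k \<in> space M" if "\<xi> \<in> space (\<Pi>\<^sub>M j\<in>K. M)" "k \<in> K" for \<xi> k K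
    using that by (auto simp: space_PiM PiE_iff)

  \<comment> \<open>Minimises (exp (t d) - 1) / d - t (1 + \<eta>), the exponent per sample.\<close>
  define t where "t = ln (1 + \<eta>) / d"
  define a where "a = t * (1 + \<eta>) * ?N"
  define E1 where "E1 = {\<xi> \<in> space ?P. exp a \<le> trace_exp I (sum_op I 0 t J (\<lambda>k. w (\<xi> k)))}"
  have t: "0 \<le> t" "t * d = ln (1 + \<eta>)" using \<eta> d_pos by (simp_all add: t_def)
  have \<rho>1: "1 + (exp (t * d) - 1) / d = 1 + \<eta> / d" using \<eta> unfolding t(2) by simp
  have b1: "(\<integral>\<^sup>+\<xi>. ennreal (trace_exp I (sum_op I 0 t J (\<lambda>k. w (\<xi> k)))) \<partial>?P) \<le>
      ennreal (1 + \<eta> / d) ^ card J * ennreal (d * exp 0)"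
  proof (rule nn_integral_PiM_trace_exp[OF J(1)])
    fix K :: "'j set" and \<xi> :: "'j \<Rightarrow> 'a"
    show "(\<integral>\<^sup>+y. ennreal (trace_exp I (rank_one_update I (sum_op I 0 t K (\<lambda>k. w (\<xi> k))) t (w y))) \<partial>M)
        \<le> ennreal (1 + \<eta> / d) * ennreal (trace_exp I (sum_op I 0 t K (\<lambda>k. w (\<xi> k))))"
      using nn_integral_update_pos[OF psd_op_sum_op_nonneg t(1), of 0] t(1) unfolding \<rho>1 by simp
  qed
  have E1: "E1 \<in> sets ?P" "measure ?P E1 \<le> (1 + \<eta> / d) ^ card J * (d * exp (0 - a))"
    unfolding E1_def using \<eta> d_pos by (intro trace_exp_tail[OF J(1) _ b1]; simp)+
  have "measure ?P E1 \<le> d * \<delta>"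
  proof -
    have "(1 + \<eta> / d) ^ card J \<le> exp (\<eta> / d) ^ card J"
      using \<eta> d_pos by (intro power_mono exp_ge_add_one_self) (simp add: add_nonneg_nonneg)
    also have "\<dots> = exp (?N * (\<eta> / d))" by (rule exp_of_nat_mult[symmetric])
    finally have "(1 + \<eta> / d) ^ card J * (d * exp (0 - a)) \<le> exp (?N * (\<eta> / d)) * (d * exp (0 - a))"
      using d_pos by (intro mult_right_mono) auto
    also have "\<dots> = d * exp (?N * (\<eta> / d) + (0 - a))" by (simp only: exp_add mult.left_commute)
    also have "?N * (\<eta> / d) + (0 - a) = ?N / d * (\<eta> - (1 + \<eta>) * ln (1 + \<eta>))"
      by (simp add: a_def t_def add_divide_distrib diff_divide_distrib algebra_simps)
    also have "d * exp (?N / d * (\<eta> - (1 + \<eta>) * ln (1 + \<eta>))) \<le> d * exp (?N / d * (- (\<eta>\<^sup>2 / 3)))"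
      using d_pos N ln_chernoff_upper[OF \<eta>]
      by (intro mult_left_mono iffD2[OF exp_le_cancel_iff]) auto
    also have "\<dots> = d * \<delta>" by (simp add: \<delta>_def field_simps)
    finally show ?thesis using E1(2) by simp
  qed

  \<comment> \<open>Minimises - (1 - exp (- t d)) / d + t (1 - \<eta>), the exponent per sample of
    the lower tail.\<close>
  define t' where "t' = - ln (1 - \<eta>) / d"
  \<comment> \<open>Each of the N subtractions lowers the operator by at most t' d, so this start
    keeps it positive semidefinite.\<close>
  define c where "c = t' * ?N * d"
  \<comment> \<open>The threshold is shifted by the same c, so that only c - a' = t' (1 - \<eta>) N
    enters the tail bound.\<close>
  define a' where "a' = c - t' * (1 - \<eta>) * ?N"
  define E2 where "E2 = {\<xi> \<in> space ?P. exp a' \<le> trace_exp I (sum_op I c (- t') J (\<lambda>k. w (\<xi> k)))}"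
  have t': "0 \<le> t'" "t' * d = - ln (1 - \<eta>)"
    using \<eta> d_pos by (simp_all add: t'_def divide_nonpos_pos)
  have \<rho>2: "1 - (1 - exp (- (t' * d))) / d = 1 - \<eta> / d" using \<eta> unfolding t'(2) by simp
  \<comment> \<open>d is a positive integer; hence 1 - \<eta> / d \<ge> 0, and powers of it are
    monotone.\<close>
  have "1 \<le> d" using d_pos by simp
  then have "\<eta> / d \<le> 1" using \<eta> by simp
  have psd: "psd_op I (sum_op I c (- t') K (\<lambda>k. w (\<xi> k)))"
    if K: "K \<subseteq> J" and \<xi>: "\<xi> \<in> space (\<Pi>\<^sub>M j\<in>K. M)" for K \<xi>
  proof (rule psd_op_sum_op_neg[OF finite_subset[OF K J(1)] _ t'(1)])
    show "(\<Sum>i\<in>I. (cmod (w (\<xi> j) i))\<^sup>2) = d" if "j \<in> K" for j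
      by (rule nrm[OF mem[OF \<xi> that]])
    have "real (card K) \<le> ?N" using card_mono[OF J(1) K] by simp
    then show "t' * real (card K) * d \<le> c"
      unfolding c_def using t' d_pos by (intro mult_right_mono mult_left_mono) auto
  qed
  have b2: "(\<integral>\<^sup>+\<xi>. ennreal (trace_exp I (sum_op I c (- t') J (\<lambda>k. w (\<xi> k)))) \<partial>?P) \<le>
      ennreal (1 - \<eta> / d) ^ card J * ennreal (d * exp c)"
  proof (rule nn_integral_PiM_trace_exp[OF J(1)])
    fix j K and \<xi> :: "'j \<Rightarrow> 'a"
    assume K: "insert j K \<subseteq> J" "j \<notin> K" and \<xi>: "\<xi> \<in> space (\<Pi>\<^sub>M j\<in>K. M)"
    have upd: "psd_op I (rank_one_update I (sum_op I c (- t') K (\<lambda>k. w (\<xi> k))) (- t') (w y))"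
      if y: "y \<in> space M" for y
    proof -
      \<comment> \<open>Positivity after the update is positivity for the enlarged sample, which is
        still indexed inside J.\<close>
      have \<xi>y: "\<xi>(j := y) \<in> space (\<Pi>\<^sub>M j\<in>insert j K. M)"
        using \<xi> y by (auto simp: space_PiM PiE_iff extensional_def)
      have "finite K" using K(1) J(1) by (auto intro: finite_subset)
      from psd[OF K(1) \<xi>y] show ?thesis
        unfolding sum_op_insert[OF \<open>finite K\<close> K(2)] .
    qed
    show "(\<integral>\<^sup>+y. ennreal (trace_exp I (rank_one_update I (sum_op I c (- t') K (\<lambda>k. w (\<xi> k))) (- t') (w y))) \<partial>M)
        \<le> ennreal (1 - \<eta> / d) * ennreal (trace_exp I (sum_op I c (- t') K (\<lambda>k. w (\<xi> k))))"
      using nn_integral_update_neg[OF psd[OF _ \<xi>] t'(1) upd] K unfolding \<rho>2 by simp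
  qed
  have E2: "E2 \<in> sets ?P" "measure ?P E2 \<le> (1 - \<eta> / d) ^ card J * (d * exp (c - a'))"
    unfolding E2_def using \<open>\<eta> / d \<le> 1\<close> by (intro trace_exp_tail[OF J(1) _ b2]; simp)+
  have "measure ?P E2 \<le> d * \<delta>"
  proof -
    have "(1 - \<eta> / d) ^ card J \<le> exp (- (\<eta> / d)) ^ card J"
      using \<open>\<eta> / d \<le> 1\<close> exp_ge_add_one_self[of "- (\<eta> / d)"] by (intro power_mono) auto
    also have "\<dots> = exp (?N * (- (\<eta> / d)))" by (simp only: exp_of_nat_mult)
    finally have "(1 - \<eta> / d) ^ card J * (d * exp (c - a')) \<le> exp (?N * (- (\<eta> / d))) * (d * exp (c - a'))"
      using d_pos by (intro mult_right_mono) auto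
    also have "\<dots> = d * exp (?N * (- (\<eta> / d)) + (c - a'))" by (simp only: exp_add mult.left_commute)
    also have "?N * (- (\<eta> / d)) + (c - a') = ?N / d * (- \<eta> - (1 - \<eta>) * ln (1 - \<eta>))"
      by (simp add: a'_def t'_def add_divide_distrib diff_divide_distrib algebra_simps)
    also have "d * exp (?N / d * (- \<eta> - (1 - \<eta>) * ln (1 - \<eta>))) \<le> d * exp (?N / d * (- (\<eta>\<^sup>2 / 3)))"
      using d_pos N ln_chernoff_lower[OF \<eta>]
      by (intro mult_left_mono iffD2[OF exp_le_cancel_iff]) auto
    also have "\<dots> = d * \<delta>" by (simp add: \<delta>_def field_simps)
    finally show ?thesis using E2(2) by simp
  qed

  show ?thesis
  proof (intro bexI conjI ballI allI)
    show "E1 \<union> E2 \<in> sets ?P" using E1(1) E2(1) by (rule sets.Un)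
    have "measure ?P (E1 \<union> E2) \<le> measure ?P E1 + measure ?P E2"
      by (rule measure_Un_le[OF E1(1) E2(1)])
    also have "\<dots> \<le> d * \<delta> + d * \<delta>" by (intro add_mono) fact+
    finally show "measure ?P (E1 \<union> E2) \<le> 2 * d * exp (- (?N * \<eta>\<^sup>2 / (3 * d)))"
      by (simp add: \<delta>_def)
  next
    fix \<xi> u assume \<xi>: "\<xi> \<in> space ?P - (E1 \<union> E2)"
    let ?n = "\<Sum>i\<in>I. (cmod (u i))\<^sup>2" and ?S = "\<Sum>j\<in>J. (cmod (ip I u (w (\<xi> j))))\<^sup>2"
    \<comment> \<open>If u vanishes on I, both sides are 0; so a violation comes with a nonzero u,
      as the Rayleigh quotient needs.\<close>
    have S0: "?S = 0" if "?n = 0"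
    proof -
      have "(cmod (ip I u (w (\<xi> j))))\<^sup>2 \<le> 0" for j
        using cmod_ip_le[of I u "w (\<xi> j)"] that by simp
      then show ?thesis by (intro sum.neutral ballI antisym) auto
    qed
    show "?S \<le> (1 + \<eta>) * (?N * ?n)"
    proof (rule ccontr)
      assume gt: "\<not> ?S \<le> (1 + \<eta>) * (?N * ?n)"
      have n0: "0 < ?n" using nn[of u] S0 gt by (cases "?n = 0") auto
      have "t * ((1 + \<eta>) * (?N * ?n)) \<le> t * ?S" using gt t(1) by (intro mult_left_mono) auto
      then have "a * ?n \<le> Re (ip I (sum_op I 0 t J (\<lambda>k. w (\<xi> k)) u) u)"
        unfolding Re_ip_sum_op by (simp add: a_def mult_ac)
      then have "exp a \<le> trace_exp I (sum_op I 0 t J (\<lambda>k. w (\<xi> k)))"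
        using t(1) by (intro exp_le_trace_exp[OF fin psd_op_sum_op_nonneg n0]) auto
      with \<xi> show False by (auto simp: E1_def)
    qed
    show "(1 - \<eta>) * (?N * ?n) \<le> ?S"
    proof (rule ccontr)
      assume lt: "\<not> (1 - \<eta>) * (?N * ?n) \<le> ?S"
      have n0: "0 < ?n" using nn[of u] S0 lt by (cases "?n = 0") auto
      have "t' * ?S \<le> t' * ((1 - \<eta>) * (?N * ?n))" using lt t'(1) by (intro mult_left_mono) auto
      then have "a' * ?n \<le> Re (ip I (sum_op I c (- t') J (\<lambda>k. w (\<xi> k)) u) u)"
        unfolding Re_ip_sum_op by (simp add: a'_def algebra_simps)
      then have "exp a' \<le> trace_exp I (sum_op I c (- t') J (\<lambda>k. w (\<xi> k)))"
        using \<xi> by (intro exp_le_trace_exp[OF fin psd n0]) auto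
      with \<xi> show False by (auto simp: E2_def)
    qed
  qed
qed

end

section \<open>Sampling inequality\<close>

text \<open>\<open>measure\<close> is 0 on nonmeasurable sets, so the good event itself has to be
  measurable. Both sides are continuous in the finitely many coordinates of u in I, which reduces
  the quantifier over all u to a countable dense set of coefficient vectors.\<close>

lemma quadratic_form_bounds_measurable:
  fixes w :: "'a \<Rightarrow> 'i \<Rightarrow> complex" and J :: "'j set"
  assumes fin: "finite I" "finite J"
    and meas: "\<And>i. i \<in> I \<Longrightarrow> (\<lambda>x. w x i) \<in> borel_measurable M"
  shows "{\<xi> \<in> space (\<Pi>\<^sub>M j\<in>J. M). \<forall>u.
      a * (\<Sum>i\<in>I. (cmod (u i))\<^sup>2) \<le> (\<Sum>j\<in>J. (cmod (ip I u (w (\<xi> j))))\<^sup>2) \<and>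
      (\<Sum>j\<in>J. (cmod (ip I u (w (\<xi> j))))\<^sup>2) \<le> b * (\<Sum>i\<in>I. (cmod (u i))\<^sup>2)}
    \<in> sets (\<Pi>\<^sub>M j\<in>J. M)"
proof -
  let ?P = "\<Pi>\<^sub>M j\<in>J. M"
  define R where "R \<xi> u \<longleftrightarrow>
      a * (\<Sum>i\<in>I. (cmod (u i))\<^sup>2) \<le> (\<Sum>j\<in>J. (cmod (ip I u (w (\<xi> j))))\<^sup>2) \<and>
      (\<Sum>j\<in>J. (cmod (ip I u (w (\<xi> j))))\<^sup>2) \<le> b * (\<Sum>i\<in>I. (cmod (u i))\<^sup>2)" for \<xi> :: "'j \<Rightarrow> 'a" and u
  obtain D :: "complex set" where D: "countable D" "\<And>X. open X \<Longrightarrow> X \<noteq> {} \<Longrightarrow> \<exists>d\<in>D. d \<in> X"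
    using countable_dense_exists by blast
  \<comment> \<open>Extensional functions: fixing the values off I keeps the set countable.\<close>
  define U where "U = (I \<rightarrow>\<^sub>E D)"
  have cU: "countable U" unfolding U_def by (intro countable_PiE fin D)
  have dense: "\<exists>v :: nat \<Rightarrow> 'i \<Rightarrow> complex. (\<forall>k. v k \<in> U) \<and> (\<forall>i\<in>I. (\<lambda>k. v k i) \<longlonglongrightarrow> u i)" for u
  proof -
    have "\<exists>z. z \<in> D \<and> dist z (u i) < 1 / real (Suc k)" for k i
      using D(2)[of "ball (u i) (1 / real (Suc k))"] by (auto simp: dist_commute)
    then obtain z where z: "\<And>k i. z k i \<in> D" "\<And>k i. dist (z k i) (u i) < 1 / real (Suc k)"
      using that[of "\<lambda>k i. SOME z. z \<in> D \<and> dist z (u i) < 1 / real (Suc k)"]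
      by (metis (mono_tags, lifting) someI_ex)
    have "(\<lambda>k. z k i) \<longlonglongrightarrow> u i" for i
    proof (rule tendsto_dist_iff[THEN iffD2], rule tendsto_sandwich[of "\<lambda>_. 0"])
      show "(\<lambda>k. 1 / real (Suc k)) \<longlonglongrightarrow> 0" by (rule LIMSEQ_Suc[OF lim_1_over_n])
      show "\<forall>\<^sub>F k in sequentially. dist (z k i) (u i) \<le> 1 / real (Suc k)"
        using z(2) less_imp_le by (intro always_eventually) blast
    qed auto
    then show ?thesis
      by (intro exI[of _ "\<lambda>k. restrict (z k) I"]) (auto simp: U_def z)
  qed
  have iff: "(\<forall>u. R \<xi> u) \<longleftrightarrow> (\<forall>u\<in>U. R \<xi> u)" for \<xi>
  proof (intro iffI allI)
    fix u assume R: "\<forall>u\<in>U. R \<xi> u"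
    obtain v where v: "\<And>k. v k \<in> U" "\<And>i. i \<in> I \<Longrightarrow> (\<lambda>k. v k i) \<longlonglongrightarrow> u i"
      using dense[of u] by blast
    have lim: "(\<lambda>k. c * (\<Sum>i\<in>I. (cmod (v k i))\<^sup>2)) \<longlonglongrightarrow> c * (\<Sum>i\<in>I. (cmod (u i))\<^sup>2)" for c
      by (intro tendsto_intros v)
    have lim': "(\<lambda>k. \<Sum>j\<in>J. (cmod (ip I (v k) (w (\<xi> j))))\<^sup>2) \<longlonglongrightarrow> (\<Sum>j\<in>J. (cmod (ip I u (w (\<xi> j))))\<^sup>2)"
      unfolding ip_def by (intro tendsto_intros v)
    show "R \<xi> u"
      unfolding R_def
    proof
      show "a * (\<Sum>i\<in>I. (cmod (u i))\<^sup>2) \<le> (\<Sum>j\<in>J. (cmod (ip I u (w (\<xi> j))))\<^sup>2)"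
        by (rule LIMSEQ_le[OF lim lim']) (use R v(1) in \<open>auto simp: R_def\<close>)
      show "(\<Sum>j\<in>J. (cmod (ip I u (w (\<xi> j))))\<^sup>2) \<le> b * (\<Sum>i\<in>I. (cmod (u i))\<^sup>2)"
        by (rule LIMSEQ_le[OF lim' lim]) (use R v(1) in \<open>auto simp: R_def\<close>)
    qed
  qed auto
  have m: "(\<lambda>\<xi>. \<Sum>j\<in>J. (cmod (ip I u (w (\<xi> j))))\<^sup>2) \<in> borel_measurable ?P" for u
  proof -
    have "(\<lambda>x. ip I u (w x)) \<in> borel_measurable M"
      unfolding ip_def
      by (intro borel_measurable_sum borel_measurable_times borel_measurable_const
          measurable_compose[OF meas cnj_borel_measurable])
    then have "(\<lambda>\<xi>. ip I u (w (\<xi> j))) \<in> borel_measurable ?P" if "j \<in> J" for j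
      by (rule measurable_compose[OF measurable_component_singleton[OF that]])
    then show ?thesis by (intro borel_measurable_sum) simp
  qed
  have "{\<xi> \<in> space ?P. R \<xi> u} \<in> sets ?P" for u
    unfolding R_def using m[of u] by measurable
  then have "space ?P - (\<Union>u\<in>U. space ?P - {\<xi> \<in> space ?P. R \<xi> u}) \<in> sets ?P"
    by (intro sets.Diff sets.top sets.countable_UN'[OF cU]) auto
  moreover have "space ?P - (\<Union>u\<in>U. space ?P - {\<xi> \<in> space ?P. R \<xi> u}) =
      {\<xi> \<in> space ?P. \<forall>u\<in>U. R \<xi> u}"
    by blast
  ultimately have "{\<xi> \<in> space ?P. \<forall>u\<in>U. R \<xi> u} \<in> sets ?P" by simp
  then have "{\<xi> \<in> space ?P. \<forall>u. R \<xi> u} \<in> sets ?P" by (simp only: iff)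
  then show ?thesis by (simp only: R_def)
qed

theorem theorem3p2:
  fixes q n N :: nat and \<eta> \<epsilon> :: real
  assumes "q \<ge> 2" and "CARD('n::finite) = q + 1"
    and "0 < \<eta>" and "\<eta> < 1" and "0 < \<epsilon>" and "\<epsilon> < 1"
    and "real N >
      ln (2 * real (complex_dim (spherical_harmonics_upto n :: (real ^ 'n \<Rightarrow> complex) set)) / \<epsilon>)
      * (3 * real (complex_dim (spherical_harmonics_upto n :: (real ^ 'n \<Rightarrow> complex) set)) / \<eta>\<^sup>2)"
  shows "measure (\<Pi>\<^sub>M j\<in>{1..N}. (normalized_surface_measure :: (real ^ 'n) measure))
    {\<xi> \<in> space (\<Pi>\<^sub>M j\<in>{1..N}. (normalized_surface_measure :: (real ^ 'n) measure)).
       \<forall>P \<in> spherical_harmonics_upto n.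
         (1 - \<eta>) * (sphere_L2_norm P)\<^sup>2 \<le> 1 / real N * (\<Sum>j=1..N. (cmod (P (\<xi> j)))\<^sup>2) \<and>
         1 / real N * (\<Sum>j=1..N. (cmod (P (\<xi> j)))\<^sup>2) \<le> (1 + \<eta>) * (sphere_L2_norm P)\<^sup>2}
    > 1 - \<epsilon>"
proof -
  let ?V = "spherical_harmonics_upto n :: (real ^ 'n \<Rightarrow> complex) set"
  let ?\<sigma> = "normalized_surface_measure :: (real ^ 'n) measure"
  let ?P = "\<Pi>\<^sub>M j\<in>{1..N}. ?\<sigma>"
  obtain B :: "(real ^ 'n \<Rightarrow> complex) set" where B: "finite B" "B \<subseteq> ?V" "sphere_orthonormal B"
    and card: "card B = complex_dim ?V"
    and expand: "\<And>P. P \<in> ?V \<Longrightarrow> P = (\<lambda>x. \<Sum>b\<in>B. sphere_ip P b * b x)"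
    by (rule spherical_harmonics_orthonormal_basis[of n]) (rule that)
  have cont: "continuous_on (sphere 0 1) b" if "b \<in> B" for b
    using spherical_harmonics_upto_continuous(1) B(2) that by blast
  \<comment> \<open>The conjugate makes \<open>ip B u (w x)\<close> the value at x of the function
    with coefficients u.\<close>
  define w where "w = (\<lambda>(x :: real ^ 'n) (b :: real ^ 'n \<Rightarrow> complex). cnj (b x))"
  have meas: "(\<lambda>x. w x b) \<in> borel_measurable ?\<sigma>" if "b \<in> B" for b
    unfolding w_def by (intro continuous_on_sphere_measurable continuous_intros cont that)
  interpret isotropic_vectors ?\<sigma> B w
  proof (rule isotropic_vectors.intro[OF prob_space_normalized_surface_measure], unfold_locales)
    show "B \<noteq> {}"
    proof
      assume "B = {}"
      then have "P = 0" if "P \<in> ?V" for P using expand[OF that] by (simp add: fun_eq_iff)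
      then show False using spherical_harmonics_upto_nonzero[of n] by blast
    qed
    show "(\<Sum>b\<in>B. (cmod (w x b))\<^sup>2) = real (card B)" if "x \<in> space ?\<sigma>" for x
      using orthonormal_basis_square_sum[OF B expand, of x] that by (simp add: w_def)
    show "(CLINT x|?\<sigma>. w x b * cnj (w x c)) = (if b = c then 1 else 0)" if "b \<in> B" "c \<in> B" for b c
    proof -
      have "(CLINT x|?\<sigma>. w x b * cnj (w x c)) = sphere_ip c b"
        by (simp add: sphere_ip_def w_def mult.commute)
      then show ?thesis using B(3) that by (auto simp: sphere_orthonormal_def)
    qed
  qed (fact B(1) meas)+
  interpret P: prob_space ?P by (rule prob_space_PiM) (rule prob_space_axioms)
  define L where "L = ln (2 * d / \<epsilon>)"
  have d1: "1 \<le> d" using d_pos by simp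
  have N: "L * (3 * d / \<eta>\<^sup>2) < real N" using assms(7) by (simp add: L_def card)
  have "1 < 2 * d / \<epsilon>" using d1 assms(5,6) by simp
  then have "0 < L" by (simp add: L_def)
  \<comment> \<open>A positive lower bound for N rules out N = 0, where 1 / N would be 0 by
    convention.\<close>
  then have "0 < L * (3 * d / \<eta>\<^sup>2)" using d_pos assms(3) by simp
  with N have N0: "0 < real N" by linarith

  define G where "G = {\<xi> \<in> space ?P. \<forall>u.
      ((1 - \<eta>) * real N) * (\<Sum>b\<in>B. (cmod (u b))\<^sup>2) \<le> (\<Sum>j=1..N. (cmod (ip B u (w (\<xi> j))))\<^sup>2) \<and>
      (\<Sum>j=1..N. (cmod (ip B u (w (\<xi> j))))\<^sup>2) \<le> ((1 + \<eta>) * real N) * (\<Sum>b\<in>B. (cmod (u b))\<^sup>2)}"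
  have G: "G \<in> sets ?P"
    unfolding G_def by (rule quadratic_form_bounds_measurable[OF B(1) _ meas]) auto
  \<comment> \<open>Expansion in the orthonormal basis matches functions P with coefficient vectors
    u, turning the squared L2 norm into the squared Euclidean norm.\<close>
  have G_iff: "(\<forall>P \<in> ?V.
         (1 - \<eta>) * (sphere_L2_norm P)\<^sup>2 \<le> 1 / real N * (\<Sum>j=1..N. (cmod (P (\<xi> j)))\<^sup>2) \<and>
         1 / real N * (\<Sum>j=1..N. (cmod (P (\<xi> j)))\<^sup>2) \<le> (1 + \<eta>) * (sphere_L2_norm P)\<^sup>2) \<longleftrightarrow>
     (\<forall>u.
      ((1 - \<eta>) * real N) * (\<Sum>b\<in>B. (cmod (u b))\<^sup>2) \<le> (\<Sum>j=1..N. (cmod (ip B u (w (\<xi> j))))\<^sup>2) \<and>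
      (\<Sum>j=1..N. (cmod (ip B u (w (\<xi> j))))\<^sup>2) \<le> ((1 + \<eta>) * real N) * (\<Sum>b\<in>B. (cmod (u b))\<^sup>2))"
    (is "(\<forall>P\<in>?V. ?Q P) \<longleftrightarrow> (\<forall>u. ?R u)") for \<xi> :: "nat \<Rightarrow> real ^ 'n"
  proof -
    have eq: "?Q (\<lambda>x. \<Sum>b\<in>B. u b * b x) \<longleftrightarrow> ?R u" for u
    proof -
      have "(\<Sum>b\<in>B. u b * b (\<xi> j)) = ip B u (w (\<xi> j))" for j
        by (simp add: ip_def w_def)
      moreover have "(sphere_L2_norm (\<lambda>x. \<Sum>b\<in>B. u b * b x))\<^sup>2 = (\<Sum>b\<in>B. (cmod (u b))\<^sup>2)"
        by (rule sphere_L2_norm_orthonormal_sum[OF B(1,3) cont])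
      ultimately show ?thesis
        using N0 by (simp only:) (simp add: field_simps)
    qed
    have mem: "(\<lambda>x. \<Sum>b\<in>B. u b * b x) \<in> ?V" for u
      using B(2) by (intro subspace_sum_mult subspace_spherical_harmonics_upto) auto
    show ?thesis
    proof (intro iffI allI ballI)
      fix u assume "\<forall>P\<in>?V. ?Q P"
      from bspec[OF this mem[of u]] show "?R u" by (simp only: eq)
    next
      fix P assume R: "\<forall>u. ?R u" and P: "P \<in> ?V"
      obtain u where u: "P = (\<lambda>x. \<Sum>b\<in>B. u b * b x)" using expand[OF P] by blast
      show "?Q P" unfolding u eq by (rule spec[OF R])
    qed
  qed
  obtain E where E: "E \<in> sets ?P" "measure ?P E \<le> 2 * d * exp (- (real N * \<eta>\<^sup>2 / (3 * d)))"
    and good: "space ?P - E \<subseteq> G"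
  proof -
    have "finite {1..N}" "{1..N} \<noteq> {}" using N0 by auto
    from matrix_chernoff[OF this assms(3,4)] obtain E where E: "E \<in> sets ?P"
      "measure ?P E \<le> 2 * d * exp (- (real N * \<eta>\<^sup>2 / (3 * d)))"
      and good: "\<forall>\<xi> \<in> space ?P - E. \<forall>u.
        (1 - \<eta>) * (real N * (\<Sum>b\<in>B. (cmod (u b))\<^sup>2)) \<le> (\<Sum>j=1..N. (cmod (ip B u (w (\<xi> j))))\<^sup>2) \<and>
        (\<Sum>j=1..N. (cmod (ip B u (w (\<xi> j))))\<^sup>2) \<le> (1 + \<eta>) * (real N * (\<Sum>b\<in>B. (cmod (u b))\<^sup>2))"
      by auto
    have "space ?P - E \<subseteq> G" unfolding G_def mult.assoc using good by blast
    with E show thesis by (rule that)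
  qed
  \<comment> \<open>The hypothesis on N is exactly the condition 2 d exp (- N \<eta>^2 / (3 d)) <
    \<epsilon>.\<close>
  have "L < real N * \<eta>\<^sup>2 / (3 * d)" using N d_pos assms(3) by (simp add: field_simps)
  then have "exp (- (real N * \<eta>\<^sup>2 / (3 * d))) < exp (- L)" by simp
  also have "exp (- L) = \<epsilon> / (2 * d)"
    using d_pos assms(5) by (simp add: L_def exp_minus)
  finally have "2 * d * exp (- (real N * \<eta>\<^sup>2 / (3 * d))) < \<epsilon>"
    using d_pos by (simp add: field_simps)
  with E(2) have "measure ?P E < \<epsilon>" by simp
  then have "1 - \<epsilon> < measure ?P (space ?P - E)" using P.prob_compl[OF E(1)] by simp
  also have "\<dots> \<le> measure ?P G" by (rule P.finite_measure_mono[OF good G])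
  finally have "1 - \<epsilon> < measure ?P G" .
  then show ?thesis unfolding G_iff G_def[symmetric] .
qed

end
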